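(* If $N\ge1$ and $\Omega\subsetneq\mathbb R^N$ is a non-empty bounded open convex set, then $$\lim_{s\to1^-}\ \limsup_{p\to1^+}\ \frac{\mathfrak h_{s,p}(\Omega)}{\mathfrak h_{s,p}(\mathbb H^N_+)}=\frac12.$$
   Context: For $N\ge1$, a non-empty open set $\Omega\subsetneq\mathbb R^N$ and $x\in\Omega$, $d_\Omega(x)=\inf_{y\in\partial\Omega}|x-y|$. $C^\infty_0(\Omega)$ is the set of smooth real functions on $\mathbb R^N$ with compact support contained in $\Omega$. For $s\in(0,1)$, $p\in[1,\infty)$ and measurable $u$ on $\mathbb R^N$, $$[u]^p_{W^{s,p}(\mathbb R^N)}=\int_{\mathbb R^N}\int_{\mathbb R^N}\frac{|u(x)-u(y)|^p}{|x-y|^{N+sp}}\,dx\,dy,$$ $$\mathfrak h_{s,p}(\Omega)=\inf_{u\in C^\infty_0(\Omega)}\Big\{[u]^p_{W^{s,p}(\mathbb R^N)}:\int_\Omega\frac{|u|^p}{d_\Omega^{sp}}\,dx=1\Big\}\in[0,\infty).$$ $\mathbb H^1_+=(0,\infty)$ and $\mathbb H^N_+=\mathbb R^{N-1}\times(0,\infty)$ for $N\ge2$. *)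

theory Defs
  imports "HOL-Analysis.Analysis"
begin

primrec times_differentiable :: "nat \<Rightarrow> (real ^ 'n \<Rightarrow> real) \<Rightarrow> bool" where
  "times_differentiable 0 u \<longleftrightarrow> continuous_on UNIV u"
| "times_differentiable (Suc m) u \<longleftrightarrow>
     (\<forall>x. u differentiable (at x)) \<and>
     (\<forall>v. times_differentiable m (\<lambda>x. frechet_derivative u (at x) v))"

definition smooth :: "(real ^ 'n \<Rightarrow> real) \<Rightarrow> bool" where
  "smooth u \<longleftrightarrow> (\<forall>m. times_differentiable m u)"

definition test_functions :: "(real ^ 'n) set \<Rightarrow> (real ^ 'n \<Rightarrow> real) set" where
  "test_functions \<Omega> = {u. smooth u \<and> compact (closure {x. u x \<noteq> 0}) \<and> closure {x. u x \<noteq> 0} \<subseteq> \<Omega>}"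

abbreviation boundary_dist :: "(real ^ 'n) set \<Rightarrow> real ^ 'n \<Rightarrow> real" where
  "boundary_dist \<Omega> x \<equiv> infdist x (frontier \<Omega>)"

(* The p-th power of the seminorm.  On the diagonal x = y the integrand is 0, by 0 / 0 = 0;
   the diagonal is a null set. *)
definition gagliardo_pow :: "real \<Rightarrow> real \<Rightarrow> (real ^ 'n \<Rightarrow> real) \<Rightarrow> ennreal" where
  "gagliardo_pow s p u =
     (\<integral>\<^sup>+y. (\<integral>\<^sup>+x. ennreal (\<bar>u x - u y\<bar> powr p / norm (x - y) powr (real CARD('n) + s * p))
        \<partial>lborel) \<partial>lborel)"

definition hardy_weighted_integral ::
    "real \<Rightarrow> real \<Rightarrow> (real ^ 'n) set \<Rightarrow> (real ^ 'n \<Rightarrow> real) \<Rightarrow> ennreal" where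
  "hardy_weighted_integral s p \<Omega> u =
     (\<integral>\<^sup>+x\<in>\<Omega>. ennreal (\<bar>u x\<bar> powr p / boundary_dist \<Omega> x powr (s * p)) \<partial>lborel)"

definition hardy_const :: "real \<Rightarrow> real \<Rightarrow> (real ^ 'n) set \<Rightarrow> ennreal" where
  "hardy_const s p \<Omega> =
     (INF u \<in> {u \<in> test_functions \<Omega>. hardy_weighted_integral s p \<Omega> u = 1}. gagliardo_pow s p u)"

(* A finite index type has no distinguished last coordinate, so the coordinate k that is
   required to be positive is a parameter. *)
definition half_space :: "'n \<Rightarrow> (real ^ 'n) set" where
  "half_space k = {x. 0 < x $ k}"

end

theory Submission
  imports Defs
begin

text \<open>Put \<open>\<sigma> = s * p\<close>, let \<open>d\<close> be the distance to the boundary, and let \<open>\<kappa>\<close> be the integral of \<open>\<bar>z\<bar>\<^sup>-\<^sup>N\<^sup>-\<^sup>\<sigma>\<close> over a half-space at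
  distance \<open>1\<close> from the origin (\<open>half_space_mass\<close>). When first \<open>p\<close> and then \<open>s\<close> tends to \<open>1\<close>, the Hardy constant
  of a bounded convex set is asymptotic to \<open>2 * \<kappa>\<close> and that of a half-space to \<open>4 * \<kappa>\<close>; the number \<open>\<kappa>\<close> cancels
  from the quotient.

  For the lower bounds, the complement of a convex set contains a half-space at distance \<open>d x\<close> from \<open>x\<close>. So the pairs with
  one point outside already contribute \<open>2 * \<kappa>\<close> times the weighted integral (\<open>hardy_const_convex_ge\<close>). In a half-space
  the pairs inside contribute the same amount once more: for \<open>p\<close> close to \<open>1\<close> one compares \<open>\<bar>u x - u y\<bar>\<close> with
  \<open>\<bar>u x\<bar> - \<bar>u y\<bar>\<close> for \<open>y\<close> above \<open>x\<close>, and after cancellation each value \<open>\<bar>u x\<bar>\<close> carries the kernel mass of another half-space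
  at distance \<open>d x\<close> (\<open>hardy_const_half_space_ge\<close>).

  For the upper bounds, the competitors can be close to indicator functions, since \<open>\<sigma> < 1\<close> in the limit. They are smooth
  cut-offs \<open>\<phi>\<close> that vanish outside a set \<open>K\<close> and are \<open>1\<close> at depth \<open>\<delta>\<close> and more. As \<open>\<integral> \<bar>z \<bullet> e\<bar> * \<bar>z\<bar>\<^sup>-\<^sup>N\<^sup>-\<^sup>\<sigma>\<close> over the unit ball
  is at most \<open>2 * \<kappa> / (1 - \<sigma>)\<close> for unit vectors \<open>e\<close>, the seminorm is at most \<open>2 * \<kappa> / (1 - \<sigma>)\<close> times the integral of
  \<open>\<bar>\<nabla>\<phi>\<bar>\<close>, up to a bounded error (\<open>gagliardo_pow_le\<close>). That integral is about the volume of the layer of depth \<open>\<delta>\<close>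
  divided by \<open>\<delta>\<close>, that is, the perimeter of \<open>K\<close>. The weighted integral is about \<open>1 / (1 - \<sigma>)\<close> times the rate at which
  the volume of \<open>{x \<in> K. d x \<le> t}\<close> grows, that is, the part of the perimeter that \<open>K\<close> shares with the
  ambient set. The quotient is \<open>2 * \<kappa>\<close> times the ratio of the two rates (\<open>eventually_hardy_const_le\<close>). For \<open>K = \<Omega>\<close> the rates
  agree (\<open>exists_deep_layers_convex\<close>). For the half-space \<open>K\<close> is a flat box on the boundary hyperplane, and the ratio is
  close to \<open>2\<close> because the top of the box is not on the hyperplane (\<open>exists_deep_layers_half_space\<close>).\<close>

section \<open>Affine changes of variables for Lebesgue measure\<close>

lemma nn_integral_lborel_translate:
  fixes f :: "'a::euclidean_space \<Rightarrow> ennreal"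
  assumes [measurable]: "f \<in> borel_measurable borel"
  shows "(\<integral>\<^sup>+x. f (c + x) \<partial>lborel) = (\<integral>\<^sup>+x. f x \<partial>lborel)"
proof -
  have "(\<integral>\<^sup>+x. f x \<partial>lborel) = (\<integral>\<^sup>+x. f x \<partial>distr lborel borel ((+) c))"
    by (simp add: lborel_distr_plus)
  also have "\<dots> = (\<integral>\<^sup>+x. f (c + x) \<partial>lborel)"
    by (rule nn_integral_distr) auto
  finally show ?thesis by simp
qed

lemma nn_integral_lborel_affine:
  fixes f :: "'a::euclidean_space \<Rightarrow> ennreal"
  assumes [measurable]: "f \<in> borel_measurable borel" and "c \<noteq> 0"
  shows "(\<integral>\<^sup>+x. f x \<partial>lborel) = ennreal (\<bar>c\<bar> ^ DIM('a)) * (\<integral>\<^sup>+x. f (t + c *\<^sub>R x) \<partial>lborel)"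
  by (subst lborel_affine[OF assms(2), of t])
     (simp add: nn_integral_density nn_integral_distr nn_integral_cmult)

lemma nn_integral_lborel_minus:
  fixes f :: "'a::euclidean_space \<Rightarrow> ennreal"
  assumes [measurable]: "f \<in> borel_measurable borel"
  shows "(\<integral>\<^sup>+x. f (c - x) \<partial>lborel) = (\<integral>\<^sup>+x. f x \<partial>lborel)"
  using nn_integral_lborel_affine[OF assms, of "-1" c] by simp

text \<open>A translation-invariant measure is a multiple of Lebesgue measure, and a rotation fixes the
  volume of the unit ball. Tonelli's theorem gives both at once: integrate
  \<open>f (x + T y) * indicator (ball 0 1) y\<close> in either order.\<close>

lemma nn_integral_lborel_orthogonal:
  fixes f :: "'a::euclidean_space \<Rightarrow> ennreal"
  assumes [measurable]: "f \<in> borel_measurable borel" and T: "orthogonal_transformation (T :: 'a \<Rightarrow> 'a)"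
  shows "(\<integral>\<^sup>+x. f (T x) \<partial>lborel) = (\<integral>\<^sup>+x. f x \<partial>lborel)"
proof -
  let ?b = "\<lambda>y:: 'a. indicator (ball 0 1) y :: ennreal"
  define S where "S = inv T"
  have TS: "T (S x) = x" for x
    using orthogonal_transformation_surj[OF T] unfolding S_def by (rule surj_f_inv_f)
  have lin: "linear T" "linear S"
    using orthogonal_transformation_linear[OF T] orthogonal_transformation_inj[OF T]
    unfolding S_def by (auto intro: inj_linear_imp_inv_linear)
  have [measurable]: "T \<in> borel_measurable borel" "S \<in> borel_measurable borel"
    using lin by (auto intro!: borel_measurable_continuous_onI linear_continuous_on
        simp: linear_conv_bounded_linear)
  have [measurable]: "ball (0::'a) 1 \<in> sets borel" by simp
  let ?V = "emeasure lborel (ball (0:: 'a) 1)"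
  have V: "(\<integral>\<^sup>+y. ?b y \<partial>lborel) = ?V" by simp
  have "(\<integral>\<^sup>+x. f x \<partial>lborel) * ?V = (\<integral>\<^sup>+y. (\<integral>\<^sup>+x. f x \<partial>lborel) * ?b y \<partial>lborel)"
    by (subst nn_integral_cmult) (auto intro!: borel_measurable_indicator)
  also have "\<dots> = (\<integral>\<^sup>+y. (\<integral>\<^sup>+x. f (T y + x) \<partial>lborel) * ?b y \<partial>lborel)"
    by (simp add: nn_integral_lborel_translate)
  also have "\<dots> = (\<integral>\<^sup>+y. (\<integral>\<^sup>+x. f (T y + x) * ?b y \<partial>lborel) \<partial>lborel)"
    by (simp add: nn_integral_multc)
  also have "\<dots> = (\<integral>\<^sup>+x. (\<integral>\<^sup>+y. f (T y + x) * ?b y \<partial>lborel) \<partial>lborel)"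
    by (rule lborel_pair.Fubini') measurable
  also have "\<dots> = (\<integral>\<^sup>+x. (\<integral>\<^sup>+y. f (T y) * ?b (- S x + y) \<partial>lborel) \<partial>lborel)"
  proof (rule nn_integral_cong)
    fix x
    have eq: "T (- S x + y) + x = T y" for y
      using lin by (simp add: linear_diff TS)
    have "(\<integral>\<^sup>+y. f (T y + x) * ?b y \<partial>lborel)
        = (\<integral>\<^sup>+y. f (T (- S x + y) + x) * ?b (- S x + y) \<partial>lborel)"
      by (subst nn_integral_lborel_translate[of "\<lambda>y. f (T y + x) * ?b y"]) auto
    then show "(\<integral>\<^sup>+y. f (T y + x) * ?b y \<partial>lborel) = (\<integral>\<^sup>+y. f (T y) * ?b (- S x + y) \<partial>lborel)"
      unfolding eq .
  qed
  also have "\<dots> = (\<integral>\<^sup>+y. (\<integral>\<^sup>+x. f (T y) * ?b (- S x + y) \<partial>lborel) \<partial>lborel)"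
    by (rule lborel_pair.Fubini') measurable
  also have "\<dots> = (\<integral>\<^sup>+y. f (T y) * ?V \<partial>lborel)"
  proof (rule nn_integral_cong)
    fix y
    have "norm (- S x + y) = norm (T y - x)" for x
    proof -
      have "norm (- S x + y) = norm (T (- S x + y))"
        using T by (simp add: orthogonal_transformation_norm)
      also have "T (- S x + y) = T y - x"
        using lin by (simp add: linear_diff TS)
      finally show ?thesis .
    qed
    then have "?b (- S x + y) = ?b (T y - x)" for x by (simp add: indicator_def)
    then have "(\<integral>\<^sup>+x. f (T y) * ?b (- S x + y) \<partial>lborel) = f (T y) * (\<integral>\<^sup>+x. ?b (T y - x) \<partial>lborel)"
      by (simp add: nn_integral_cmult)
    also have "(\<integral>\<^sup>+x. ?b (T y - x) \<partial>lborel) = ?V"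
      by (subst nn_integral_lborel_minus) auto
    finally show "(\<integral>\<^sup>+x. f (T y) * ?b (- S x + y) \<partial>lborel) = f (T y) * ?V" .
  qed
  also have "\<dots> = (\<integral>\<^sup>+y. f (T y) \<partial>lborel) * ?V"
    by (simp add: nn_integral_multc)
  finally have eq: "(\<integral>\<^sup>+x. f x \<partial>lborel) * ?V = (\<integral>\<^sup>+y. f (T y) \<partial>lborel) * ?V" .
  have "?V \<noteq> 0" "?V \<noteq> top"
    using emeasure_lborel_ball_finite[of "0:: 'a" 1] content_ball_pos[of 1 "0:: 'a"]
    by (auto simp: measure_def)
  then have "x * ?V / ?V = x" for x
    by (simp add: ennreal_times_divide[symmetric] ennreal_divide_self less_top[symmetric])
  with eq show ?thesis by metis
qed

section \<open>Kernel mass of half-spaces\<close>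

definition riesz_kernel :: "real \<Rightarrow> real ^ 'n \<Rightarrow> real" where
  "riesz_kernel \<sigma> z = norm z powr - (real CARD('n) + \<sigma>)"

lemma riesz_kernel_nonneg [simp]: "0 \<le> riesz_kernel \<sigma> z"
  by (simp add: riesz_kernel_def)

lemma riesz_kernel_minus [simp]: "riesz_kernel \<sigma> (- z) = riesz_kernel \<sigma> z"
  by (simp add: riesz_kernel_def)

lemma riesz_kernel_minus_commute: "riesz_kernel \<sigma> (x - y) = riesz_kernel \<sigma> (y - x)"
  by (simp add: riesz_kernel_def norm_minus_commute)

lemma riesz_kernel_measurable [measurable]: "riesz_kernel \<sigma> \<in> borel_measurable borel"
  unfolding riesz_kernel_def by measurable

text \<open>The constant by which everything is measured: a half-space at distance \<open>t\<close> from a point carries the kernel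
  mass \<open>t\<^sup>-\<^sup>\<sigma>\<close> times this number, whatever its normal direction.\<close>

definition half_space_mass :: "real ^ 'n \<Rightarrow> real \<Rightarrow> ennreal" where
  "half_space_mass e \<sigma> = (\<integral>\<^sup>+z\<in>{z. 1 < z \<bullet> e}. ennreal (riesz_kernel \<sigma> z) \<partial>lborel)"

lemma half_space_mass_cong:
  fixes e e' :: "real ^ 'n"
  assumes "norm e = 1" "norm e' = 1"
  shows "half_space_mass e \<sigma> = half_space_mass e' \<sigma>"
proof -
  obtain T where T: "orthogonal_transformation T" "T e = e'"
    using orthogonal_transformation_exists[of e e'] assms by auto
  have "half_space_mass e' \<sigma>
      = (\<integral>\<^sup>+z. ennreal (riesz_kernel \<sigma> (T z)) * indicator {z. 1 < z \<bullet> e'} (T z) \<partial>lborel)"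
    unfolding half_space_mass_def
    by (rule nn_integral_lborel_orthogonal[OF _ T(1), symmetric]) measurable
  also have "\<dots> = half_space_mass e \<sigma>"
    unfolding half_space_mass_def
  proof (rule nn_integral_cong)
    fix z
    have "T z \<bullet> e' = z \<bullet> e"
      using T by (metis orthogonal_transformation_def)
    moreover have "riesz_kernel \<sigma> (T z) = riesz_kernel \<sigma> z"
      using T by (simp add: riesz_kernel_def orthogonal_transformation_norm)
    ultimately show "ennreal (riesz_kernel \<sigma> (T z)) * indicator {z. 1 < z \<bullet> e'} (T z)
        = ennreal (riesz_kernel \<sigma> z) * indicator {z. 1 < z \<bullet> e} z"
      by (simp add: indicator_def)
  qed
  finally show ?thesis by simp
qed

lemma nn_integral_riesz_kernel_half_space:
  fixes e :: "real ^ 'n"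
  assumes "0 < t"
  shows "(\<integral>\<^sup>+z\<in>{z. t < z \<bullet> e}. ennreal (riesz_kernel \<sigma> z) \<partial>lborel)
       = ennreal (t powr - \<sigma>) * half_space_mass e \<sigma>"
proof -
  have "(\<integral>\<^sup>+z\<in>{z. t < z \<bullet> e}. ennreal (riesz_kernel \<sigma> z) \<partial>lborel)
      = ennreal (\<bar>t\<bar> ^ CARD('n)) *
        (\<integral>\<^sup>+z. ennreal (riesz_kernel \<sigma> (0 + t *\<^sub>R z)) * indicator {z. t < z \<bullet> e} (0 + t *\<^sub>R z) \<partial>lborel)"
    using nn_integral_lborel_affine
        [of "\<lambda>z. ennreal (riesz_kernel \<sigma> z) * indicator {z. t < z \<bullet> e} z" t 0] assms
    by simp
  also have "(\<lambda>z. ennreal (riesz_kernel \<sigma> (0 + t *\<^sub>R z)) * indicator {z. t < z \<bullet> e} (0 + t *\<^sub>R z))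
      = (\<lambda>z. ennreal (t powr - (real CARD('n) + \<sigma>)) *
             (ennreal (riesz_kernel \<sigma> z) * indicator {z. 1 < z \<bullet> e} z))"
    using assms
    by (auto simp: fun_eq_iff indicator_def riesz_kernel_def powr_mult ennreal_mult'')
  also have "(\<integral>\<^sup>+z. ennreal (t powr - (real CARD('n) + \<sigma>)) *
             (ennreal (riesz_kernel \<sigma> z) * indicator {z. 1 < z \<bullet> e} z) \<partial>lborel)
      = ennreal (t powr - (real CARD('n) + \<sigma>)) * half_space_mass e \<sigma>"
    unfolding half_space_mass_def by (rule nn_integral_cmult) measurable
  also have "ennreal (\<bar>t\<bar> ^ CARD('n)) * (ennreal (t powr - (real CARD('n) + \<sigma>)) * half_space_mass e \<sigma>)
      = ennreal (t powr real CARD('n) * t powr - (real CARD('n) + \<sigma>)) * half_space_mass e \<sigma>"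
    using assms by (simp add: ennreal_mult'' mult.assoc powr_realpow)
  also have "t powr real CARD('n) * t powr - (real CARD('n) + \<sigma>) = t powr - \<sigma>"
    by (simp add: powr_add[symmetric])
  finally show ?thesis .
qed

lemma nn_integral_powr_tail:
  fixes a w :: real
  assumes "0 < a" "0 < w"
  shows "(\<integral>\<^sup>+t\<in>{w..}. ennreal (a * t powr (- a - 1)) \<partial>lborel) = ennreal (w powr - a)"
proof -
  have "(\<integral>\<^sup>+t\<in>{w..}. ennreal (a * t powr (- a - 1)) \<partial>lborel) = ennreal (0 - (- (w powr - a)))"
  proof (rule nn_integral_FTC_atLeast[where F = "\<lambda>t. - (t powr - a)"])
    show "((\<lambda>t. - (t powr - a)) has_real_derivative a * x powr (- a - 1)) (at x)" if "w \<le> x" for x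
      using that assms by (auto intro!: derivative_eq_intros)
    show "((\<lambda>t. - (t powr - a)) \<longlongrightarrow> 0) at_top"
      using tendsto_minus[OF tendsto_neg_powr[OF _ filterlim_ident, of "- a"]] assms by simp
  qed (use assms in auto)
  then show ?thesis by simp
qed

text \<open>Tonelli's theorem applied to \<open>w\<^sup>-\<^sup>a = \<integral> a * t\<^sup>-\<^sup>a\<^sup>-\<^sup>1 dt\<close> over \<open>t \<ge> w\<close>.\<close>

lemma nn_integral_powr_layer_cake:
  fixes w :: "'a::euclidean_space \<Rightarrow> real"
  assumes [measurable]: "w \<in> borel_measurable borel" "A \<in> sets borel"
    and pos: "\<And>x. x \<in> A \<Longrightarrow> 0 < w x" and a: "0 < a"
  shows "(\<integral>\<^sup>+x\<in>A. ennreal (w x powr - a) \<partial>lborel)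
       = (\<integral>\<^sup>+t\<in>{0<..}. ennreal (a * t powr (- a - 1)) * emeasure lborel {x \<in> A. w x \<le> t} \<partial>lborel)"
proof -
  have "(\<integral>\<^sup>+x\<in>A. ennreal (w x powr - a) \<partial>lborel)
      = (\<integral>\<^sup>+x. (\<integral>\<^sup>+t. ennreal (a * t powr (- a - 1)) * indicator {t. 0 < t \<and> w x \<le> t} t
            * indicator A x \<partial>lborel) \<partial>lborel)"
  proof (rule nn_integral_cong)
    fix x
    show "ennreal (w x powr - a) * indicator A x
        = (\<integral>\<^sup>+t. ennreal (a * t powr (- a - 1)) * indicator {t. 0 < t \<and> w x \<le> t} t
            * indicator A x \<partial>lborel)"
    proof (cases "x \<in> A")
      case True
      then have "{t. 0 < t \<and> w x \<le> t} = {w x..}" using pos[of x] by auto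
      then show ?thesis
        using nn_integral_powr_tail[OF a pos[OF True]] True by simp
    qed simp
  qed
  also have "\<dots> = (\<integral>\<^sup>+t. (\<integral>\<^sup>+x. ennreal (a * t powr (- a - 1)) * indicator {t. 0 < t \<and> w x \<le> t} t
            * indicator A x \<partial>lborel) \<partial>lborel)"
    by (rule lborel_pair.Fubini') measurable
  also have "\<dots> = (\<integral>\<^sup>+t\<in>{0<..}. ennreal (a * t powr (- a - 1)) * emeasure lborel {x \<in> A. w x \<le> t} \<partial>lborel)"
  proof (rule nn_integral_cong)
    fix t
    have "(\<lambda>x. ennreal (a * t powr (- a - 1)) * indicator {t. 0 < t \<and> w x \<le> t} t * indicator A x)
        = (\<lambda>x. ennreal (a * t powr (- a - 1)) * indicator {0<..} t * indicator {x \<in> A. w x \<le> t} x)"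
      by (auto simp: fun_eq_iff indicator_def)
    then show "(\<integral>\<^sup>+x. ennreal (a * t powr (- a - 1)) * indicator {t. 0 < t \<and> w x \<le> t} t
            * indicator A x \<partial>lborel)
        = ennreal (a * t powr (- a - 1)) * emeasure lborel {x \<in> A. w x \<le> t} * indicator {0<..} t"
      by (simp add: nn_integral_cmult mult_ac)
  qed
  finally show ?thesis .
qed

text \<open>By the layer-cake formula the integral becomes \<open>\<integral> t powr (- N - \<sigma> - 1) * t\<^sup>N dt\<close> over \<open>t \<ge> 1\<close>, since balls of
  radius \<open>t\<close> have volume proportional to \<open>t\<^sup>N\<close>.\<close>

lemma riesz_kernel_tail_finite:
  assumes "0 < \<sigma>"
  shows "(\<integral>\<^sup>+z\<in>{z :: real ^ 'n. 1 \<le> norm z}. ennreal (riesz_kernel \<sigma> z) \<partial>lborel) < \<infinity>"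
proof -
  let ?N = "real CARD('n)"
  let ?A = "{z :: real ^ 'n. 1 \<le> norm z}"
  let ?c = "measure lborel (cball (0 :: real ^ 'n) 1)"
  have N: "0 < ?N" by simp
  have bound: "emeasure lborel {z \<in> ?A. norm z \<le> t} \<le> ennreal (?c * t powr ?N)" if "1 \<le> t" for t
  proof -
    have "emeasure lborel {z \<in> ?A. norm z \<le> t} \<le> emeasure lborel (cball (0 :: real ^ 'n) t)"
      by (rule emeasure_mono) auto
    also have "\<dots> = ennreal (measure lborel (cball (0 :: real ^ 'n) t))"
      by (rule emeasure_eq_ennreal_measure) (metis emeasure_lborel_cball_finite less_irrefl infinity_ennreal_def)
    also have "measure lborel (cball (0 :: real ^ 'n) t) = ?c * t powr ?N"
      using that content_ball_conv_unit_ball[of t "0 :: real ^ 'n"]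
      by (simp add: powr_realpow content_cball_conv_ball)
    finally show ?thesis .
  qed
  have "(\<integral>\<^sup>+z\<in>?A. ennreal (riesz_kernel \<sigma> z) \<partial>lborel)
      = (\<integral>\<^sup>+t\<in>{0<..}. ennreal ((?N + \<sigma>) * t powr (- (?N + \<sigma>) - 1)) * emeasure lborel {z \<in> ?A. norm z \<le> t} \<partial>lborel)"
    unfolding riesz_kernel_def
    by (rule nn_integral_powr_layer_cake) (use assms N in \<open>auto intro: add_pos_pos\<close>)
  also have "\<dots> \<le> (\<integral>\<^sup>+t\<in>{1..}. ennreal (?c * (?N + \<sigma>) / \<sigma>) * ennreal (\<sigma> * t powr (- \<sigma> - 1)) \<partial>lborel)"
  proof (rule nn_integral_mono)
    fix t
    show "ennreal ((?N + \<sigma>) * t powr (- (?N + \<sigma>) - 1)) * emeasure lborel {z \<in> ?A. norm z \<le> t} * indicator {0<..} t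
        \<le> ennreal (?c * (?N + \<sigma>) / \<sigma>) * ennreal (\<sigma> * t powr (- \<sigma> - 1)) * indicator {1..} t"
    proof (cases "1 \<le> t")
      case True
      have "ennreal ((?N + \<sigma>) * t powr (- (?N + \<sigma>) - 1)) * emeasure lborel {z \<in> ?A. norm z \<le> t}
          \<le> ennreal ((?N + \<sigma>) * t powr (- (?N + \<sigma>) - 1)) * ennreal (?c * t powr ?N)"
        by (intro mult_left_mono bound True) simp
      also have "\<dots> = ennreal ((?N + \<sigma>) * ?c * (t powr (- (?N + \<sigma>) - 1) * t powr ?N))"
        using assms by (subst ennreal_mult''[symmetric]) (auto simp: mult_ac)
      also have "t powr (- (?N + \<sigma>) - 1) * t powr ?N = t powr (- \<sigma> - 1)"
        by (simp add: powr_add[symmetric])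
      also have "ennreal ((?N + \<sigma>) * ?c * t powr (- \<sigma> - 1))
          = ennreal (?c * (?N + \<sigma>) / \<sigma>) * ennreal (\<sigma> * t powr (- \<sigma> - 1))"
        using assms by (subst ennreal_mult''[symmetric]) (auto simp: mult_ac)
      finally show ?thesis using True by simp
    next
      case False
      then have empty: "{z \<in> ?A. norm z \<le> t} = {}" by auto
      show ?thesis unfolding empty using False by simp
    qed
  qed
  also have "\<dots> = ennreal (?c * (?N + \<sigma>) / \<sigma>) * ennreal (1 powr - \<sigma>)"
    using nn_integral_powr_tail[OF assms, of 1]
    by (simp add: mult.assoc nn_integral_cmult)
  also have "\<dots> < \<infinity>"
    by (simp add: ennreal_mult''[symmetric])
  finally show ?thesis .
qed

lemma half_space_mass_finite:
  fixes e :: "real ^ 'n"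
  assumes "0 < \<sigma>" "norm e = 1"
  shows "half_space_mass e \<sigma> < \<infinity>"
proof -
  have "half_space_mass e \<sigma> \<le> (\<integral>\<^sup>+z\<in>{z :: real ^ 'n. 1 \<le> norm z}. ennreal (riesz_kernel \<sigma> z) \<partial>lborel)"
    unfolding half_space_mass_def
  proof (rule nn_integral_mono, rule mult_left_mono)
    fix z :: "real ^ 'n"
    have "z \<bullet> e \<le> norm z" using norm_cauchy_schwarz[of z e] assms by simp
    then show "indicator {z. 1 < z \<bullet> e} z \<le> (indicator {z. 1 \<le> norm z} z :: ennreal)"
      by (auto simp: indicator_def)
  qed simp
  also have "\<dots> < \<infinity>" by (rule riesz_kernel_tail_finite) fact
  finally show ?thesis .
qed

lemma half_space_mass_antimono:
  assumes "norm e = 1" "\<sigma> \<le> \<tau>"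
  shows "half_space_mass e \<tau> \<le> half_space_mass e \<sigma>"
  unfolding half_space_mass_def
proof (intro nn_integral_mono)
  fix z
  have "z \<bullet> e \<le> norm z" using norm_cauchy_schwarz[of z e] assms by simp
  then show "ennreal (riesz_kernel \<tau> z) * indicator {z. 1 < z \<bullet> e} z
      \<le> ennreal (riesz_kernel \<sigma> z) * indicator {z. 1 < z \<bullet> e} z"
    using assms by (auto simp: indicator_def riesz_kernel_def intro!: ennreal_leI powr_mono)
qed

lemma half_space_mass_pos:
  assumes "norm e = 1"
  shows "0 < half_space_mass e \<sigma>"
proof (rule ccontr)
  assume "\<not> 0 < half_space_mass e \<sigma>"
  then have 0: "half_space_mass e \<sigma> = 0" by simp
  let ?A = "{z. 1 < z \<bullet> e}"
  have "AE z in lborel. ennreal (riesz_kernel \<sigma> z) * indicator ?A z = 0"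
    using 0 unfolding half_space_mass_def by (subst (asm) nn_integral_0_iff_AE) auto
  then have "AE z in lborel. z \<notin> ?A"
    by eventually_elim (auto simp: indicator_def riesz_kernel_def split: if_splits)
  then have "?A \<in> null_sets lborel"
    by (subst AE_iff_null_sets) auto
  moreover have "open ?A"
    by (intro open_Collect_less continuous_intros)
  moreover have "2 *\<^sub>R e \<in> ?A"
    using assms by (simp add: dot_square_norm)
  ultimately show False
    using open_not_negligible[of ?A] null_sets_completionI[of ?A lborel]
    unfolding negligible_iff_null_sets by blast
qed

text \<open>A quantitative form of continuity from the right in the exponent: \<open>r\<^sup>-\<^sup>x \<ge> 1 - x * ln r\<close>, and the logarithm
  is absorbed by half of the exponent, \<open>ln r \<le> (2 / s) * r powr (s / 2)\<close>.\<close>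

lemma half_space_mass_ge:
  assumes "norm e = 1" "0 < s" "s \<le> \<sigma>"
  shows "half_space_mass e s \<le> half_space_mass e \<sigma> + ennreal ((\<sigma> - s) * (2 / s)) * half_space_mass e (s / 2)"
proof -
  have "half_space_mass e s
      \<le> (\<integral>\<^sup>+z. (ennreal (riesz_kernel \<sigma> z) * indicator {z. 1 < z \<bullet> e} z
          + ennreal ((\<sigma> - s) * (2 / s)) * (ennreal (riesz_kernel (s / 2) z) * indicator {z. 1 < z \<bullet> e} z)) \<partial>lborel)"
    unfolding half_space_mass_def
  proof (rule nn_integral_mono)
    fix z
    show "ennreal (riesz_kernel s z) * indicator {z. 1 < z \<bullet> e} z
        \<le> ennreal (riesz_kernel \<sigma> z) * indicator {z. 1 < z \<bullet> e} z
          + ennreal ((\<sigma> - s) * (2 / s)) * (ennreal (riesz_kernel (s / 2) z) * indicator {z. 1 < z \<bullet> e} z)"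
    proof (cases "1 < z \<bullet> e")
      case True
      define r where "r = norm z"
      have r: "1 < r" using norm_cauchy_schwarz[of z e] assms True by (simp add: r_def)
      define N where "N = real CARD('a)"
      have "1 - (\<sigma> - s) * ln r \<le> exp (- (\<sigma> - s) * ln r)"
        using exp_ge_add_one_self[of "- (\<sigma> - s) * ln r"] by (simp add: algebra_simps)
      also have "\<dots> = r powr (s - \<sigma>)" using r by (simp add: powr_def)
      finally have 1: "1 - (\<sigma> - s) * ln r \<le> r powr (s - \<sigma>)" .
      have "(s / 2) * ln r \<le> exp (s / 2 * ln r)"
        using exp_ge_add_one_self[of "s / 2 * ln r"] by linarith
      then have "(s / 2) * ln r \<le> r powr (s / 2)"
        using r by (simp add: powr_def)
      then have "ln r \<le> 2 / s * r powr (s / 2)"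
        using assms by (simp add: field_simps)
      then have "(\<sigma> - s) * ln r \<le> (\<sigma> - s) * (2 / s * r powr (s / 2))"
        using assms by (intro mult_left_mono) auto
      then have "1 \<le> r powr (s - \<sigma>) + (\<sigma> - s) * (2 / s) * r powr (s / 2)"
        using 1 unfolding mult.assoc by linarith
      then have "r powr - (N + s) * 1 \<le> r powr - (N + s) * (r powr (s - \<sigma>) + (\<sigma> - s) * (2 / s) * r powr (s / 2))"
        by (intro mult_left_mono) auto
      also have "\<dots> = r powr - (N + \<sigma>) + (\<sigma> - s) * (2 / s) * r powr - (N + s / 2)"
      proof -
        have "r powr - (N + s) * r powr (s - \<sigma>) = r powr - (N + \<sigma>)"
          and "r powr - (N + s) * r powr (s / 2) = r powr - (N + s / 2)"
          by (simp_all add: powr_add[symmetric] algebra_simps)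
        then show ?thesis by (simp add: distrib_left mult.left_commute)
      qed
      finally have "riesz_kernel s z \<le> riesz_kernel \<sigma> z + (\<sigma> - s) * (2 / s) * riesz_kernel (s / 2) z"
        by (simp add: riesz_kernel_def r_def N_def)
      then show ?thesis using True assms
        by (simp add: ennreal_mult''[symmetric] ennreal_plus[symmetric] ennreal_leI del: ennreal_plus)
    qed simp
  qed
  also have "\<dots> = half_space_mass e \<sigma> + ennreal ((\<sigma> - s) * (2 / s)) * half_space_mass e (s / 2)"
    unfolding half_space_mass_def by (simp add: nn_integral_add nn_integral_cmult)
  finally show ?thesis .
qed

text \<open>Write the truncation \<open>min 1 (max 0 (z \<bullet> e))\<close> as the length of \<open>{t. 0 < t \<and> t < 1 \<and> t < z \<bullet> e}\<close>. By Tonelli's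
  theorem the integral is the sum over \<open>t\<close> of the masses \<open>t\<^sup>-\<^sup>\<sigma>\<close> of half-spaces. This identity links the
  first moment of the kernel, which governs the seminorm of functions with an integrable gradient, to
  the half-space mass, which governs the lower bounds.\<close>

lemma nn_integral_truncated_inner_riesz_kernel:
  fixes e :: "real ^ 'n"
  assumes "0 < \<sigma>" "\<sigma> < 1"
  shows "(\<integral>\<^sup>+z. ennreal (min 1 (max 0 (z \<bullet> e))) * ennreal (riesz_kernel \<sigma> z) \<partial>lborel)
       = half_space_mass e \<sigma> * ennreal (1 / (1 - \<sigma>))"
proof -
  have min_eq: "ennreal (min 1 (max 0 a)) = (\<integral>\<^sup>+t. indicator {t. 0 < t \<and> t < 1 \<and> t < a} t \<partial>lborel)" for a :: real
  proof -
    have "{t. 0 < t \<and> t < 1 \<and> t < a} = {0<..<min 1 (max 0 a)}" by auto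
    then show ?thesis by simp
  qed
  have "(\<integral>\<^sup>+z. ennreal (min 1 (max 0 (z \<bullet> e))) * ennreal (riesz_kernel \<sigma> z) \<partial>lborel)
      = (\<integral>\<^sup>+z. (\<integral>\<^sup>+t. indicator {t. 0 < t \<and> t < 1 \<and> t < z \<bullet> e} t * ennreal (riesz_kernel \<sigma> z) \<partial>lborel) \<partial>lborel)"
    unfolding min_eq by (subst nn_integral_multc) auto
  also have "\<dots> = (\<integral>\<^sup>+t. (\<integral>\<^sup>+z. indicator {t. 0 < t \<and> t < 1 \<and> t < z \<bullet> e} t * ennreal (riesz_kernel \<sigma> z) \<partial>lborel) \<partial>lborel)"
    by (rule lborel_pair.Fubini') measurable
  also have "\<dots> = (\<integral>\<^sup>+t. half_space_mass e \<sigma> * (ennreal (t powr - \<sigma>) * indicator {0<..<1} t) \<partial>lborel)"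
  proof (rule nn_integral_cong)
    fix t :: real
    have "(\<lambda>z. indicator {t. 0 < t \<and> t < 1 \<and> t < z \<bullet> e} t * ennreal (riesz_kernel \<sigma> z))
        = (\<lambda>z. indicator {0<..<1} t * (ennreal (riesz_kernel \<sigma> z) * indicator {z. t < z \<bullet> e} z))"
      by (auto simp: fun_eq_iff indicator_def)
    then have "(\<integral>\<^sup>+z. indicator {t. 0 < t \<and> t < 1 \<and> t < z \<bullet> e} t * ennreal (riesz_kernel \<sigma> z) \<partial>lborel)
        = indicator {0<..<1} t * (\<integral>\<^sup>+z\<in>{z. t < z \<bullet> e}. ennreal (riesz_kernel \<sigma> z) \<partial>lborel)"
      by (simp add: nn_integral_cmult)
    also have "\<dots> = half_space_mass e \<sigma> * (ennreal (t powr - \<sigma>) * indicator {0<..<1} t)"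
      by (cases "t \<in> {0<..<1}") (auto simp: nn_integral_riesz_kernel_half_space mult_ac)
    finally show "(\<integral>\<^sup>+z. indicator {t. 0 < t \<and> t < 1 \<and> t < z \<bullet> e} t * ennreal (riesz_kernel \<sigma> z) \<partial>lborel)
        = half_space_mass e \<sigma> * (ennreal (t powr - \<sigma>) * indicator {0<..<1} t)" .
  qed
  also have "\<dots> = half_space_mass e \<sigma> * (\<integral>\<^sup>+t\<in>{0<..<1}. ennreal (t powr - \<sigma>) \<partial>lborel)"
    by (subst nn_integral_cmult) auto
  also have "(\<integral>\<^sup>+t\<in>{0<..<1}. ennreal (t powr - \<sigma>) \<partial>lborel) = (\<integral>\<^sup>+t\<in>{0..1}. ennreal (t powr - \<sigma>) \<partial>lborel)"
  proof (rule nn_integral_cong_AE)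
    show "AE t in lborel. ennreal (t powr - \<sigma>) * indicator {0<..<1} t = ennreal (t powr - \<sigma>) * indicator {0..1} t"
      using AE_lborel_singleton[of "0::real"] AE_lborel_singleton[of "1::real"]
      by eventually_elim (auto simp: indicator_def)
  qed
  also have "\<dots> = ennreal (1 / (1 - \<sigma>))"
    using nn_integral_has_integral_lebesgue'[of "{0..1}" "\<lambda>t. t powr - \<sigma>" "1 / (1 - \<sigma>)"] has_integral_powr_from_0[of "- \<sigma>" 1] assms
    by simp
  finally show ?thesis .
qed

section \<open>Lower bounds for the Hardy constant\<close>

lemma gagliardo_pow_eq:
  fixes u :: "real ^ 'n \<Rightarrow> real"
  shows "gagliardo_pow s p u
    = (\<integral>\<^sup>+y. (\<integral>\<^sup>+x. ennreal (\<bar>u x - u y\<bar> powr p) * ennreal (riesz_kernel (s * p) (x - y)) \<partial>lborel) \<partial>lborel)"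
  unfolding gagliardo_pow_def riesz_kernel_def
  by (simp add: powr_minus_divide ennreal_mult''[symmetric] del: minus_add_distrib)

lemma hardy_weighted_integral_eq:
  "hardy_weighted_integral s p \<Omega> u
    = (\<integral>\<^sup>+x. ennreal (\<bar>u x\<bar> powr p) * (ennreal (boundary_dist \<Omega> x powr - (s * p)) * indicator \<Omega> x) \<partial>lborel)"
  unfolding hardy_weighted_integral_def
  by (simp add: powr_minus_divide ennreal_mult''[symmetric] mult.assoc[symmetric])

lemma boundary_dist_measurable [measurable]: "boundary_dist \<Omega> \<in> borel_measurable borel"
  by (intro borel_measurable_continuous_onI continuous_intros)

lemma borel_measurable_vec_nth [measurable (raw)]:
  "f \<in> borel_measurable M \<Longrightarrow> (\<lambda>x. f x $ k :: real) \<in> borel_measurable M"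
  by (rule measurable_compose[OF _ borel_measurable_continuous_onI]) (auto intro!: continuous_intros)

text \<open>The double integral is symmetric, so a set of ordered pairs that is disjoint from its mirror image
  counts twice.\<close>

lemma gagliardo_pow_ge_twice:
  fixes u :: "real ^ 'n \<Rightarrow> real"
  assumes [measurable]: "u \<in> borel_measurable borel" "Measurable.pred (borel \<Otimes>\<^sub>M borel) (\<lambda>(x, y). S x y)"
    and S: "\<And>x y. \<not> (S x y \<and> S y x)"
  shows "2 * (\<integral>\<^sup>+x. (\<integral>\<^sup>+y. ennreal (\<bar>u x - u y\<bar> powr p) * ennreal (riesz_kernel (s * p) (x - y))
      * indicator {y. S x y} y \<partial>lborel) \<partial>lborel) \<le> gagliardo_pow s p u"
proof -
  define F where "F x y = ennreal (\<bar>u x - u y\<bar> powr p) * ennreal (riesz_kernel (s * p) (x - y))" for x y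
  have F_sym: "F x y = F y x" for x y
    unfolding F_def by (subst riesz_kernel_minus_commute) (simp add: abs_minus_commute)
  have [measurable]: "(\<lambda>(x, y). F x y) \<in> borel_measurable (borel \<Otimes>\<^sub>M borel)"
    unfolding F_def by measurable
  let ?I = "\<integral>\<^sup>+x. (\<integral>\<^sup>+y. F x y * indicator {y. S x y} y \<partial>lborel) \<partial>lborel"
  have "?I = (\<integral>\<^sup>+y. (\<integral>\<^sup>+x. F x y * indicator {y. S x y} y \<partial>lborel) \<partial>lborel)"
    by (rule lborel_pair.Fubini') measurable
  then have "2 * ?I = (\<integral>\<^sup>+y. (\<integral>\<^sup>+x. F x y * indicator {y. S x y} y \<partial>lborel) \<partial>lborel)
      + (\<integral>\<^sup>+y. (\<integral>\<^sup>+x. F y x * indicator {x. S y x} x \<partial>lborel) \<partial>lborel)"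
    by (simp add: mult_2)
  also have "\<dots> = (\<integral>\<^sup>+y. (\<integral>\<^sup>+x. F x y * indicator {y. S x y} y + F y x * indicator {x. S y x} x \<partial>lborel) \<partial>lborel)"
    by (simp add: nn_integral_add)
  also have "\<dots> \<le> (\<integral>\<^sup>+y. (\<integral>\<^sup>+x. F x y \<partial>lborel) \<partial>lborel)"
  proof (intro nn_integral_mono)
    fix x y
    show "F x y * indicator {y. S x y} y + F y x * indicator {x. S y x} x \<le> F x y"
      using S[of x y] F_sym[of x y] by (auto simp: indicator_def)
  qed
  finally show ?thesis by (simp add: gagliardo_pow_eq F_def)
qed

lemma nn_integral_riesz_kernel_shifted_half_space:
  fixes e :: "real ^ 'n"
  assumes "0 < t"
  shows "(\<integral>\<^sup>+y. ennreal (riesz_kernel \<sigma> (x - y)) * indicator {y. t < (y - x) \<bullet> e} y \<partial>lborel)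
       = ennreal (t powr - \<sigma>) * half_space_mass e \<sigma>"
proof -
  have "(\<integral>\<^sup>+y. ennreal (riesz_kernel \<sigma> (x - y)) * indicator {y. t < (y - x) \<bullet> e} y \<partial>lborel)
      = (\<integral>\<^sup>+z. ennreal (riesz_kernel \<sigma> (x - (x + z))) * indicator {y. t < (y - x) \<bullet> e} (x + z) \<partial>lborel)"
    by (rule nn_integral_lborel_translate[symmetric]) measurable
  also have "\<dots> = (\<integral>\<^sup>+z\<in>{z. t < z \<bullet> e}. ennreal (riesz_kernel \<sigma> z) \<partial>lborel)"
    by (simp add: indicator_def)
  finally show ?thesis using nn_integral_riesz_kernel_half_space[OF assms, where e = e] by simp
qed

lemma test_functionsD:
  assumes "u \<in> test_functions \<Omega>"
  shows "continuous_on UNIV u" "u \<in> borel_measurable borel" "x \<notin> \<Omega> \<Longrightarrow> u x = 0"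
proof -
  have "times_differentiable 0 u" using assms by (auto simp: test_functions_def smooth_def)
  then show "continuous_on UNIV u" by simp
  then show "u \<in> borel_measurable borel" by (rule borel_measurable_continuous_onI)
  show "x \<notin> \<Omega> \<Longrightarrow> u x = 0"
    using assms closure_subset[of "{x. u x \<noteq> 0}"] by (auto simp: test_functions_def)
qed

lemma boundary_dist_pos:
  fixes \<Omega> :: "(real ^ 'n) set"
  assumes "open \<Omega>" "\<Omega> \<noteq> UNIV" "x \<in> \<Omega>"
  shows "0 < boundary_dist \<Omega> x"
proof (rule infdist_pos_not_in_closed)
  show "frontier \<Omega> \<noteq> {}" using assms frontier_eq_empty by blast
  show "x \<notin> frontier \<Omega>" using assms by (simp add: frontier_def interior_open)
qed (simp add: frontier_closed)

text \<open>Take the supporting hyperplane at a nearest boundary point \<open>z\<close>. By the Cauchy-Schwarz inequality its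
  distance from \<open>x\<close> is at most \<open>dist x z\<close>, whatever its normal is.\<close>

lemma convex_subset_half_space_at_boundary_dist:
  fixes \<Omega> :: "(real ^ 'n) set"
  assumes "open \<Omega>" "\<Omega> \<noteq> UNIV" "convex \<Omega>" "x \<in> \<Omega>"
  obtains e where "norm e = 1" "\<And>y. y \<in> \<Omega> \<Longrightarrow> (y - x) \<bullet> e \<le> boundary_dist \<Omega> x"
proof -
  have "frontier \<Omega> \<noteq> {}" using assms frontier_eq_empty by blast
  then obtain z where z: "z \<in> frontier \<Omega>" "boundary_dist \<Omega> x = dist x z"
    using infdist_attains_inf[OF frontier_closed, of \<Omega> x] by blast
  have "z \<in> closure \<Omega>" "z \<notin> rel_interior (closure \<Omega>)"
    using z(1) assms
    by (auto simp: frontier_def interior_open convex_rel_interior_closure rel_interior_open)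
  then obtain a where a: "a \<noteq> 0" "\<And>y. y \<in> closure \<Omega> \<Longrightarrow> a \<bullet> z \<le> a \<bullet> y"
    using supporting_hyperplane_rel_boundary[OF convex_closure[OF assms(3)]] by metis
  define e where "e = - (a /\<^sub>R norm a)"
  have e: "norm e = 1" using a(1) by (simp add: e_def)
  have "(y - x) \<bullet> e \<le> boundary_dist \<Omega> x" if "y \<in> \<Omega>" for y
  proof -
    have "a \<bullet> z \<le> a \<bullet> y" using a(2) that closure_subset by blast
    then have "y \<bullet> e \<le> z \<bullet> e"
      by (simp add: e_def inner_commute[of _ a] divide_right_mono mult_left_mono)
    then have "(y - x) \<bullet> e \<le> (z - x) \<bullet> e" by (simp add: inner_diff_left)
    also have "\<dots> \<le> norm (z - x)" using norm_cauchy_schwarz[of "z - x" e] e by simp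
    finally show ?thesis using z(2) by (simp add: dist_norm norm_minus_commute)
  qed
  with e show thesis by (rule that)
qed

text \<open>Only the pairs with one point outside \<open>\<Omega>\<close> are kept. There \<open>\<bar>u x - u y\<bar> = \<bar>u x\<bar>\<close>, and the complement
  contains a half-space at distance \<open>boundary_dist \<Omega> x\<close> from \<open>x\<close>, so the integral over \<open>y\<close> produces the
  Hardy weight with the constant \<open>half_space_mass\<close>.\<close>

proposition hardy_const_convex_ge:
  fixes \<Omega> :: "(real ^ 'n) set" and e :: "real ^ 'n"
  assumes \<Omega>: "open \<Omega>" "\<Omega> \<noteq> UNIV" "convex \<Omega>" and e: "norm e = 1"
  shows "2 * half_space_mass e (s * p) \<le> hardy_const s p \<Omega>"
  unfolding hardy_const_def
proof (rule INF_greatest)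
  fix u assume "u \<in> {u \<in> test_functions \<Omega>. hardy_weighted_integral s p \<Omega> u = 1}"
  then have u: "u \<in> test_functions \<Omega>" and norm: "hardy_weighted_integral s p \<Omega> u = 1" by auto
  note [measurable] = test_functionsD(2)[OF u] borel_open[OF \<Omega>(1)]
  let ?S = "\<lambda>x y. x \<in> \<Omega> \<and> y \<notin> \<Omega>"
  have "half_space_mass e (s * p) = half_space_mass e (s * p) * hardy_weighted_integral s p \<Omega> u"
    by (simp add: norm)
  also have "\<dots> = (\<integral>\<^sup>+x. half_space_mass e (s * p) * (ennreal (\<bar>u x\<bar> powr p) *
      (ennreal (boundary_dist \<Omega> x powr - (s * p)) * indicator \<Omega> x)) \<partial>lborel)"
    unfolding hardy_weighted_integral_eq by (rule nn_integral_cmult[symmetric]) measurable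
  also have "\<dots> \<le> (\<integral>\<^sup>+x. (\<integral>\<^sup>+y. ennreal (\<bar>u x - u y\<bar> powr p) * ennreal (riesz_kernel (s * p) (x - y))
      * indicator {y. ?S x y} y \<partial>lborel) \<partial>lborel)"
  proof (rule nn_integral_mono)
    fix x
    show "half_space_mass e (s * p) * (ennreal (\<bar>u x\<bar> powr p) *
        (ennreal (boundary_dist \<Omega> x powr - (s * p)) * indicator \<Omega> x))
      \<le> (\<integral>\<^sup>+y. ennreal (\<bar>u x - u y\<bar> powr p) * ennreal (riesz_kernel (s * p) (x - y))
          * indicator {y. ?S x y} y \<partial>lborel)"
    proof (cases "x \<in> \<Omega>")
      case True
      obtain e' where e': "norm e' = 1" "\<And>y. y \<in> \<Omega> \<Longrightarrow> (y - x) \<bullet> e' \<le> boundary_dist \<Omega> x"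
        using convex_subset_half_space_at_boundary_dist[OF \<Omega> True] by metis
      have "half_space_mass e (s * p) * (ennreal (\<bar>u x\<bar> powr p) *
          (ennreal (boundary_dist \<Omega> x powr - (s * p)) * indicator \<Omega> x))
        = ennreal (\<bar>u x\<bar> powr p) * (ennreal (boundary_dist \<Omega> x powr - (s * p)) * half_space_mass e' (s * p))"
        using True half_space_mass_cong[OF e e'(1), of "s * p"] by (simp add: mult_ac)
      also have "\<dots> = ennreal (\<bar>u x\<bar> powr p) * (\<integral>\<^sup>+y. ennreal (riesz_kernel (s * p) (x - y))
          * indicator {y. boundary_dist \<Omega> x < (y - x) \<bullet> e'} y \<partial>lborel)"
        by (subst nn_integral_riesz_kernel_shifted_half_space) (use boundary_dist_pos[OF \<Omega>(1,2) True] in auto)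
      also have "\<dots> = (\<integral>\<^sup>+y. ennreal (\<bar>u x\<bar> powr p) * (ennreal (riesz_kernel (s * p) (x - y))
          * indicator {y. boundary_dist \<Omega> x < (y - x) \<bullet> e'} y) \<partial>lborel)"
        by (rule nn_integral_cmult[symmetric]) measurable
      also have "\<dots> \<le> (\<integral>\<^sup>+y. ennreal (\<bar>u x - u y\<bar> powr p) * ennreal (riesz_kernel (s * p) (x - y))
          * indicator {y. ?S x y} y \<partial>lborel)"
      proof (rule nn_integral_mono)
        fix y
        show "ennreal (\<bar>u x\<bar> powr p) * (ennreal (riesz_kernel (s * p) (x - y))
            * indicator {y. boundary_dist \<Omega> x < (y - x) \<bullet> e'} y)
          \<le> ennreal (\<bar>u x - u y\<bar> powr p) * ennreal (riesz_kernel (s * p) (x - y))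
            * indicator {y. ?S x y} y"
          using True e'(2)[of y] test_functionsD(3)[OF u, of y]
          by (cases "y \<in> \<Omega>") (auto simp: indicator_def)
      qed
      finally show ?thesis .
    qed simp
  qed
  finally have "half_space_mass e (s * p) \<le> (\<integral>\<^sup>+x. (\<integral>\<^sup>+y. ennreal (\<bar>u x - u y\<bar> powr p)
      * ennreal (riesz_kernel (s * p) (x - y)) * indicator {y. ?S x y} y \<partial>lborel) \<partial>lborel)" .
  then have "2 * half_space_mass e (s * p) \<le> 2 * (\<integral>\<^sup>+x. (\<integral>\<^sup>+y. ennreal (\<bar>u x - u y\<bar> powr p)
      * ennreal (riesz_kernel (s * p) (x - y)) * indicator {y. ?S x y} y \<partial>lborel) \<partial>lborel)"
    by (intro mult_left_mono) auto
  also have "\<dots> \<le> gagliardo_pow s p u"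
    by (rule gagliardo_pow_ge_twice) auto
  finally show "2 * half_space_mass e (s * p) \<le> gagliardo_pow s p u" .
qed

lemma open_half_space: "open (half_space k :: (real ^ 'n) set)"
  unfolding half_space_def by (intro open_Collect_less continuous_intros)

lemma frontier_half_space: "frontier (half_space k :: (real ^ 'n) set) = {x. x $ k = 0}"
  using frontier_halfspace_gt[of "axis k 1 :: real ^ 'n" 0]
  by (simp add: half_space_def inner_axis' axis_eq_0_iff)

lemma boundary_dist_half_space:
  assumes "x \<in> half_space k"
  shows "boundary_dist (half_space k) x = x $ k"
proof (rule antisym)
  have x: "0 < x $ k" using assms by (simp add: half_space_def)
  have "boundary_dist (half_space k) x \<le> dist x (x - (x $ k) *\<^sub>R axis k 1)"
    unfolding frontier_half_space by (rule infdist_le) (simp add: axis_def)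
  also have "\<dots> = x $ k" using x by (simp add: dist_norm)
  finally show "boundary_dist (half_space k) x \<le> x $ k" .
  have "0 \<in> {x :: real ^ 'a. x $ k = 0}" by simp
  then have "{x :: real ^ 'a. x $ k = 0} \<noteq> {}" by blast
  moreover have "x $ k \<le> dist x y" if "y $ k = 0" for y
    using component_le_norm_cart[of "x - y" k] that x by (simp add: dist_norm)
  ultimately show "x $ k \<le> boundary_dist (half_space k) x"
    unfolding frontier_half_space infdist_def by (auto intro!: cINF_greatest)
qed

text \<open>The triangle inequality followed by convexity of the \<open>p\<close>-th power.\<close>

lemma powr_abs_triangle:
  fixes a b :: real
  assumes p: "1 \<le> p"
  shows "2 powr (1 - p) * \<bar>a\<bar> powr p \<le> \<bar>a - b\<bar> powr p + \<bar>b\<bar> powr p"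
proof -
  have conv: "2 powr (1 - p) * (x + y) powr p \<le> x powr p + y powr p" if "0 < x" "0 < y" for x y :: real
  proof -
    have "((1 - 1 / 2) *\<^sub>R x + (1 / 2) *\<^sub>R y) powr p \<le> (1 - 1 / 2) * x powr p + (1 / 2) * y powr p"
      using powr_convex[OF p] that by (intro convex_onD) auto
    then have "((x + y) / 2) powr p \<le> (x powr p + y powr p) / 2" by (simp add: add_divide_distrib)
    then show ?thesis using that by (simp add: powr_divide powr_diff field_simps)
  qed
  have two: "2 powr (1 - p) \<le> (1 :: real)" using powr_mono[of "1 - p" 0 2] p by simp
  show ?thesis
  proof (cases "a = b \<or> b = 0")
    case True
    have "2 powr (1 - p) * \<bar>a\<bar> powr p \<le> 1 * \<bar>a\<bar> powr p"
      using two by (intro mult_right_mono) auto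
    with True show ?thesis using p by auto
  next
    case False
    have "2 powr (1 - p) * \<bar>a\<bar> powr p \<le> 2 powr (1 - p) * (\<bar>a - b\<bar> + \<bar>b\<bar>) powr p"
      using p by (intro mult_left_mono powr_mono2) auto
    also have "\<dots> \<le> \<bar>a - b\<bar> powr p + \<bar>b\<bar> powr p"
      using False by (intro conv) auto
    finally show ?thesis .
  qed
qed

text \<open>The pairs with one point outside the half-space give half of the constant. The other half comes from pairs
  inside, with \<open>y\<close> above \<open>x\<close>. For \<open>p = 1\<close> one integrates \<open>\<bar>u x - u y\<bar> \<ge> \<bar>u x\<bar> - \<bar>u y\<bar>\<close> over such pairs: each
  value \<open>\<bar>u x\<bar>\<close> then receives the kernel mass above \<open>x\<close> minus the mass between the boundary and \<open>x\<close>, and by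
  reflection in \<open>x\<close> what remains is the mass of a half-space at distance \<open>x $ k\<close>. Both masses are infinite, so only
  the pairs whose heights differ by a factor of more than \<open>1 + \<epsilon>\<close> are used; this costs little when
  \<open>\<epsilon>\<close> is small. For \<open>p > 1\<close> the inequality holds with the factor \<open>2 powr (1 - p)\<close>, which tends to \<open>1\<close>. The
  negative term stands on the right-hand side of the conclusion because subtraction truncates at \<open>0\<close>.\<close>

proposition hardy_const_half_space_ge:
  fixes k :: "'n::finite" and e :: "real ^ 'n"
  assumes p: "1 \<le> p" and s: "0 < s" and \<epsilon>: "0 < \<epsilon>" and e: "norm e = 1"
  shows "ennreal (4 + 2 * 2 powr (1 - p) * \<epsilon> powr - (s * p)) * half_space_mass e (s * p)
    \<le> hardy_const s p (half_space k :: (real ^ 'n) set)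
      + ennreal (2 * (\<epsilon> / (1 + \<epsilon>)) powr - (s * p)) * half_space_mass e (s * p)"
proof -
  define \<sigma> where "\<sigma> = s * p"
  define \<kappa> where "\<kappa> = half_space_mass e \<sigma>"
  define n where "n = (- axis k 1 :: real ^ 'n)"
  define q where "q = \<epsilon> / (1 + \<epsilon>)"
  let ?H = "half_space k :: (real ^ 'n) set"
  have \<sigma>: "0 < \<sigma>" using s p by (simp add: \<sigma>_def)
  have q: "0 < q" using \<epsilon> by (simp add: q_def)
  have \<kappa>_finite: "\<kappa> < \<infinity>" unfolding \<kappa>_def using \<sigma> e by (rule half_space_mass_finite)
  have mass: "half_space_mass n \<sigma> = \<kappa>" "half_space_mass (- n) \<sigma> = \<kappa>"
    unfolding \<kappa>_def by (intro half_space_mass_cong; simp add: n_def e)+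
  have inner: "z \<bullet> n = - (z $ k)" "z \<bullet> (- n) = z $ k" for z
    by (simp_all add: n_def inner_axis)
  have bound: "ennreal (4 + 2 * 2 powr (1 - p) * \<epsilon> powr - \<sigma>) * \<kappa>
      \<le> gagliardo_pow s p u + ennreal (2 * q powr - \<sigma>) * \<kappa>"
    if u: "u \<in> test_functions ?H" and norm: "hardy_weighted_integral s p ?H u = 1" for u
  proof -
    note [measurable] = test_functionsD(2)[OF u]
    let ?K = "\<lambda>x y. ennreal (riesz_kernel \<sigma> (x - y))"
    let ?D = "\<lambda>x y. ennreal (\<bar>u x - u y\<bar> powr p)"
    let ?U = "\<lambda>x. ennreal (\<bar>u x\<bar> powr p)"
    define up where "up x y \<longleftrightarrow> 0 < x $ k \<and> (1 + \<epsilon>) * x $ k < y $ k" for x y :: "real ^ 'n"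
    define out where "out x y \<longleftrightarrow> 0 < x $ k \<and> y $ k < 0" for x y :: "real ^ 'n"
    have [measurable]: "Measurable.pred (borel \<Otimes>\<^sub>M borel) (\<lambda>(x, y). up x y)"
      "Measurable.pred (borel \<Otimes>\<^sub>M borel) (\<lambda>(x, y). out x y)"
      unfolding up_def out_def by measurable
    have J: "(\<integral>\<^sup>+x. ?U x * (ennreal (x $ k powr - \<sigma>) * indicator ?H x) \<partial>lborel) = 1"
    proof -
      have "(\<integral>\<^sup>+x. ?U x * (ennreal (x $ k powr - \<sigma>) * indicator ?H x) \<partial>lborel) = hardy_weighted_integral s p ?H u"
        unfolding hardy_weighted_integral_eq \<sigma>_def
        by (intro nn_integral_cong) (auto simp: indicator_def boundary_dist_half_space)
      then show ?thesis by (simp add: norm)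
    qed
    have mass_at: "(\<integral>\<^sup>+x. ?U x * M x \<partial>lborel) = ennreal c * \<kappa>"
      if M: "\<And>x. x \<in> ?H \<Longrightarrow> M x = ennreal ((b * x $ k) powr - \<sigma>) * \<kappa>"
        and b: "0 < b" and c: "c = b powr - \<sigma>" for M and b c :: real
    proof -
      have "(\<integral>\<^sup>+x. ?U x * M x \<partial>lborel)
          = (\<integral>\<^sup>+x. ennreal c * \<kappa> * (?U x * (ennreal (x $ k powr - \<sigma>) * indicator ?H x)) \<partial>lborel)"
      proof (rule nn_integral_cong)
        fix x
        show "?U x * M x = ennreal c * \<kappa> * (?U x * (ennreal (x $ k powr - \<sigma>) * indicator ?H x))"
        proof (cases "x \<in> ?H")
          case True
          then have "(b * x $ k) powr - \<sigma> = c * x $ k powr - \<sigma>"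
            using b c by (simp add: powr_mult half_space_def)
          then show ?thesis using True M[OF True] by (simp add: ennreal_mult'' mult_ac)
        next
          case False
          then show ?thesis using test_functionsD(3)[OF u False] by simp
        qed
      qed
      also have "\<dots> = ennreal c * \<kappa> * 1"
        unfolding J[symmetric] by (rule nn_integral_cmult) (simp add: half_space_def)
      finally show ?thesis by simp
    qed
    define A where "A = (\<integral>\<^sup>+x. (\<integral>\<^sup>+y. ?D x y * ?K x y * indicator {y. up x y} y \<partial>lborel) \<partial>lborel)"
    define B where "B = (\<integral>\<^sup>+x. (\<integral>\<^sup>+y. ?U y * ?K x y * indicator {y. up x y} y \<partial>lborel) \<partial>lborel)"
    define C where "C = (\<integral>\<^sup>+x. (\<integral>\<^sup>+y. ?D x y * ?K x y * indicator {y. out x y} y \<partial>lborel) \<partial>lborel)"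
    \<comment> \<open>the pairs that leave the half-space\<close>
    have C: "C = \<kappa>"
    proof -
      have "C = (\<integral>\<^sup>+x. ?U x * (\<integral>\<^sup>+y. ?K x y * indicator {y. out x y} y \<partial>lborel) \<partial>lborel)"
        unfolding C_def
      proof (rule nn_integral_cong)
        fix x
        have "(\<integral>\<^sup>+y. ?D x y * ?K x y * indicator {y. out x y} y \<partial>lborel)
            = (\<integral>\<^sup>+y. ?U x * (?K x y * indicator {y. out x y} y) \<partial>lborel)"
        proof (rule nn_integral_cong)
          fix y
          show "?D x y * ?K x y * indicator {y. out x y} y = ?U x * (?K x y * indicator {y. out x y} y)"
            using test_functionsD(3)[OF u, of y] by (auto simp: indicator_def out_def half_space_def mult_ac)
        qed
        also have "\<dots> = ?U x * (\<integral>\<^sup>+y. ?K x y * indicator {y. out x y} y \<partial>lborel)"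
          by (rule nn_integral_cmult) measurable
        finally show "(\<integral>\<^sup>+y. ?D x y * ?K x y * indicator {y. out x y} y \<partial>lborel)
            = ?U x * (\<integral>\<^sup>+y. ?K x y * indicator {y. out x y} y \<partial>lborel)" .
      qed
      also have "\<dots> = ennreal 1 * \<kappa>"
      proof (rule mass_at)
        fix x assume "x \<in> ?H"
        then have x: "0 < x $ k" by (simp add: half_space_def)
        then have "{y. out x y} = {y. x $ k < (y - x) \<bullet> n}" by (auto simp: out_def inner)
        then show "(\<integral>\<^sup>+y. ?K x y * indicator {y. out x y} y \<partial>lborel) = ennreal ((1 * x $ k) powr - \<sigma>) * \<kappa>"
          using nn_integral_riesz_kernel_shifted_half_space[OF x, of \<sigma> x n] by (simp add: mass)
      qed auto
      finally show ?thesis by simp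
    qed
    \<comment> \<open>the p-th powers at the lower points, against the kernel mass above height \<open>(1 + \<epsilon>) * x $ k\<close>\<close>
    have AB: "ennreal (2 powr (1 - p) * \<epsilon> powr - \<sigma>) * \<kappa> \<le> A + B"
    proof -
      have "(\<integral>\<^sup>+x. ?U x * (\<integral>\<^sup>+y. ?K x y * indicator {y. up x y} y \<partial>lborel) \<partial>lborel) = ennreal (\<epsilon> powr - \<sigma>) * \<kappa>"
      proof (rule mass_at)
        fix x assume "x \<in> ?H"
        then have x: "0 < x $ k" by (simp add: half_space_def)
        then have "{y. up x y} = {y. \<epsilon> * x $ k < (y - x) \<bullet> (- n)}" by (auto simp: up_def inner algebra_simps)
        then show "(\<integral>\<^sup>+y. ?K x y * indicator {y. up x y} y \<partial>lborel) = ennreal ((\<epsilon> * x $ k) powr - \<sigma>) * \<kappa>"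
          using nn_integral_riesz_kernel_shifted_half_space[of "\<epsilon> * x $ k" \<sigma> x "- n"] x \<epsilon> by (simp add: mass)
      qed (use \<epsilon> in auto)
      then have "ennreal (2 powr (1 - p) * \<epsilon> powr - \<sigma>) * \<kappa>
          = ennreal (2 powr (1 - p)) * (\<integral>\<^sup>+x. ?U x * (\<integral>\<^sup>+y. ?K x y * indicator {y. up x y} y \<partial>lborel) \<partial>lborel)"
        by (simp add: ennreal_mult'' mult_ac)
      also have "\<dots> = (\<integral>\<^sup>+x. ennreal (2 powr (1 - p)) * (?U x * (\<integral>\<^sup>+y. ?K x y * indicator {y. up x y} y \<partial>lborel)) \<partial>lborel)"
        by (rule nn_integral_cmult[symmetric]) measurable
      also have "\<dots> = (\<integral>\<^sup>+x. (\<integral>\<^sup>+y. ennreal (2 powr (1 - p)) * (?U x * (?K x y * indicator {y. up x y} y)) \<partial>lborel) \<partial>lborel)"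
        by (simp add: nn_integral_cmult)
      also have "\<dots> \<le> (\<integral>\<^sup>+x. (\<integral>\<^sup>+y. ?D x y * ?K x y * indicator {y. up x y} y + ?U y * ?K x y * indicator {y. up x y} y \<partial>lborel) \<partial>lborel)"
      proof (intro nn_integral_mono)
        fix x y
        have "ennreal (2 powr (1 - p)) * ?U x \<le> ?D x y + ?U y"
          using powr_abs_triangle[OF p, of "u x" "u y"]
          by (simp add: ennreal_mult''[symmetric] ennreal_plus[symmetric] ennreal_leI del: ennreal_plus)
        then have "(ennreal (2 powr (1 - p)) * ?U x) * (?K x y * indicator {y. up x y} y)
            \<le> (?D x y + ?U y) * (?K x y * indicator {y. up x y} y)"
          by (rule mult_right_mono) simp
        then show "ennreal (2 powr (1 - p)) * (?U x * (?K x y * indicator {y. up x y} y))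
            \<le> ?D x y * ?K x y * indicator {y. up x y} y + ?U y * ?K x y * indicator {y. up x y} y"
          by (simp add: distrib_right mult.assoc)
      qed
      also have "\<dots> = A + B"
        unfolding A_def B_def by (simp add: nn_integral_add)
      finally show ?thesis .
    qed
    \<comment> \<open>seen from \<open>y\<close>, the lower points and the outside lie in one half-space, at distance \<open>q * y $ k\<close>\<close>
    have B: "B + \<kappa> \<le> ennreal (q powr - \<sigma>) * \<kappa>"
    proof -
      have "B = (\<integral>\<^sup>+y. (\<integral>\<^sup>+x. ?U y * ?K x y * indicator {y. up x y} y \<partial>lborel) \<partial>lborel)"
        unfolding B_def by (rule lborel_pair.Fubini') measurable
      also have "\<dots> = (\<integral>\<^sup>+y. ?U y * (\<integral>\<^sup>+x. ?K y x * indicator {x. up x y} x \<partial>lborel) \<partial>lborel)"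
      proof (rule nn_integral_cong)
        fix y
        have "(\<integral>\<^sup>+x. ?U y * ?K x y * indicator {y. up x y} y \<partial>lborel)
            = (\<integral>\<^sup>+x. ?U y * (?K y x * indicator {x. up x y} x) \<partial>lborel)"
          by (intro nn_integral_cong) (simp add: indicator_def riesz_kernel_minus_commute mult_ac)
        also have "\<dots> = ?U y * (\<integral>\<^sup>+x. ?K y x * indicator {x. up x y} x \<partial>lborel)"
          by (rule nn_integral_cmult) measurable
        finally show "(\<integral>\<^sup>+x. ?U y * ?K x y * indicator {y. up x y} y \<partial>lborel)
            = ?U y * (\<integral>\<^sup>+x. ?K y x * indicator {x. up x y} x \<partial>lborel)" .
      qed
      finally have B_eq: "B = (\<integral>\<^sup>+y. ?U y * (\<integral>\<^sup>+x. ?K y x * indicator {x. up x y} x \<partial>lborel) \<partial>lborel)" .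
      have "(\<integral>\<^sup>+y. ?U y * (\<integral>\<^sup>+x. ?K y x * indicator {x. y $ k < (x - y) \<bullet> n} x \<partial>lborel) \<partial>lborel) = ennreal 1 * \<kappa>"
        by (rule mass_at[of _ 1 1]) (auto simp: half_space_def nn_integral_riesz_kernel_shifted_half_space mass)
      then have "B + \<kappa> = (\<integral>\<^sup>+y. ?U y * (\<integral>\<^sup>+x. ?K y x * indicator {x. up x y} x \<partial>lborel) \<partial>lborel)
          + (\<integral>\<^sup>+y. ?U y * (\<integral>\<^sup>+x. ?K y x * indicator {x. y $ k < (x - y) \<bullet> n} x \<partial>lborel) \<partial>lborel)"
        by (simp add: B_eq)
      also have "\<dots> = (\<integral>\<^sup>+y. ?U y * (\<integral>\<^sup>+x. ?K y x * indicator {x. up x y} x + ?K y x * indicator {x. y $ k < (x - y) \<bullet> n} x \<partial>lborel) \<partial>lborel)"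
        by (simp add: nn_integral_add distrib_left)
      also have "\<dots> \<le> (\<integral>\<^sup>+y. ?U y * (\<integral>\<^sup>+x. ?K y x * indicator {x. q * y $ k < (x - y) \<bullet> n} x \<partial>lborel) \<partial>lborel)"
      proof (rule nn_integral_mono)
        fix y
        show "?U y * (\<integral>\<^sup>+x. ?K y x * indicator {x. up x y} x + ?K y x * indicator {x. y $ k < (x - y) \<bullet> n} x \<partial>lborel)
            \<le> ?U y * (\<integral>\<^sup>+x. ?K y x * indicator {x. q * y $ k < (x - y) \<bullet> n} x \<partial>lborel)"
        proof (cases "y \<in> ?H")
          case True
          then have y: "0 < y $ k" by (simp add: half_space_def)
          have q1: "q * y $ k < y $ k" using y \<epsilon> by (simp add: q_def field_simps)
          have up: "0 < x $ k" "q * y $ k < y $ k - x $ k" if "up x y" for x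
            using that \<epsilon> by (simp_all add: up_def q_def field_simps)
          then show ?thesis
            using q1 by (intro mult_left_mono nn_integral_mono) (auto simp: indicator_def inner dest: up)
        next
          case False
          then show ?thesis using test_functionsD(3)[OF u False] by simp
        qed
      qed
      also have "\<dots> = ennreal (q powr - \<sigma>) * \<kappa>"
        by (rule mass_at[of _ q]) (use q in \<open>auto simp: half_space_def nn_integral_riesz_kernel_shifted_half_space mass\<close>)
      finally show ?thesis .
    qed
    have "2 * (A + C) \<le> gagliardo_pow s p u"
    proof -
      have "A + C = (\<integral>\<^sup>+x. (\<integral>\<^sup>+y. ?D x y * ?K x y * indicator {y. up x y \<or> out x y} y \<partial>lborel) \<partial>lborel)"
      proof -
        have "?D x y * ?K x y * indicator {y. up x y \<or> out x y} y
            = ?D x y * ?K x y * indicator {y. up x y} y + ?D x y * ?K x y * indicator {y. out x y} y" for x y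
        proof -
          have "0 < y $ k" if "up x y"
            using that \<epsilon> mult_pos_pos[of "1 + \<epsilon>" "x $ k"] unfolding up_def by linarith
          then have "\<not> (up x y \<and> out x y)" by (auto simp: out_def)
          then show ?thesis by (auto simp: indicator_def)
        qed
        then show ?thesis unfolding A_def C_def by (simp add: nn_integral_add)
      qed
      moreover have "\<not> ((up x y \<or> out x y) \<and> (up y x \<or> out y x))" for x y
      proof -
        have "a < (1 + \<epsilon>) * a" if "0 < a" for a using that \<epsilon> by simp
        then show ?thesis unfolding up_def out_def by (smt (verit))
      qed
      ultimately show ?thesis
        using gagliardo_pow_ge_twice[of u "\<lambda>x y. up x y \<or> out x y" p s] by (simp add: \<sigma>_def)
    qed
    moreover have "ennreal (4 + 2 * 2 powr (1 - p) * \<epsilon> powr - \<sigma>) * \<kappa> \<le> 2 * (A + C) + ennreal (2 * q powr - \<sigma>) * \<kappa>"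
    proof -
      have "ennreal (4 + 2 * 2 powr (1 - p) * \<epsilon> powr - \<sigma>) * \<kappa>
          = 4 * \<kappa> + 2 * (ennreal (2 powr (1 - p) * \<epsilon> powr - \<sigma>) * \<kappa>)"
        by (simp add: ennreal_plus distrib_right mult.assoc ennreal_mult'' )
      also have "\<dots> \<le> 4 * \<kappa> + 2 * (A + B)"
        using AB by (intro add_left_mono mult_left_mono) auto
      also have "\<dots> = 2 * (A + C) + 2 * (B + \<kappa>)"
        by (simp add: C distrib_left mult_2[of "2 * \<kappa>", symmetric] mult.assoc[symmetric] add_ac flip: mult_2)
      also have "\<dots> \<le> 2 * (A + C) + 2 * (ennreal (q powr - \<sigma>) * \<kappa>)"
        using B by (intro add_left_mono mult_left_mono) auto
      also have "\<dots> = 2 * (A + C) + ennreal (2 * q powr - \<sigma>) * \<kappa>"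
        by (simp add: ennreal_mult'' mult.assoc)
      finally show ?thesis .
    qed
    ultimately show ?thesis by (meson add_right_mono order_trans)
  qed
  have fin: "ennreal (2 * q powr - \<sigma>) * \<kappa> \<noteq> top"
    using \<kappa>_finite by (simp add: ennreal_mult_eq_top_iff)
  have "ennreal (4 + 2 * 2 powr (1 - p) * \<epsilon> powr - \<sigma>) * \<kappa> - ennreal (2 * q powr - \<sigma>) * \<kappa> \<le> hardy_const s p ?H"
    unfolding hardy_const_def
  proof (rule INF_greatest)
    fix u assume "u \<in> {u \<in> test_functions ?H. hardy_weighted_integral s p ?H u = 1}"
    then show "ennreal (4 + 2 * 2 powr (1 - p) * \<epsilon> powr - \<sigma>) * \<kappa> - ennreal (2 * q powr - \<sigma>) * \<kappa>
        \<le> gagliardo_pow s p u"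
      using bound[of u] unfolding ennreal_minus_le_iff by (auto simp: add.commute fin)
  qed
  then show ?thesis
    using fin unfolding ennreal_minus_le_iff by (auto simp: add.commute \<kappa>_def \<sigma>_def q_def)
qed

section \<open>Smooth functions\<close>

lemma frechet_derivative_eq:
  "(f has_derivative f') (at x) \<Longrightarrow> frechet_derivative f (at x) = f'"
  using frechet_derivative_at by metis

lemma times_differentiable_SucI:
  assumes "\<And>x. (u has_derivative u' x) (at x)" "\<And>v. times_differentiable m (\<lambda>x. u' x v)"
  shows "times_differentiable (Suc m) u"
  using assms frechet_derivative_eq[OF assms(1)] by (auto simp: differentiable_def)

lemma times_differentiable_imp_continuous:
  "times_differentiable m u \<Longrightarrow> continuous_on UNIV u"
  by (cases m) (auto intro!: continuous_at_imp_continuous_on differentiable_imp_continuous_within)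

lemma times_differentiable_SucD:
  "times_differentiable (Suc m) u \<Longrightarrow> times_differentiable m u"
proof (induction m arbitrary: u)
  case 0
  then show ?case using times_differentiable_imp_continuous[OF 0] by simp
next
  case (Suc m)
  then show ?case by (metis times_differentiable.simps(2))
qed

lemma times_differentiable_derivative:
  "times_differentiable (Suc m) u \<Longrightarrow> (u has_derivative frechet_derivative u (at x)) (at x)"
  by (simp add: frechet_derivative_works[symmetric])

lemma times_differentiable_const: "times_differentiable m (\<lambda>x. c)"
proof (induction m arbitrary: c)
  case (Suc m)
  show ?case by (rule times_differentiable_SucI[where u' = "\<lambda>x v. 0"]) (auto simp: Suc)
qed simp

lemma times_differentiable_linear:
  assumes "bounded_linear f" shows "times_differentiable m f"
proof (cases m)
  case 0
  then show ?thesis using assms by (simp add: linear_continuous_on)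
next
  case (Suc n)
  show ?thesis unfolding Suc
    by (rule times_differentiable_SucI[where u' = "\<lambda>x. f"])
       (auto intro: bounded_linear_imp_has_derivative assms times_differentiable_const)
qed

lemma times_differentiable_add:
  "times_differentiable m f \<Longrightarrow> times_differentiable m g \<Longrightarrow> times_differentiable m (\<lambda>x. f x + g x)"
proof (induction m arbitrary: f g)
  case 0
  then show ?case by (auto intro: continuous_on_add)
next
  case (Suc m)
  show ?case
    by (rule times_differentiable_SucI[OF has_derivative_add
          [OF times_differentiable_derivative[OF Suc.prems(1)] times_differentiable_derivative[OF Suc.prems(2)]]])
       (use Suc in auto)
qed

lemma times_differentiable_mult:
  "times_differentiable m f \<Longrightarrow> times_differentiable m g \<Longrightarrow> times_differentiable m (\<lambda>x. f x * g x)"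
proof (induction m arbitrary: f g)
  case 0
  then show ?case by (auto intro: continuous_on_mult)
next
  case (Suc m)
  show ?case
    by (rule times_differentiable_SucI[OF has_derivative_mult
          [OF times_differentiable_derivative[OF Suc.prems(1)] times_differentiable_derivative[OF Suc.prems(2)]]])
       (use Suc times_differentiable_SucD[OF Suc.prems(1)] times_differentiable_SucD[OF Suc.prems(2)]
         in \<open>auto intro!: times_differentiable_add\<close>)
qed

text \<open>A set of functions on the line that is closed under differentiation consists of smooth
  functions; this form of the chain rule needs no higher derivatives by name.\<close>

lemma times_differentiable_compose:
  assumes closed: "\<And>h. h \<in> H \<Longrightarrow> \<exists>h' \<in> H. \<forall>t :: real. (h has_real_derivative h' t) (at t)"
    and "h \<in> H" and "times_differentiable m f"
  shows "times_differentiable m (\<lambda>x. h (f x))"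
  using assms(2,3)
proof (induction m arbitrary: h f)
  case 0
  obtain h' where "\<forall>t. (h has_real_derivative h' t) (at t)" using closed 0 by blast
  then have "continuous_on UNIV h" by (meson DERIV_continuous_on has_field_derivative_at_within)
  from continuous_on_compose2[OF this, of UNIV f] 0 show ?case by simp
next
  case (Suc m)
  obtain h' where h': "h' \<in> H" "\<And>t. (h has_real_derivative h' t) (at t)" using closed Suc.prems(1) by blast
  have "((\<lambda>x. h (f x)) has_derivative (\<lambda>v. h' (f x) * frechet_derivative f (at x) v)) (at x)" for x
    using has_derivative_compose[OF times_differentiable_derivative[OF Suc.prems(2)], of h]
      h'(2)[of "f x"] unfolding has_field_derivative_def by auto
  then show ?case
    by (rule times_differentiable_SucI)
       (use Suc h' times_differentiable_SucD[OF Suc.prems(2)] in \<open>auto intro!: times_differentiable_mult\<close>)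
qed

text \<open>The functions \<open>poly P (1 / t) * exp (- 1 / t)\<close>, extended by zero to \<open>t \<le> 0\<close>. Differentiation only changes the
  polynomial, so all of them are smooth.\<close>

definition flat_exp :: "real poly \<Rightarrow> real \<Rightarrow> real" where
  "flat_exp P t = (if 0 < t then poly P (1 / t) * exp (- (1 / t)) else 0)"

lemma poly_mult_exp_minus_tendsto_0:
  "((\<lambda>t::real. poly P t * exp (- t)) \<longlongrightarrow> 0) at_top"
proof -
  have "((\<lambda>t. \<Sum>i\<le>degree P. coeff P i * (t ^ i / exp t)) \<longlongrightarrow> (\<Sum>i\<le>degree P. coeff P i * 0)) at_top"
    by (intro tendsto_intros tendsto_power_div_exp_0)
  then show ?thesis
    by (simp add: poly_altdef sum_distrib_right exp_minus divide_inverse mult.assoc)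
qed

lemma flat_exp_has_derivative:
  "(flat_exp P has_real_derivative flat_exp ((P - pderiv P) * [:0, 0, 1:]) t) (at t)"
proof -
  let ?Q = "(P - pderiv P) * [:0, 0, 1:]"
  consider "t > 0" | "t < 0" | "t = 0" by linarith
  then show ?thesis
  proof cases
    case 1
    have "((\<lambda>t. poly P (1 / t) * exp (- (1 / t))) has_real_derivative flat_exp ?Q t) (at t)"
      using 1 by (auto intro!: derivative_eq_intros poly_DERIV[THEN DERIV_chain2]
          simp: flat_exp_def field_simps power2_eq_square)
    then show ?thesis
      by (rule has_field_derivative_transform_within_open[of _ _ _ "{0<..}"])
         (use 1 in \<open>auto simp: flat_exp_def\<close>)
  next
    case 2
    have "((\<lambda>t. 0) has_real_derivative flat_exp ?Q t) (at t)"
      using 2 by (simp add: flat_exp_def)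
    then show ?thesis
      by (rule has_field_derivative_transform_within_open[of _ _ _ "{..<0}"])
         (use 2 in \<open>auto simp: flat_exp_def\<close>)
  next
    case 3
    have lim: "((\<lambda>h. poly (P * [:0, 1:]) (1 / h) * exp (- (1 / h))) \<longlongrightarrow> 0) (at_right 0)"
      using filterlim_compose[OF poly_mult_exp_minus_tendsto_0[of "P * [:0, 1:]"] filterlim_inverse_at_top_right]
      by (simp add: inverse_eq_divide)
    have "((\<lambda>h. flat_exp P h / h) \<longlongrightarrow> 0) (at_right 0)"
      by (rule Lim_transform_eventually[OF lim])
         (auto simp: eventually_at_filter flat_exp_def)
    moreover have "((\<lambda>h. flat_exp P h / h) \<longlongrightarrow> 0) (at_left 0)"
      by (rule tendsto_eventually) (auto simp: eventually_at_filter flat_exp_def)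
    ultimately have "((\<lambda>h. flat_exp P h / h) \<longlongrightarrow> 0) (at 0)"
      by (simp add: filterlim_at_split)
    then show ?thesis using 3 by (simp add: DERIV_def flat_exp_def)
  qed
qed

lemma times_differentiable_flat_exp:
  assumes "times_differentiable m f"
  shows "times_differentiable m (\<lambda>x. flat_exp P (f x))"
  by (rule times_differentiable_compose[where H = "range flat_exp"])
     (use flat_exp_has_derivative assms in blast)+

lemma times_differentiable_inner_self:
  "times_differentiable m (\<lambda>x :: real ^ 'n. (x - c) \<bullet> (x - c))"
proof (cases m)
  case 0
  then show ?thesis by (auto intro!: continuous_intros)
next
  case (Suc n)
  have "times_differentiable n (\<lambda>x. 2 * (x \<bullet> v) + - 2 * (c \<bullet> v))" for v :: "real ^ 'n"
    by (intro times_differentiable_add times_differentiable_linear times_differentiable_const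
        bounded_linear_const_mult bounded_linear_inner_left)
  then show ?thesis unfolding Suc
    by (intro times_differentiable_SucI[where u' = "\<lambda>x v. 2 * (x \<bullet> v) + - 2 * (c \<bullet> v)"])
       (auto intro!: derivative_eq_intros simp: inner_commute algebra_simps)
qed

definition bump :: "real \<Rightarrow> real ^ 'n \<Rightarrow> real" where
  "bump r z = flat_exp 1 (r\<^sup>2 - z \<bullet> z)"

lemma bump_nonneg: "0 \<le> bump r z"
  by (simp add: bump_def flat_exp_def)

lemma bump_pos_iff: "0 < r \<Longrightarrow> 0 < bump r z \<longleftrightarrow> norm z < r"
  by (auto simp: bump_def flat_exp_def dot_square_norm intro: power_strict_mono power_less_imp_less_base[of _ 2])

lemma times_differentiable_bump: "times_differentiable m (bump r :: real ^ 'n \<Rightarrow> real)"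
proof -
  have "times_differentiable m (\<lambda>x :: real ^ 'n. r\<^sup>2 + - 1 * ((x - 0) \<bullet> (x - 0)))"
    by (intro times_differentiable_add times_differentiable_mult times_differentiable_const
        times_differentiable_inner_self)
  from times_differentiable_flat_exp[OF this, of 1] show ?thesis
    by (simp add: bump_def[abs_def])
qed

text \<open>Every derivative falls on the kernel \<open>\<kappa>\<close>: the Leibniz rule over the fixed box differentiates under the integral sign,
  and the result is a convolution of the same form with a directional derivative of \<open>\<kappa>\<close>.\<close>

lemma times_differentiable_convolution:
  fixes \<kappa> g :: "real ^ 'n \<Rightarrow> real"
  assumes "times_differentiable m \<kappa>" and g: "continuous_on UNIV g"
  shows "times_differentiable m (\<lambda>x. integral (cbox a b) (\<lambda>y. \<kappa> (x - y) * g y))"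
  using assms(1)
proof (induction m arbitrary: \<kappa>)
  case 0
  have "continuous_on (UNIV \<times> cbox a b) (\<lambda>(x, y). \<kappa> (x - y) * g y)"
    using 0 unfolding split_beta
    by (auto intro!: continuous_intros continuous_on_compose2[of UNIV \<kappa>] continuous_on_compose2[OF g])
  then show ?case by (auto intro: integral_continuous_on_param)
next
  case (Suc m)
  define D where "D v x = frechet_derivative \<kappa> (at x) v" for v x
  have D: "(\<kappa> has_derivative (\<lambda>v. D v x)) (at x)" for x
    unfolding D_def using times_differentiable_derivative[OF Suc.prems] by simp
  have Dm: "times_differentiable m (D v)" for v
    using Suc.prems by (simp add: D_def[abs_def])
  then have contD: "continuous_on UNIV (D v)" for v
    by (rule times_differentiable_imp_continuous)
  have cont: "continuous_on UNIV \<kappa>"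
    by (rule times_differentiable_imp_continuous[OF Suc.prems])
  \<comment> \<open>the derivative of the integrand, as an element of the Banach space of bounded linear maps\<close>
  define F where "F x y = (\<Sum>i\<in>Basis. (D i (x - y) * g y) *\<^sub>R blinfun_inner_left i)" for x y :: "real ^ 'n"
  have F: "blinfun_apply (F x y) v = D v (x - y) * g y" for x y v
  proof -
    have lin: "linear (\<lambda>v. D v (x - y))" using D by (rule has_derivative_linear)
    have "D v (x - y) = D (\<Sum>i\<in>Basis. (v \<bullet> i) *\<^sub>R i) (x - y)" by (simp add: euclidean_representation)
    also have "\<dots> = (\<Sum>i\<in>Basis. (v \<bullet> i) * D i (x - y))"
      using linear_sum[OF lin, of "\<lambda>i. (v \<bullet> i) *\<^sub>R i" Basis] linear_cmul[OF lin] by simp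
    finally show ?thesis
      by (simp add: F_def blinfun.sum_left blinfun.scaleR_left sum_distrib_left inner_commute mult_ac)
  qed
  have contF: "continuous_on (UNIV \<times> cbox a b) (\<lambda>(x, y). F x y)"
    unfolding F_def split_beta
    by (auto intro!: continuous_intros continuous_on_compose2[OF contD] continuous_on_compose2[OF g])
  have int: "(\<lambda>y. f (x - y) * g y) integrable_on cbox a b" if "continuous_on UNIV f" for f x
    by (intro integrable_continuous continuous_on_mult continuous_on_compose2[OF that]
        continuous_on_subset[OF g] continuous_intros) auto
  have "((\<lambda>x. integral (cbox a b) (\<lambda>y. \<kappa> (x - y) * g y)) has_derivative
      (\<lambda>v. integral (cbox a b) (\<lambda>y. D v (x - y) * g y))) (at x)" for x
  proof -
    have "((\<lambda>x. integral (cbox a b) (\<lambda>y. \<kappa> (x - y) * g y)) has_derivative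
        blinfun_apply (integral (cbox a b) (F x))) (at x within UNIV)"
    proof (rule leibniz_rule[OF _ _ contF])
      fix x y
      show "((\<lambda>x. \<kappa> (x - y) * g y) has_derivative blinfun_apply (F x y)) (at x within UNIV)"
        by (rule has_derivative_eq_rhs[OF has_derivative_mult_left
              [OF has_derivative_compose[OF _ D, of "\<lambda>x. x - y" "\<lambda>v. v"]]])
           (auto simp: F intro!: derivative_eq_intros)
    qed (use int cont in auto)
    moreover have "blinfun_apply (integral (cbox a b) (F x)) v = integral (cbox a b) (\<lambda>y. D v (x - y) * g y)" for v
    proof -
      have "F x integrable_on cbox a b"
        using continuous_on_compose2[OF contF continuous_on_Pair[OF continuous_on_const continuous_on_id],
            of x "cbox a b"]
        by (intro integrable_continuous) auto
      then have "blinfun_apply (integral (cbox a b) (F x)) v = integral (cbox a b) (\<lambda>y. blinfun_apply (F x y) v)"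
        by (rule blinfun_apply_integral)
      then show ?thesis by (simp add: F)
    qed
    ultimately show ?thesis by (rule has_derivative_eq_rhs[OF _ ext])
  qed
  then show ?case
    by (rule times_differentiable_SucI) (rule Suc.IH[OF Dm])
qed

section \<open>Smooth cut-offs\<close>

lemma distr_lborel_reflect: "distr lborel borel (\<lambda>y :: 'a::euclidean_space. x - y) = lborel"
  by (subst (2) lborel_affine[of "- 1" x]) (auto simp: density_1)

lemma integrable_bump: "0 < r \<Longrightarrow> integrable lborel (bump r :: real ^ 'n \<Rightarrow> real)"
proof -
  assume r: "0 < r"
  have cont: "continuous_on UNIV (bump r :: real ^ 'n \<Rightarrow> real)"
    using times_differentiable_bump by (rule times_differentiable_imp_continuous)
  have "integrable lborel (\<lambda>z :: real ^ 'n. indicator (cball 0 r) z *\<^sub>R (bump r z :: real))"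
    by (rule borel_integrable_compact) (auto intro: continuous_on_subset[OF cont])
  also have "(\<lambda>z :: real ^ 'n. indicator (cball 0 r) z *\<^sub>R (bump r z :: real)) = bump r"
  proof
    fix z :: "real ^ 'n"
    show "indicator (cball 0 r) z *\<^sub>R (bump r z :: real) = bump r z"
      using bump_pos_iff[OF r, of z] bump_nonneg[of r z] by (auto simp: indicator_def)
  qed
  finally show ?thesis .
qed

lemma integral_bump_pos: "0 < r \<Longrightarrow> 0 < (\<integral>z. bump r (z :: real ^ 'n) \<partial>lborel)"
proof -
  assume r: "0 < r"
  have "(\<integral>z. bump r (z :: real ^ 'n) \<partial>lborel) \<noteq> 0"
  proof
    assume "(\<integral>z. bump r (z :: real ^ 'n) \<partial>lborel) = 0"
    then have "AE z :: real ^ 'n in lborel. bump r z = 0"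
      by (subst (asm) integral_nonneg_eq_0_iff_AE) (auto simp: integrable_bump[OF r] bump_nonneg)
    then have "AE z :: real ^ 'n in lborel. z \<notin> ball 0 r"
      by eventually_elim (use bump_pos_iff[OF r] in force)
    then have "ball (0 :: real ^ 'n) r \<in> null_sets lborel"
      by (subst AE_iff_null_sets) auto
    then show False
      using open_not_negligible[of "ball (0 :: real ^ 'n) r"] r
        null_sets_completionI[of "ball (0 :: real ^ 'n) r" lborel]
      unfolding negligible_iff_null_sets by auto
  qed
  moreover have "0 \<le> (\<integral>z. bump r (z :: real ^ 'n) \<partial>lborel)"
    by (intro integral_nonneg_AE) (simp add: bump_nonneg)
  ultimately show ?thesis by linarith
qed

lemma infdist_add_norm: "infdist x A \<le> infdist (x - z) A + norm (z :: real ^ 'n)"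
  using infdist_triangle[of x A "x - z"] by (simp add: dist_norm)

text \<open>The cut-off is a mollified multiple of the distance to the complement, truncated to
  \<open>[0, 1]\<close>. The truncation starts a little inside \<open>K\<close> and ends a little before the depth \<open>\<delta>\<close>,
  which leaves room for the mollifier and costs the factor \<open>\<theta>\<close> in the Lipschitz constant.\<close>

lemma exists_test_function_cutoff:
  fixes K :: "(real ^ 'n) set"
  assumes K: "open K" "bounded K" and \<delta>: "0 < \<delta>" and \<theta>: "1 < \<theta>"
  obtains \<phi> where "\<phi> \<in> test_functions K" "\<And>x. 0 \<le> \<phi> x" "\<And>x. \<phi> x \<le> 1"
    "\<And>x. \<delta> \<le> infdist x (- K) \<Longrightarrow> \<phi> x = 1"
    "\<And>x y. \<bar>\<phi> x - \<phi> y\<bar> \<le> \<theta> / \<delta> * norm (x - y)"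
proof -
  have ne: "- K \<noteq> {}" using K(2) by (metis Compl_empty_eq double_complement not_bounded_UNIV)
  define a where "a = \<delta> * (1 - 1 / \<theta>) / 2"
  define r where "r = a / 2"
  have a: "0 < a" "\<delta> - 2 * a = \<delta> / \<theta>"
    using \<delta> \<theta> by (auto simp: a_def field_simps)
  have r: "0 < r" "r < a" using a by (auto simp: r_def)
  define d where "d x = infdist x (- K)" for x
  define g where "g x = max 0 (min 1 ((d x - a) / (\<delta> / \<theta>)))" for x
  have d_cont: "continuous_on UNIV d" unfolding d_def by (intro continuous_intros)
  then have g_cont: "continuous_on UNIV g"
    unfolding g_def using \<delta> \<theta> by (intro continuous_intros) auto
  then have [measurable]: "g \<in> borel_measurable borel" by (rule borel_measurable_continuous_onI)
  have g01: "0 \<le> g x" "g x \<le> 1" for x by (auto simp: g_def)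
  have g1: "g x = 1" if "\<delta> - a \<le> d x" for x
  proof -
    have "\<delta> / \<theta> \<le> d x - a" using that a by linarith
    then show ?thesis using \<delta> \<theta> by (simp add: g_def field_simps min_def max_def)
  qed
  have g0: "a < d x" if "g x \<noteq> 0" for x
  proof (rule ccontr)
    assume "\<not> a < d x"
    then have "(d x - a) / (\<delta> / \<theta>) \<le> 0"
      using \<delta> \<theta> by (intro divide_nonpos_pos) auto
    with that show False by (simp add: g_def)
  qed
  have d_lip: "\<bar>d x - d y\<bar> \<le> norm (x - y)" for x y
    using infdist_triangle_abs[of x "- K" y] by (simp add: d_def dist_norm)
  have g_lip: "\<bar>g x - g y\<bar> \<le> \<theta> / \<delta> * norm (x - y)" for x y
  proof -
    have "\<bar>g x - g y\<bar> \<le> \<bar>(d x - a) / (\<delta> / \<theta>) - (d y - a) / (\<delta> / \<theta>)\<bar>"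
      unfolding g_def by linarith
    also have "(d x - a) / (\<delta> / \<theta>) - (d y - a) / (\<delta> / \<theta>) = \<theta> / \<delta> * (d x - d y)"
      by (simp add: algebra_simps diff_divide_distrib)
    also have "\<bar>\<theta> / \<delta> * (d x - d y)\<bar> = \<theta> / \<delta> * \<bar>d x - d y\<bar>"
      using \<delta> \<theta> by (simp add: abs_mult)
    also have "\<dots> \<le> \<theta> / \<delta> * norm (x - y)"
      using \<delta> \<theta> d_lip by (intro mult_left_mono) auto
    finally show ?thesis .
  qed
  have supp: "x \<in> K" if "0 < d x" for x
    using that by (auto simp: d_def intro: ccontr)
  obtain c where c: "K \<subseteq> cbox (- c) c" using bounded_subset_cbox_symmetric[OF K(2)] by blast
  define I where "I = (\<integral>z. bump r (z :: real ^ 'n) \<partial>lborel)"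
  have I: "0 < I" unfolding I_def by (rule integral_bump_pos) fact
  have [measurable]: "(bump r :: real ^ 'n \<Rightarrow> real) \<in> borel_measurable borel"
    using integrable_bump[OF r(1)] by auto
  define \<phi> where "\<phi> x = 1 / I * integral (cbox (- c) c) (\<lambda>y. bump r (x - y) * g y)" for x
  have int: "integrable lborel (\<lambda>z. bump r z * g (x - z))" for x
    by (rule Bochner_Integration.integrable_bound[OF integrable_bump[OF r(1)]])
       (auto simp: abs_mult g01 bump_nonneg mult_left_le intro!: always_eventually)
  have refl: "integrable lborel (\<lambda>y. bump r (x - y) * g y)"
    "(\<integral>y. bump r (x - y) * g y \<partial>lborel) = (\<integral>z. bump r z * g (x - z) \<partial>lborel)" for x
  proof -
    show "integrable lborel (\<lambda>y. bump r (x - y) * g y)"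
      using int[of x] by (subst distr_lborel_reflect[of x, symmetric], subst integrable_distr_eq) auto
    show "(\<integral>y. bump r (x - y) * g y \<partial>lborel) = (\<integral>z. bump r z * g (x - z) \<partial>lborel)"
      by (subst distr_lborel_reflect[of x, symmetric], subst integral_distr) auto
  qed
  have \<phi>_eq: "\<phi> x = 1 / I * (\<integral>z. bump r z * g (x - z) \<partial>lborel)" for x
  proof -
    have "g y = 0" if "y \<notin> cbox (- c) c" for y
      using that c g0[of y] supp[of y] a by (meson less_trans subsetD)
    then have eq: "(\<lambda>y. if y \<in> cbox (- c) c then bump r (x - y) * g y else 0) = (\<lambda>y. bump r (x - y) * g y)"
      by auto
    have "integral (cbox (- c) c) (\<lambda>y. bump r (x - y) * g y) = integral UNIV (\<lambda>y. bump r (x - y) * g y)"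
      using integral_restrict_UNIV[of "cbox (- c) c" "\<lambda>y. bump r (x - y) * g y"] unfolding eq by simp
    also have "\<dots> = (\<integral>y. bump r (x - y) * g y \<partial>lborel)"
      by (rule integral_lborel[OF refl(1)])
    finally show ?thesis by (simp add: \<phi>_def refl(2))
  qed
  have smooth: "smooth \<phi>"
    unfolding smooth_def \<phi>_def
    by (intro allI times_differentiable_mult times_differentiable_const
        times_differentiable_convolution times_differentiable_bump g_cont)
  have nonneg: "0 \<le> \<phi> x" for x
    unfolding \<phi>_eq using I by (intro mult_nonneg_nonneg integral_nonneg_AE) (auto simp: g01 bump_nonneg)
  have le1: "\<phi> x \<le> 1" for x
  proof -
    have "(\<integral>z. bump r z * g (x - z) \<partial>lborel) \<le> I"
      unfolding I_def by (intro integral_mono int integrable_bump r) (auto simp: g01 bump_nonneg mult_left_le)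
    then show ?thesis using I by (simp add: \<phi>_eq)
  qed
  have eq1: "\<phi> x = 1" if "\<delta> \<le> infdist x (- K)" for x
  proof -
    have "bump r z * g (x - z) = bump r z" for z
    proof (cases "norm z < r")
      case True
      then have "g (x - z) = 1"
        using that infdist_add_norm[of x "- K" z] r by (intro g1) (simp add: d_def)
      then show ?thesis by simp
    next
      case False
      then show ?thesis using bump_pos_iff[OF r(1), of z] bump_nonneg[of r z] by simp
    qed
    then have "(\<lambda>z. bump r z * g (x - z)) = bump r" by (rule ext)
    then have "(\<integral>z. bump r z * g (x - z) \<partial>lborel) = I" by (simp only: I_def)
    then show ?thesis using I by (simp add: \<phi>_eq)
  qed
  have lip: "\<bar>\<phi> x - \<phi> y\<bar> \<le> \<theta> / \<delta> * norm (x - y)" for x y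
  proof -
    have "\<phi> x - \<phi> y = 1 / I * (\<integral>z. bump r z * g (x - z) - bump r z * g (y - z) \<partial>lborel)"
      by (simp add: \<phi>_eq right_diff_distrib int)
    then have eq: "\<bar>\<phi> x - \<phi> y\<bar> = 1 / I * \<bar>\<integral>z. bump r z * g (x - z) - bump r z * g (y - z) \<partial>lborel\<bar>"
      using I by (simp add: abs_mult)
    have "\<bar>\<integral>z. bump r z * g (x - z) - bump r z * g (y - z) \<partial>lborel\<bar>
        \<le> (\<integral>z. \<bar>bump r z * g (x - z) - bump r z * g (y - z)\<bar> \<partial>lborel)"
      using integral_norm_bound[of lborel "\<lambda>z. bump r z * g (x - z) - bump r z * g (y - z)"] by simp
    also have "\<dots> \<le> (\<integral>z. \<theta> / \<delta> * norm (x - y) * bump r (z :: real ^ 'n) \<partial>lborel)"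
    proof (rule integral_mono)
      fix z :: "real ^ 'n"
      have "\<bar>bump r z * g (x - z) - bump r z * g (y - z)\<bar> = bump r z * \<bar>g (x - z) - g (y - z)\<bar>"
        using bump_nonneg[of r z] by (simp add: right_diff_distrib[symmetric] abs_mult)
      also have "\<dots> \<le> bump r z * (\<theta> / \<delta> * norm (x - y))"
        using g_lip[of "x - z" "y - z"] bump_nonneg[of r z] by (intro mult_left_mono) auto
      finally show "\<bar>bump r z * g (x - z) - bump r z * g (y - z)\<bar> \<le> \<theta> / \<delta> * norm (x - y) * bump r z"
        by (simp add: mult_ac)
    qed (intro integrable_abs Bochner_Integration.integrable_diff integrable_mult_right int integrable_bump r)+
    also have "\<dots> = \<theta> / \<delta> * norm (x - y) * I" by (simp add: I_def)
    finally have "1 / I * \<bar>\<integral>z. bump r z * g (x - z) - bump r z * g (y - z) \<partial>lborel\<bar>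
        \<le> 1 / I * (\<theta> / \<delta> * norm (x - y) * I)"
      using I by (intro mult_left_mono) auto
    with eq show ?thesis using I by simp
  qed
  have supp_sub: "{x. \<phi> x \<noteq> 0} \<subseteq> {x. a / 2 \<le> d x}"
  proof
    fix x assume "x \<in> {x. \<phi> x \<noteq> 0}"
    then have "\<phi> x \<noteq> 0" by simp
    have "\<exists>z. bump r z * g (x - z) \<noteq> 0"
    proof (rule ccontr)
      assume "\<not> ?thesis"
      then have "(\<lambda>z. bump r z * g (x - z)) = (\<lambda>z. 0)" by auto
      then have "\<phi> x = 0" unfolding \<phi>_eq by (simp only: integral_zero mult_zero_right)
      with \<open>\<phi> x \<noteq> 0\<close> show False ..
    qed
    then obtain z where z: "bump r z * g (x - z) \<noteq> 0" by blast
    then have "norm z < r" using bump_pos_iff[OF r(1), of z] bump_nonneg[of r z] by (auto simp: less_le)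
    moreover have "a < d (x - z)" using z by (intro g0) auto
    ultimately have "a / 2 \<le> d x"
      using d_lip[of "x - z" x] by (simp add: r_def)
    then show "x \<in> {x. a / 2 \<le> d x}" by simp
  qed
  have closed: "closed {x. a / 2 \<le> d x}"
    by (intro closed_Collect_le continuous_intros d_cont)
  have sub: "{x. a / 2 \<le> d x} \<subseteq> K" using supp a by (auto intro: less_le_trans[of 0 "a / 2"])
  have cl: "closure {x. \<phi> x \<noteq> 0} \<subseteq> {x. a / 2 \<le> d x}"
    using closed supp_sub by (rule closure_minimal[rotated])
  then have "compact (closure {x. \<phi> x \<noteq> 0})"
    using sub bounded_subset[OF K(2), of "closure {x. \<phi> x \<noteq> 0}"] unfolding compact_eq_bounded_closed by blast
  with smooth cl sub have "\<phi> \<in> test_functions K"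
    unfolding test_functions_def by auto
  with nonneg le1 eq1 lip show thesis by (intro that[of \<phi>]) auto
qed

section \<open>Seminorm and weighted integral of a cut-off\<close>

text \<open>What the estimate of the seminorm needs to know about a cut-off. It is constant at depth \<open>\<delta>\<close> and more, and
  outside \<open>K\<close>, so its gradient lives on the layer of depth \<open>\<delta>\<close>, where it is at most \<open>L\<close>.\<close>

locale cutoff =
  fixes K :: "(real ^ 'n) set" and \<phi> :: "real ^ 'n \<Rightarrow> real" and L \<delta> :: real
  assumes K: "open K" "bounded K"
    and test: "\<phi> \<in> test_functions K"
    and range: "0 \<le> \<phi> x" "\<phi> x \<le> 1"
    and deep: "\<delta> \<le> infdist x (- K) \<Longrightarrow> \<phi> x = 1"
    and lipschitz: "\<bar>\<phi> x - \<phi> y\<bar> \<le> L * norm (x - y)"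
begin

definition \<phi>' :: "real ^ 'n \<Rightarrow> real ^ 'n \<Rightarrow> real" where
  "\<phi>' x v = frechet_derivative \<phi> (at x) v"

lemma L_nonneg: "0 \<le> L"
proof -
  obtain v :: "real ^ 'n" where "norm v = 1" using vector_choose_size[of 1] by auto
  then show ?thesis using lipschitz[of v 0] abs_ge_zero[of "\<phi> v - \<phi> 0"] by simp
qed

lemma times_differentiable: "times_differentiable m \<phi>"
  using test by (auto simp: test_functions_def smooth_def)

lemma has_derivative: "(\<phi> has_derivative \<phi>' x) (at x)"
  unfolding \<phi>'_def by (rule times_differentiable_derivative) (rule times_differentiable)

lemma continuous_directional_derivative: "continuous_on UNIV (\<lambda>x. \<phi>' x v)"
  using times_differentiable[of "Suc 0"] by (simp add: \<phi>'_def)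

lemma directional_derivative_measurable [measurable]: "(\<lambda>(x, v). \<phi>' x v) \<in> borel_measurable (borel \<Otimes>\<^sub>M borel)"
proof -
  have [measurable]: "(\<lambda>x. \<phi>' x v) \<in> borel_measurable borel" for v
    by (intro borel_measurable_continuous_onI continuous_directional_derivative)
  have rep: "\<phi>' x v = (\<Sum>i\<in>Basis. (v \<bullet> i) * \<phi>' x i)" for x v
  proof -
    have lin: "linear (\<phi>' x)" using has_derivative by (rule has_derivative_linear)
    have "\<phi>' x v = \<phi>' x (\<Sum>i\<in>Basis. (v \<bullet> i) *\<^sub>R i)" by (simp add: euclidean_representation)
    also have "\<dots> = (\<Sum>i\<in>Basis. (v \<bullet> i) * \<phi>' x i)"
      using linear_sum[OF lin, of "\<lambda>i. (v \<bullet> i) *\<^sub>R i" Basis] linear_cmul[OF lin] by simp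
    finally show ?thesis .
  qed
  have "(\<lambda>(x, v). \<phi>' x v) = (\<lambda>(x, v). \<Sum>i\<in>Basis. (v \<bullet> i) * \<phi>' x i)"
    by (intro ext, unfold split_beta, rule rep)
  also have "\<dots> \<in> borel_measurable (borel \<Otimes>\<^sub>M borel)" by measurable
  finally show ?thesis .
qed

lemma measurable_cutoff [measurable]: "\<phi> \<in> borel_measurable borel"
  using test by (rule test_functionsD)

lemma along_line: "((\<lambda>t. \<phi> (x + t *\<^sub>R v)) has_real_derivative \<phi>' (x + t *\<^sub>R v) v) (at t within T)"
proof -
  have "((\<lambda>t. \<phi> (x + t *\<^sub>R v)) has_derivative (\<lambda>h. \<phi>' (x + t *\<^sub>R v) (h *\<^sub>R v))) (at t within T)"
    by (rule has_derivative_compose[OF _ has_derivative]) (auto intro!: derivative_eq_intros)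
  then show ?thesis
    using linear_cmul[OF has_derivative_linear[OF has_derivative], of "x + t *\<^sub>R v" _ v]
    by (simp add: has_field_derivative_def mult.commute[of _ "\<phi>' (x + t *\<^sub>R v) v"])
qed

lemma directional_derivative_le: "\<bar>\<phi>' x v\<bar> \<le> L * norm v"
proof -
  have "((\<lambda>h. (\<phi> (x + h *\<^sub>R v) - \<phi> x) / h) \<longlongrightarrow> \<phi>' x v) (at 0)"
    using along_line[of x v 0 UNIV] by (simp add: DERIV_def)
  then have "((\<lambda>h. \<bar>(\<phi> (x + h *\<^sub>R v) - \<phi> x) / h\<bar>) \<longlongrightarrow> \<bar>\<phi>' x v\<bar>) (at 0)"
    by (rule tendsto_rabs)
  then show ?thesis
  proof (rule tendsto_upperbound)
    show "\<forall>\<^sub>F h in at 0. \<bar>(\<phi> (x + h *\<^sub>R v) - \<phi> x) / h\<bar> \<le> L * norm v"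
      using lipschitz[of "x + h *\<^sub>R v" x for h]
      by (auto simp: eventually_at_filter abs_divide divide_simps mult_ac intro!: always_eventually)
  qed simp
qed

text \<open>Off the layer the cut-off takes one of its extreme values \<open>0\<close> and \<open>1\<close>, so the derivative vanishes.\<close>

lemma directional_derivative_eq_0:
  assumes "\<not> (x \<in> K \<and> infdist x (- K) < \<delta>)"
  shows "\<phi>' x v = 0"
proof -
  have "\<phi> x = 0 \<or> \<phi> x = 1" using assms deep[of x] test_functionsD(3)[OF test, of x] by fastforce
  then have "(\<forall>y\<in>UNIV. \<phi> y \<le> \<phi> x) \<or> (\<forall>y\<in>UNIV. \<phi> x \<le> \<phi> y)" using range by metis
  then have "\<phi>' x = (\<lambda>v. 0)"
    using differential_zero_maxmin[of x UNIV \<phi> "\<phi>' x"] has_derivative by auto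
  then show ?thesis by simp
qed

text \<open>Integrate the derivative along the segment from \<open>x\<close> to \<open>x + z\<close>, exchange the integrals and use translation
  invariance.\<close>

lemma nn_integral_increment_le:
  "(\<integral>\<^sup>+x. ennreal \<bar>\<phi> (x + z) - \<phi> x\<bar> \<partial>lborel) \<le> (\<integral>\<^sup>+x. ennreal \<bar>\<phi>' x z\<bar> \<partial>lborel)"
proof -
  have [measurable]: "(\<lambda>x. \<phi>' x z) \<in> borel_measurable borel"
    by (intro borel_measurable_continuous_onI continuous_directional_derivative)
  have "(\<integral>\<^sup>+x. ennreal \<bar>\<phi> (x + z) - \<phi> x\<bar> \<partial>lborel)
      \<le> (\<integral>\<^sup>+x. (\<integral>\<^sup>+t. ennreal \<bar>\<phi>' (x + t *\<^sub>R z) z\<bar> * indicator {0..1} t \<partial>lborel) \<partial>lborel)"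
  proof (rule nn_integral_mono)
    fix x
    let ?g = "\<lambda>t. \<phi>' (x + t *\<^sub>R z) z"
    have g: "(?g has_integral (\<phi> (x + 1 *\<^sub>R z) - \<phi> (x + 0 *\<^sub>R z))) {0..1}"
      by (rule fundamental_theorem_of_calculus)
         (use along_line in \<open>auto simp: has_real_derivative_iff_has_vector_derivative[symmetric]\<close>)
    have "continuous_on {0..1} ?g"
      by (rule continuous_on_compose2[OF continuous_directional_derivative]) (auto intro!: continuous_intros)
    then have abs: "(\<lambda>t. \<bar>?g t\<bar>) integrable_on {0..1}"
      by (intro integrable_continuous_real continuous_intros)
    have "\<bar>\<phi> (x + z) - \<phi> x\<bar> \<le> integral {0..1} (\<lambda>t. \<bar>?g t\<bar>)"
      using integral_norm_bound_integral[OF has_integral_integrable[OF g] abs] integral_unique[OF g] by simp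
    then have "ennreal \<bar>\<phi> (x + z) - \<phi> x\<bar> \<le> ennreal (integral {0..1} (\<lambda>t. \<bar>?g t\<bar>))"
      by (rule ennreal_leI)
    also have "\<dots> = (\<integral>\<^sup>+t. ennreal \<bar>\<phi>' (x + t *\<^sub>R z) z\<bar> * indicator {0..1} t \<partial>lborel)"
      using nn_integral_has_integral_lebesgue'[OF _ integrable_integral[OF abs]] by simp
    finally show "ennreal \<bar>\<phi> (x + z) - \<phi> x\<bar>
        \<le> (\<integral>\<^sup>+t. ennreal \<bar>\<phi>' (x + t *\<^sub>R z) z\<bar> * indicator {0..1} t \<partial>lborel)" .
  qed
  also have "\<dots> = (\<integral>\<^sup>+t. (\<integral>\<^sup>+x. ennreal \<bar>\<phi>' (x + t *\<^sub>R z) z\<bar> * indicator {0..1} t \<partial>lborel) \<partial>lborel)"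
    by (rule lborel_pair.Fubini') measurable
  also have "\<dots> = (\<integral>\<^sup>+t. (\<integral>\<^sup>+x. ennreal \<bar>\<phi>' x z\<bar> \<partial>lborel) * indicator {0..1::real} t \<partial>lborel)"
  proof (rule nn_integral_cong)
    fix t :: real
    have "(\<integral>\<^sup>+x. ennreal \<bar>\<phi>' (x + t *\<^sub>R z) z\<bar> * indicator {0..1} t \<partial>lborel)
        = (\<integral>\<^sup>+x. ennreal \<bar>\<phi>' (t *\<^sub>R z + x) z\<bar> \<partial>lborel) * indicator {0..1} t"
      by (simp add: nn_integral_multc add.commute)
    also have "(\<integral>\<^sup>+x. ennreal \<bar>\<phi>' (t *\<^sub>R z + x) z\<bar> \<partial>lborel) = (\<integral>\<^sup>+x. ennreal \<bar>\<phi>' x z\<bar> \<partial>lborel)"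
      by (rule nn_integral_lborel_translate) measurable
    finally show "(\<integral>\<^sup>+x. ennreal \<bar>\<phi>' (x + t *\<^sub>R z) z\<bar> * indicator {0..1} t \<partial>lborel)
        = (\<integral>\<^sup>+x. ennreal \<bar>\<phi>' x z\<bar> \<partial>lborel) * indicator {0..1} t" .
  qed
  also have "\<dots> = (\<integral>\<^sup>+x. ennreal \<bar>\<phi>' x z\<bar> \<partial>lborel)"
    by (simp add: nn_integral_cmult)
  finally show ?thesis .
qed

text \<open>On the unit ball \<open>\<bar>z \<bullet> e\<bar>\<close> agrees with its truncation at height \<open>1\<close>, whose integral against the
  kernel is known exactly.\<close>

lemma nn_integral_directional_derivative_le:
  fixes e :: "real ^ 'n"
  assumes \<sigma>: "0 < \<sigma>" "\<sigma> < 1" and e: "norm e = 1"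
  shows "(\<integral>\<^sup>+z. ennreal \<bar>\<phi>' x z\<bar> * (ennreal (riesz_kernel \<sigma> z) * indicator (ball 0 1) z) \<partial>lborel)
    \<le> ennreal (2 * L / (1 - \<sigma>)) * half_space_mass e \<sigma> * indicator {x \<in> K. infdist x (- K) < \<delta>} x"
proof (cases "x \<in> K \<and> infdist x (- K) < \<delta>")
  case False
  then show ?thesis using directional_derivative_eq_0[OF False] by simp
next
  case True
  have lin: "linear (\<phi>' x)" using has_derivative by (rule has_derivative_linear)
  define g where "g = adjoint (\<phi>' x) 1"
  have g: "\<phi>' x z = z \<bullet> g" for z
    using adjoint_works[OF lin, of z 1] by (simp add: g_def)
  have "norm g * norm g \<le> L * norm g"
    using directional_derivative_le[of x g] by (simp add: g dot_square_norm power2_eq_square)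
  then have g_le: "norm g \<le> L" using L_nonneg by (cases "g = 0") auto
  obtain n where n: "norm n = 1" "g = norm g *\<^sub>R n"
  proof (cases "g = 0")
    case True
    then show ?thesis using that[of e] e by simp
  next
    case False
    then show ?thesis using that[of "g /\<^sub>R norm g"] by simp
  qed
  let ?T = "\<lambda>n z. ennreal (min 1 (max 0 (z \<bullet> n))) * ennreal (riesz_kernel \<sigma> z)"
  have "(\<integral>\<^sup>+z. ennreal \<bar>\<phi>' x z\<bar> * (ennreal (riesz_kernel \<sigma> z) * indicator (ball 0 1) z) \<partial>lborel)
      \<le> (\<integral>\<^sup>+z. ennreal L * (?T n z + ?T (- n) z) \<partial>lborel)"
  proof (rule nn_integral_mono)
    fix z
    show "ennreal \<bar>\<phi>' x z\<bar> * (ennreal (riesz_kernel \<sigma> z) * indicator (ball 0 1) z)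
        \<le> ennreal L * (?T n z + ?T (- n) z)"
    proof (cases "norm z < 1")
      case True
      have "\<bar>z \<bullet> n\<bar> \<le> 1" using Cauchy_Schwarz_ineq2[of z n] n(1) True by simp
      then have abs: "\<bar>z \<bullet> n\<bar> = min 1 (max 0 (z \<bullet> n)) + min 1 (max 0 (z \<bullet> (- n)))" by simp
      have "\<bar>\<phi>' x z\<bar> = norm g * \<bar>z \<bullet> n\<bar>"
        using n(1) unfolding g by (subst n(2)) (simp add: abs_mult)
      also have "\<dots> \<le> L * (min 1 (max 0 (z \<bullet> n)) + min 1 (max 0 (z \<bullet> (- n))))"
        unfolding abs[symmetric] by (intro mult_right_mono g_le) simp
      finally have "ennreal \<bar>\<phi>' x z\<bar> \<le> ennreal (L * (min 1 (max 0 (z \<bullet> n)) + min 1 (max 0 (z \<bullet> (- n)))))"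
        by (rule ennreal_leI)
      also have "\<dots> = ennreal L * (ennreal (min 1 (max 0 (z \<bullet> n))) + ennreal (min 1 (max 0 (z \<bullet> (- n)))))"
        using L_nonneg by (simp only: ennreal_mult ennreal_plus add_nonneg_nonneg min.boundedI max.cobounded1 zero_le_one)
      finally have "ennreal \<bar>\<phi>' x z\<bar> * ennreal (riesz_kernel \<sigma> z)
          \<le> ennreal L * (ennreal (min 1 (max 0 (z \<bullet> n))) + ennreal (min 1 (max 0 (z \<bullet> (- n))))) * ennreal (riesz_kernel \<sigma> z)"
        by (rule mult_right_mono) simp
      then show ?thesis using True by (simp add: distrib_left distrib_right mult.assoc)
    qed simp
  qed
  also have "\<dots> = ennreal L * ((\<integral>\<^sup>+z. ?T n z \<partial>lborel) + (\<integral>\<^sup>+z. ?T (- n) z \<partial>lborel))"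
    by (subst nn_integral_cmult, measurable) (subst nn_integral_add, measurable)
  also have "\<dots> = ennreal L * (2 * (half_space_mass e \<sigma> * ennreal (1 / (1 - \<sigma>))))"
    using n(1) e half_space_mass_cong[of n e \<sigma>] half_space_mass_cong[of "- n" e \<sigma>]
    by (simp only: nn_integral_truncated_inner_riesz_kernel[OF \<sigma>] mult_2 norm_minus_cancel)
  also have "\<dots> = ennreal (2 * L / (1 - \<sigma>)) * half_space_mass e \<sigma>"
  proof -
    have "ennreal (2 * L / (1 - \<sigma>)) = ennreal L * 2 * ennreal (1 / (1 - \<sigma>))"
      using L_nonneg \<sigma> by (simp add: ennreal_mult''[symmetric] ennreal_numeral[symmetric] del: ennreal_numeral)
    then show ?thesis by (simp add: mult_ac)
  qed
  finally show ?thesis using True by simp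
qed

text \<open>The values lie in \<open>[0, 1]\<close>, hence \<open>\<bar>\<phi> x - \<phi> y\<bar>\<^sup>p \<le> \<bar>\<phi> x - \<phi> y\<bar>\<close> and only the total exponent \<open>s * p\<close> matters.
  Increments \<open>z\<close> shorter than \<open>1\<close> are controlled by the gradient and produce the factor \<open>1 / (1 - s * p)\<close>; the
  longer ones change the function on a set of measure at most twice that of \<open>K\<close>.\<close>

lemma gagliardo_pow_le:
  fixes e :: "real ^ 'n"
  assumes p: "1 \<le> p" and s: "0 < s" "s * p < 1" and e: "norm e = 1"
  shows "gagliardo_pow s p \<phi>
    \<le> ennreal (2 * L / (1 - s * p)) * half_space_mass e (s * p) * emeasure lborel {x \<in> K. infdist x (- K) < \<delta>}
      + 2 * emeasure lborel K * (\<integral>\<^sup>+z\<in>{z :: real ^ 'n. 1 \<le> norm z}. ennreal (riesz_kernel (s * p) z) \<partial>lborel)"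
proof -
  define \<sigma> where "\<sigma> = s * p"
  have \<sigma>: "0 < \<sigma>" "\<sigma> < 1" using p s by (auto simp: \<sigma>_def)
  have [measurable]: "K \<in> sets borel" "ball (0 :: real ^ 'n) 1 \<in> sets borel" using K(1) by simp_all
  have [measurable]: "{x \<in> K. infdist x (- K) < \<delta>} \<in> sets borel"
    by (intro borel_open open_Collect_conj open_Collect_less continuous_intros) (simp add: K(1))
  let ?k = "\<lambda>z :: real ^ 'n. ennreal (riesz_kernel \<sigma> z)"
  have "gagliardo_pow s p \<phi> \<le> (\<integral>\<^sup>+y. (\<integral>\<^sup>+x. ennreal \<bar>\<phi> x - \<phi> y\<bar> * ?k (x - y) \<partial>lborel) \<partial>lborel)"
    unfolding gagliardo_pow_eq \<sigma>_def
  proof (intro nn_integral_mono mult_right_mono ennreal_leI)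
    fix x y
    have "\<bar>\<phi> x - \<phi> y\<bar> \<le> 1" using range[of x] range[of y] by linarith
    then have "\<bar>\<phi> x - \<phi> y\<bar> powr p \<le> \<bar>\<phi> x - \<phi> y\<bar> powr 1" using p by (intro powr_mono') auto
    then show "\<bar>\<phi> x - \<phi> y\<bar> powr p \<le> \<bar>\<phi> x - \<phi> y\<bar>" by simp
  qed simp
  also have "\<dots> = (\<integral>\<^sup>+y. (\<integral>\<^sup>+z. ennreal \<bar>\<phi> (y + z) - \<phi> y\<bar> * ?k z \<partial>lborel) \<partial>lborel)"
  proof (rule nn_integral_cong)
    fix y
    show "(\<integral>\<^sup>+x. ennreal \<bar>\<phi> x - \<phi> y\<bar> * ?k (x - y) \<partial>lborel) = (\<integral>\<^sup>+z. ennreal \<bar>\<phi> (y + z) - \<phi> y\<bar> * ?k z \<partial>lborel)"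
      using nn_integral_lborel_translate[of "\<lambda>x. ennreal \<bar>\<phi> x - \<phi> y\<bar> * ?k (x - y)" y] by simp
  qed
  also have "\<dots> = (\<integral>\<^sup>+z. (\<integral>\<^sup>+y. ennreal \<bar>\<phi> (y + z) - \<phi> y\<bar> * ?k z \<partial>lborel) \<partial>lborel)"
    by (rule lborel_pair.Fubini') measurable
  also have "\<dots> = (\<integral>\<^sup>+z. (\<integral>\<^sup>+y. ennreal \<bar>\<phi> (y + z) - \<phi> y\<bar> \<partial>lborel) * ?k z \<partial>lborel)"
    by (simp add: nn_integral_multc)
  also have "\<dots> \<le> (\<integral>\<^sup>+z. (\<integral>\<^sup>+y. ennreal \<bar>\<phi>' y z\<bar> \<partial>lborel) * (?k z * indicator (ball 0 1) z)
      + 2 * emeasure lborel K * (?k z * indicator {z. 1 \<le> norm z} z) \<partial>lborel)"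
  proof (rule nn_integral_mono)
    fix z
    show "(\<integral>\<^sup>+y. ennreal \<bar>\<phi> (y + z) - \<phi> y\<bar> \<partial>lborel) * ?k z
      \<le> (\<integral>\<^sup>+y. ennreal \<bar>\<phi>' y z\<bar> \<partial>lborel) * (?k z * indicator (ball 0 1) z)
        + 2 * emeasure lborel K * (?k z * indicator {z. 1 \<le> norm z} z)"
    proof (cases "norm z < 1")
      case True
      then show ?thesis using nn_integral_increment_le[of z] by (auto intro: mult_right_mono)
    next
      case False
      have "(\<integral>\<^sup>+y. ennreal \<bar>\<phi> (y + z) - \<phi> y\<bar> \<partial>lborel) \<le> (\<integral>\<^sup>+y. indicator K (z + y) + indicator K y \<partial>lborel)"
      proof (rule nn_integral_mono)
        fix y
        have "\<bar>\<phi> (y + z) - \<phi> y\<bar> \<le> indicator K (z + y) + indicator K y"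
          using range[of "y + z"] range[of y] test_functionsD(3)[OF test, of y] test_functionsD(3)[OF test, of "y + z"]
          by (auto simp: indicator_def add.commute)
        then have "ennreal \<bar>\<phi> (y + z) - \<phi> y\<bar> \<le> ennreal (indicator K (z + y) + indicator K y)"
          by (rule ennreal_leI)
        then show "ennreal \<bar>\<phi> (y + z) - \<phi> y\<bar> \<le> indicator K (z + y) + indicator K y"
          by (simp add: ennreal_indicator)
      qed
      also have "\<dots> = (\<integral>\<^sup>+y. indicator K (z + y) \<partial>lborel) + emeasure lborel K"
        by (subst nn_integral_add) auto
      also have "(\<integral>\<^sup>+y. indicator K (z + y) \<partial>lborel) = emeasure lborel K"
        by (subst nn_integral_lborel_translate) auto
      finally have "(\<integral>\<^sup>+y. ennreal \<bar>\<phi> (y + z) - \<phi> y\<bar> \<partial>lborel) * ?k z \<le> (2 * emeasure lborel K) * ?k z"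
        by (intro mult_right_mono) (simp_all add: mult_2)
      with False show ?thesis by simp
    qed
  qed
  also have "\<dots> = (\<integral>\<^sup>+z. (\<integral>\<^sup>+y. ennreal \<bar>\<phi>' y z\<bar> \<partial>lborel) * (?k z * indicator (ball 0 1) z) \<partial>lborel)
      + (\<integral>\<^sup>+z. 2 * emeasure lborel K * (?k z * indicator {z. 1 \<le> norm z} z) \<partial>lborel)"
    by (rule nn_integral_add) measurable
  also have "\<dots> = (\<integral>\<^sup>+z. (\<integral>\<^sup>+y. ennreal \<bar>\<phi>' y z\<bar> * (?k z * indicator (ball 0 1) z) \<partial>lborel) \<partial>lborel)
      + 2 * emeasure lborel K * (\<integral>\<^sup>+z\<in>{z. 1 \<le> norm z}. ?k z \<partial>lborel)"
    by (simp add: nn_integral_cmult nn_integral_multc)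
  also have "(\<integral>\<^sup>+z. (\<integral>\<^sup>+y. ennreal \<bar>\<phi>' y z\<bar> * (?k z * indicator (ball 0 1) z) \<partial>lborel) \<partial>lborel)
      = (\<integral>\<^sup>+y. (\<integral>\<^sup>+z. ennreal \<bar>\<phi>' y z\<bar> * (?k z * indicator (ball 0 1) z) \<partial>lborel) \<partial>lborel)"
    by (rule lborel_pair.Fubini') measurable
  also have "\<dots> \<le> (\<integral>\<^sup>+y. ennreal (2 * L / (1 - \<sigma>)) * half_space_mass e \<sigma>
      * indicator {x \<in> K. infdist x (- K) < \<delta>} y \<partial>lborel)"
    by (intro nn_integral_mono nn_integral_directional_derivative_le \<sigma> e)
  also have "\<dots> = ennreal (2 * L / (1 - \<sigma>)) * half_space_mass e \<sigma> * emeasure lborel {x \<in> K. infdist x (- K) < \<delta>}"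
    by (subst nn_integral_cmult) auto
  finally show ?thesis by (simp add: \<sigma>_def add_right_mono)
qed

end

lemma test_functions_mult_left:
  assumes "u \<in> test_functions \<Omega>" "c \<noteq> 0"
  shows "(\<lambda>x. c * u x) \<in> test_functions \<Omega>"
  using assms times_differentiable_mult[OF times_differentiable_const]
  by (auto simp: test_functions_def smooth_def)

text \<open>Both integrals are homogeneous of degree \<open>p\<close>, so the normalization can be achieved by scaling.\<close>

lemma hardy_const_le_quotient:
  fixes u :: "real ^ 'n \<Rightarrow> real"
  assumes u: "u \<in> test_functions \<Omega>" and p: "0 < p" and J: "hardy_weighted_integral s p \<Omega> u = ennreal j" "0 < j"
    and [measurable]: "\<Omega> \<in> sets borel"
  shows "hardy_const s p \<Omega> \<le> ennreal (1 / j) * gagliardo_pow s p u"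
proof -
  note [measurable] = test_functionsD(2)[OF u]
  define c where "c = j powr - (1 / p)"
  have "c powr p = j powr - 1" unfolding c_def powr_powr using p by simp
  then have c: "0 < c" "c powr p = 1 / j" using J by (auto simp: c_def powr_minus_divide)
  have scale: "ennreal (\<bar>c * a\<bar> powr p) = ennreal (1 / j) * ennreal (\<bar>a\<bar> powr p)" for a
    using c J by (simp add: abs_mult powr_mult ennreal_mult''[symmetric])
  have "hardy_weighted_integral s p \<Omega> (\<lambda>x. c * u x) = ennreal (1 / j) * hardy_weighted_integral s p \<Omega> u"
    unfolding hardy_weighted_integral_eq scale mult.assoc by (rule nn_integral_cmult) measurable
  also have "\<dots> = 1" using J by (simp add: ennreal_mult''[symmetric])
  finally have "hardy_const s p \<Omega> \<le> gagliardo_pow s p (\<lambda>x. c * u x)"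
    unfolding hardy_const_def using test_functions_mult_left[OF u, of c] c by (intro INF_lower) auto
  also have "\<dots> = ennreal (1 / j) * gagliardo_pow s p u"
    unfolding gagliardo_pow_eq right_diff_distrib[symmetric] scale mult.assoc
    by (simp add: nn_integral_cmult)
  finally show ?thesis .
qed

text \<open>On the compact support of \<open>u\<close> the distance to the boundary is bounded away from \<open>0\<close>.\<close>

lemma hardy_weighted_integral_finite:
  fixes u :: "real ^ 'n \<Rightarrow> real"
  assumes u: "u \<in> test_functions \<Omega>" and \<Omega>: "open \<Omega>" "\<Omega> \<noteq> UNIV" and p: "0 < p" and s: "0 < s"
    and le1: "\<And>x. \<bar>u x\<bar> \<le> 1"
  shows "hardy_weighted_integral s p \<Omega> u < \<infinity>"
proof -
  define C where "C = closure {x. u x \<noteq> 0}"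
  have C: "compact C" "C \<subseteq> \<Omega>" using u by (auto simp: C_def test_functions_def)
  obtain m where m: "0 < m" "\<And>x. x \<in> C \<Longrightarrow> m \<le> boundary_dist \<Omega> x"
  proof (cases "C = {}")
    case True
    then show ?thesis using that[of 1] by simp
  next
    case False
    then obtain x where "x \<in> C" "\<And>y. y \<in> C \<Longrightarrow> boundary_dist \<Omega> x \<le> boundary_dist \<Omega> y"
      using continuous_attains_inf[OF C(1), of "boundary_dist \<Omega>"] continuous_on_infdist[OF continuous_on_id]
      by blast
    then show ?thesis using that[of "boundary_dist \<Omega> x"] boundary_dist_pos[OF \<Omega>] C by blast
  qed
  have "hardy_weighted_integral s p \<Omega> u \<le> (\<integral>\<^sup>+x. ennreal (m powr - (s * p)) * indicator C x \<partial>lborel)"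
    unfolding hardy_weighted_integral_eq
  proof (rule nn_integral_mono)
    fix x
    show "ennreal (\<bar>u x\<bar> powr p) * (ennreal (boundary_dist \<Omega> x powr - (s * p)) * indicator \<Omega> x)
        \<le> ennreal (m powr - (s * p)) * indicator C x"
    proof (cases "x \<in> C")
      case True
      have "\<bar>u x\<bar> powr p \<le> 1 powr p" using p le1 by (intro powr_mono2) auto
      moreover have "boundary_dist \<Omega> x powr - (s * p) \<le> m powr - (s * p)"
        using m True p s by (intro powr_mono2') auto
      ultimately have "\<bar>u x\<bar> powr p * boundary_dist \<Omega> x powr - (s * p) \<le> 1 * m powr - (s * p)"
        by (intro mult_mono) auto
      then show ?thesis using True C by (auto simp: ennreal_mult''[symmetric] intro: ennreal_leI)
    next
      case False
      then have "u x = 0" using closure_subset[of "{x. u x \<noteq> 0}"] by (auto simp: C_def)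
      then show ?thesis by simp
    qed
  qed
  also have "\<dots> = ennreal (m powr - (s * p)) * emeasure lborel C"
    by (subst nn_integral_cmult) (simp_all add: borel_closed compact_imp_closed C(1) borel_measurable_indicator)
  also have "\<dots> < \<infinity>"
    using emeasure_lborel_cbox_finite emeasure_compact_finite[OF C(1)] by (simp add: ennreal_mult_less_top)
  finally show ?thesis .
qed

text \<open>If the sublevel sets of \<open>w\<close> grow at rate \<open>m\<close>, then the layer-cake formula shows that the integral of \<open>w powr - \<sigma>\<close>
  is at least about \<open>m / (1 - \<sigma>)\<close>. The defect \<open>M * \<delta>\<close> of the growth condition stands on the other side, since
  \<open>m * t - M * \<delta>\<close> may be negative.\<close>

lemma nn_integral_powr_ge_of_linear_growth:
  fixes w :: "'a::euclidean_space \<Rightarrow> real"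
  assumes [measurable]: "w \<in> borel_measurable borel" "A \<in> sets borel"
    and pos: "\<And>x. x \<in> A \<Longrightarrow> 0 < w x"
    and \<sigma>: "0 < \<sigma>" "\<sigma> < 1" and \<delta>: "0 < \<delta>" "\<delta> \<le> T" and m: "0 \<le> m" "0 \<le> M"
    and growth: "\<And>t. \<delta> \<le> t \<Longrightarrow> t \<le> T \<Longrightarrow> ennreal (m * t) \<le> emeasure lborel {x \<in> A. w x \<le> t} + ennreal (M * \<delta>)"
  shows "ennreal (m * \<sigma> * (T powr (1 - \<sigma>) - \<delta> powr (1 - \<sigma>)) / (1 - \<sigma>))
    \<le> (\<integral>\<^sup>+x\<in>A. ennreal (w x powr - \<sigma>) \<partial>lborel) + ennreal (M * \<delta> powr (1 - \<sigma>))"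
proof -
  let ?k = "\<lambda>t. ennreal (\<sigma> * t powr (- \<sigma> - 1))"
  have "ennreal (m * \<sigma> * (T powr (1 - \<sigma>) - \<delta> powr (1 - \<sigma>)) / (1 - \<sigma>))
      = (\<integral>\<^sup>+t. ennreal (m * \<sigma> * t powr - \<sigma>) * indicator {\<delta>..T} t \<partial>lborel)"
  proof -
    have "((\<lambda>t. m * \<sigma> / (1 - \<sigma>) * t powr (1 - \<sigma>)) has_real_derivative m * \<sigma> * x powr - \<sigma>) (at x)"
      if "x \<in> {\<delta>..T}" for x
      using that \<delta> \<sigma> by (auto intro!: derivative_eq_intros simp: divide_simps)
    then have "(\<integral>\<^sup>+t. ennreal (m * \<sigma> * t powr - \<sigma>) * indicator {\<delta>..T} t \<partial>lborel)
        = ennreal (m * \<sigma> / (1 - \<sigma>) * T powr (1 - \<sigma>) - m * \<sigma> / (1 - \<sigma>) * \<delta> powr (1 - \<sigma>))"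
      using \<delta> \<sigma> m by (intro nn_integral_FTC_Icc) auto
    then show ?thesis by (simp add: right_diff_distrib diff_divide_distrib)
  qed
  also have "\<dots> \<le> (\<integral>\<^sup>+t. ?k t * emeasure lborel {x \<in> A. w x \<le> t} * indicator {0<..} t
      + ennreal (M * \<delta>) * (?k t * indicator {\<delta>..} t) \<partial>lborel)"
  proof (rule nn_integral_mono)
    fix t
    show "ennreal (m * \<sigma> * t powr - \<sigma>) * indicator {\<delta>..T} t
        \<le> ?k t * emeasure lborel {x \<in> A. w x \<le> t} * indicator {0<..} t + ennreal (M * \<delta>) * (?k t * indicator {\<delta>..} t)"
    proof (cases "t \<in> {\<delta>..T}")
      case True
      then have t: "0 < t" using \<delta> by auto
      have "t powr - \<sigma> = t powr (- \<sigma> - 1) * t"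
        using t by (simp add: powr_diff)
      then have "ennreal (m * \<sigma> * t powr - \<sigma>) = ?k t * ennreal (m * t)"
        using t m \<sigma> by (simp add: ennreal_mult''[symmetric] mult_ac)
      also have "\<dots> \<le> ?k t * (emeasure lborel {x \<in> A. w x \<le> t} + ennreal (M * \<delta>))"
        using True by (intro mult_left_mono growth) auto
      finally show ?thesis using True t by (simp add: distrib_left mult_ac)
    qed simp
  qed
  also have "\<dots> = (\<integral>\<^sup>+t\<in>{0<..}. ?k t * emeasure lborel {x \<in> A. w x \<le> t} \<partial>lborel)
      + ennreal (M * \<delta>) * (\<integral>\<^sup>+t\<in>{\<delta>..}. ?k t \<partial>lborel)"
  proof -
    have "(\<lambda>t. emeasure lborel {x \<in> A. w x \<le> t}) \<in> borel_measurable borel"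
    proof -
      have "(\<lambda>t. \<integral>\<^sup>+x. indicator {(t, x). x \<in> A \<and> w x \<le> t} (t, x) \<partial>lborel) \<in> borel_measurable borel"
        by measurable
      also have "(\<lambda>t. \<integral>\<^sup>+x. indicator {(t, x). x \<in> A \<and> w x \<le> t} (t, x) \<partial>lborel)
          = (\<lambda>t. emeasure lborel {x \<in> A. w x \<le> t})"
      proof
        fix t
        have "(\<lambda>x. indicator {(t, x). x \<in> A \<and> w x \<le> t} (t, x)) = (indicator {x \<in> A. w x \<le> t} :: 'a \<Rightarrow> ennreal)"
          by (auto simp: fun_eq_iff indicator_def)
        then show "(\<integral>\<^sup>+x. indicator {(t, x). x \<in> A \<and> w x \<le> t} (t, x) \<partial>lborel) = emeasure lborel {x \<in> A. w x \<le> t}"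
          by simp
      qed
      finally show ?thesis .
    qed
    then show ?thesis by (subst nn_integral_add) (auto simp: nn_integral_cmult)
  qed
  also have "(\<integral>\<^sup>+t\<in>{0<..}. ?k t * emeasure lborel {x \<in> A. w x \<le> t} \<partial>lborel)
      = (\<integral>\<^sup>+x\<in>A. ennreal (w x powr - \<sigma>) \<partial>lborel)"
    by (rule nn_integral_powr_layer_cake[symmetric]) (use pos \<sigma> in auto)
  also have "ennreal (M * \<delta>) * (\<integral>\<^sup>+t\<in>{\<delta>..}. ?k t \<partial>lborel) = ennreal (M * \<delta> powr (1 - \<sigma>))"
    unfolding nn_integral_powr_tail[OF \<sigma>(1) \<delta>(1)]
    using \<delta> m by (simp add: ennreal_mult''[symmetric] powr_diff powr_minus divide_simps)
  finally show ?thesis .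
qed

section \<open>Upper bounds for the Hardy constant\<close>

text \<open>The dimension is passed as a type, since the exponent alone does not determine it.\<close>

definition riesz_tail :: "'n::finite itself \<Rightarrow> real \<Rightarrow> ennreal" where
  "riesz_tail _ \<sigma> = (\<integral>\<^sup>+z\<in>{z :: real ^ 'n. 1 \<le> norm z}. ennreal (riesz_kernel \<sigma> z) \<partial>lborel)"

lemma riesz_tail_antimono:
  assumes "\<sigma> \<le> \<tau>"
  shows "riesz_tail TYPE('n::finite) \<tau> \<le> riesz_tail TYPE('n) \<sigma>"
  unfolding riesz_tail_def
proof (rule nn_integral_mono)
  fix z :: "real ^ 'n"
  show "ennreal (riesz_kernel \<tau> z) * indicator {z. 1 \<le> norm z} z
      \<le> ennreal (riesz_kernel \<sigma> z) * indicator {z. 1 \<le> norm z} z"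
    using assms by (auto simp: indicator_def riesz_kernel_def intro!: ennreal_leI powr_mono)
qed

text \<open>The two rates that compete in the quotient for a cut-off at depth \<open>\<delta>\<close>: \<open>M\<close> bounds, per unit of depth, the volume of the
  layer on which the cut-off varies, and \<open>m\<close> bounds from below the growth, on the set where the cut-off is \<open>1\<close>, of the sublevel sets of
  the distance to the boundary of the larger set \<open>D\<close>.\<close>

definition deep_layers :: "(real ^ 'n) set \<Rightarrow> (real ^ 'n) set \<Rightarrow> real \<Rightarrow> real \<Rightarrow> real \<Rightarrow> real \<Rightarrow> bool" where
  "deep_layers K D m M T \<delta> \<longleftrightarrow>
     measure lborel {x \<in> K. infdist x (- K) < \<delta>} \<le> M * \<delta> \<and>
     (\<forall>t. \<delta> \<le> t \<longrightarrow> t \<le> T \<longrightarrow>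
        m * t - M * \<delta> \<le> measure lborel {x \<in> K. \<delta> \<le> infdist x (- K) \<and> boundary_dist D x \<le> t})"

text \<open>The cut-off at depth \<open>\<delta>\<close> is the competitor. Its gradient is at most \<open>\<theta> / \<delta>\<close> on a set of measure at most
  \<open>M * \<delta>\<close>, which bounds the numerator; the denominator \<open>den\<close> comes from the set where the cut-off is \<open>1\<close>.\<close>

lemma hardy_const_le_of_deep_layers:
  fixes K D :: "(real ^ 'n) set" and e :: "real ^ 'n"
  assumes K: "open K" "bounded K" "K \<subseteq> D" and D: "open D" "D \<noteq> UNIV" and e: "norm e = 1"
    and p: "1 \<le> p" and s: "0 < s" "s * p < 1"
    and \<delta>: "0 < \<delta>" "\<delta> \<le> T" and m: "0 \<le> m" "0 \<le> M" and \<theta>: "1 < \<theta>"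
    and layers: "deep_layers K D m M T \<delta>"
    and mass: "half_space_mass e s = ennreal k" "0 \<le> k"
    and tail: "riesz_tail TYPE('n) s = ennreal \<tau>" "0 \<le> \<tau>"
    and den: "den = m * (s * p) * (T powr (1 - s * p) - \<delta> powr (1 - s * p)) / (1 - s * p) - M * \<delta> powr (1 - s * p)" "0 < den"
  shows "hardy_const s p D \<le> ennreal ((2 * \<theta> * M * k / (1 - s * p) + 2 * measure lborel K * \<tau>) / den)"
proof -
  define \<sigma> where "\<sigma> = s * p"
  have \<sigma>: "0 < \<sigma>" "\<sigma> < 1" "s \<le> \<sigma>" using p s by (auto simp: \<sigma>_def)
  obtain \<phi> where \<phi>: "\<phi> \<in> test_functions K" "\<And>x. 0 \<le> \<phi> x" "\<And>x. \<phi> x \<le> 1"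
    "\<And>x. \<delta> \<le> infdist x (- K) \<Longrightarrow> \<phi> x = 1"
    "\<And>x y. \<bar>\<phi> x - \<phi> y\<bar> \<le> \<theta> / \<delta> * norm (x - y)"
    using exists_test_function_cutoff[OF K(1,2) \<delta>(1) \<theta>] by metis
  interpret C: cutoff K \<phi> "\<theta> / \<delta>" \<delta>
    by unfold_locales (use K \<phi> in auto)
  have [measurable]: "K \<in> sets borel" "D \<in> sets borel" using K D by auto
  have testD: "\<phi> \<in> test_functions D"
    using \<phi>(1) K(3) by (auto simp: test_functions_def)
  have fin_subset: "emeasure lborel A = ennreal (measure lborel A)" if "A \<subseteq> K" "A \<in> sets borel" for A
  proof -
    have "emeasure lborel A \<le> emeasure lborel K" using that by (intro emeasure_mono) auto
    also have "\<dots> < \<infinity>" using K(2) by (rule emeasure_bounded_finite)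
    finally show ?thesis by (simp add: emeasure_eq_ennreal_measure less_top)
  qed
  let ?A = "{x \<in> K. \<delta> \<le> infdist x (- K)}"
  have [measurable]: "(\<lambda>x. infdist x (- K)) \<in> borel_measurable borel"
    by (intro borel_measurable_continuous_onI continuous_intros)
  have A: "?A \<in> sets borel" by measurable
  have "hardy_weighted_integral s p D \<phi> < \<infinity>"
    by (rule hardy_weighted_integral_finite[OF testD D]) (use p s \<phi> in auto)
  then obtain j where j: "hardy_weighted_integral s p D \<phi> = ennreal j" "0 \<le> j"
    by (metis ennreal_cases infinity_ennreal_def less_irrefl)
  have "ennreal (m * \<sigma> * (T powr (1 - \<sigma>) - \<delta> powr (1 - \<sigma>)) / (1 - \<sigma>))
      \<le> (\<integral>\<^sup>+x\<in>?A. ennreal (boundary_dist D x powr - \<sigma>) \<partial>lborel) + ennreal (M * \<delta> powr (1 - \<sigma>))"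
  proof (rule nn_integral_powr_ge_of_linear_growth[OF _ A _ \<sigma>(1,2) \<delta> m])
    show "0 < boundary_dist D x" if "x \<in> ?A" for x
      using that K(3) by (intro boundary_dist_pos[OF D]) auto
    fix t assume t: "\<delta> \<le> t" "t \<le> T"
    then have "m * t \<le> measure lborel {x \<in> K. \<delta> \<le> infdist x (- K) \<and> boundary_dist D x \<le> t} + M * \<delta>"
      using layers by (fastforce simp: deep_layers_def)
    then have "ennreal (m * t) \<le> ennreal (measure lborel {x \<in> ?A. boundary_dist D x \<le> t} + M * \<delta>)"
      by (intro ennreal_leI) (simp add: conj_assoc)
    also have "\<dots> = emeasure lborel {x \<in> ?A. boundary_dist D x \<le> t} + ennreal (M * \<delta>)"
      using m \<delta> by (subst fin_subset) auto
    finally show "ennreal (m * t) \<le> emeasure lborel {x \<in> ?A. boundary_dist D x \<le> t} + ennreal (M * \<delta>)" .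
  qed measurable
  also have "(\<integral>\<^sup>+x\<in>?A. ennreal (boundary_dist D x powr - \<sigma>) \<partial>lborel) \<le> ennreal j"
    unfolding j(1)[symmetric] hardy_weighted_integral_eq \<sigma>_def
    using \<phi>(4) K(3) by (intro nn_integral_mono) (auto simp: indicator_def)
  finally have "ennreal (m * \<sigma> * (T powr (1 - \<sigma>) - \<delta> powr (1 - \<sigma>)) / (1 - \<sigma>)) \<le> ennreal (j + M * \<delta> powr (1 - \<sigma>))"
    using j m by (simp add: add_right_mono)
  then have den_le: "den \<le> j"
    using j m by (subst (asm) ennreal_le_iff) (auto simp: den(1) \<sigma>_def)
  have "gagliardo_pow s p \<phi>
      \<le> ennreal (2 * (\<theta> / \<delta>) / (1 - s * p)) * half_space_mass e (s * p) * emeasure lborel {x \<in> K. infdist x (- K) < \<delta>}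
        + 2 * emeasure lborel K * riesz_tail TYPE('n) (s * p)"
    unfolding riesz_tail_def by (rule C.gagliardo_pow_le) fact+
  also have "\<dots> \<le> ennreal (2 * (\<theta> / \<delta>) / (1 - s * p)) * ennreal k * ennreal (M * \<delta>)
        + 2 * ennreal (measure lborel K) * ennreal \<tau>"
  proof (intro add_mono mult_mono)
    show "half_space_mass e (s * p) \<le> ennreal k"
      using half_space_mass_antimono[OF e \<sigma>(3)] mass by (simp add: \<sigma>_def)
    show "riesz_tail TYPE('n) (s * p) \<le> ennreal \<tau>"
      using riesz_tail_antimono[OF \<sigma>(3), where 'n = 'n] tail by (simp add: \<sigma>_def)
    show "emeasure lborel {x \<in> K. infdist x (- K) < \<delta>} \<le> ennreal (M * \<delta>)"
      using layers by (subst fin_subset) (auto simp: deep_layers_def intro!: ennreal_leI)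
    show "emeasure lborel K \<le> ennreal (measure lborel K)"
      by (subst fin_subset) auto
  qed auto
  also have "\<dots> = ennreal (2 * \<theta> * M * k / (1 - s * p) + 2 * measure lborel K * \<tau>)"
  proof -
    have "2 * (\<theta> / \<delta>) / (1 - s * p) * k * (M * \<delta>) = 2 * \<theta> * M * k / (1 - s * p)"
      using \<delta> s by (simp add: divide_simps)
    moreover have "0 \<le> 2 * \<theta> * M * k / (1 - s * p)"
      using \<theta> m mass s by auto
    ultimately show ?thesis
      using \<theta> m mass s tail \<delta>
      by (simp add: ennreal_plus ennreal_mult''[symmetric] ennreal_numeral[symmetric] del: ennreal_numeral)
  qed
  finally have gag: "gagliardo_pow s p \<phi> \<le> ennreal (2 * \<theta> * M * k / (1 - s * p) + 2 * measure lborel K * \<tau>)" .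
  have "hardy_const s p D \<le> ennreal (1 / j) * gagliardo_pow s p \<phi>"
    by (rule hardy_const_le_quotient[OF testD _ j(1)]) (use p den_le den in auto)
  also have "\<dots> \<le> ennreal (1 / den) * ennreal (2 * \<theta> * M * k / (1 - s * p) + 2 * measure lborel K * \<tau>)"
    using gag den_le den by (intro mult_mono ennreal_leI divide_left_mono) auto
  also have "\<dots> = ennreal ((2 * \<theta> * M * k / (1 - s * p) + 2 * measure lborel K * \<tau>) / den)"
    using den by (simp add: ennreal_mult'[symmetric])
  finally show ?thesis .
qed

text \<open>For given \<open>s\<close> the depth \<open>\<delta>\<close> is taken so small that \<open>\<delta>\<^sup>1\<^sup>-\<^sup>s \<le> 1 - s\<close>; letting \<open>p\<close> and then \<open>s\<close>
  tend to \<open>1\<close> leaves the ratio of the two rates \<open>M\<close> and \<open>m\<close>.\<close>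

proposition eventually_hardy_const_le:
  fixes K D :: "(real ^ 'n) set" and e :: "real ^ 'n"
  assumes K: "open K" "bounded K" "K \<subseteq> D" and D: "open D" "D \<noteq> UNIV" and e: "norm e = 1"
    and m: "0 < m" "0 \<le> M" and T: "0 < T" and c: "M / m < c"
    and layers: "\<And>\<epsilon>. 0 < \<epsilon> \<Longrightarrow> \<exists>\<delta>. 0 < \<delta> \<and> \<delta> < \<epsilon> \<and> deep_layers K D m M T \<delta>"
  shows "\<forall>\<^sub>F s in at_left 1. \<forall>\<^sub>F p in at_right 1. hardy_const s p D \<le> ennreal (2 * c) * half_space_mass e s"
proof -
  define V where "V = measure lborel K"
  define \<kappa> where "\<kappa> s = enn2real (half_space_mass e s)" for s
  define \<tau> where "\<tau> s = enn2real (riesz_tail TYPE('n) s)" for s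
  have \<kappa>: "half_space_mass e s = ennreal (\<kappa> s)" if "0 < s" for s
    using half_space_mass_finite[OF that e] by (simp add: \<kappa>_def ennreal_enn2real_if less_top)
  have \<tau>: "riesz_tail TYPE('n) s = ennreal (\<tau> s)" if "0 < s" for s
    using riesz_kernel_tail_finite[OF that, where 'n = 'n] by (simp add: \<tau>_def riesz_tail_def ennreal_enn2real_if less_top)
  have \<kappa>1: "0 < \<kappa> 1" using half_space_mass_pos[OF e, of 1] \<kappa>[of 1] by (simp add: ennreal_less_zero_iff)
  have nonneg: "0 \<le> \<kappa> s" "0 \<le> \<tau> s" "0 \<le> V" for s by (simp_all add: \<kappa>_def \<tau>_def V_def)
  \<comment> \<open>exceeds 1 by so little that \<open>\<theta> * M / m\<close> is still below \<open>c\<close>\<close>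
  define \<theta> where "\<theta> = 1 + (c * m - M) / (2 * (M + 1))"
  have cm: "M < c * m" using c m by (simp add: field_simps)
  then have \<theta>: "1 < \<theta>" using m by (simp add: \<theta>_def)
  have "M * (c * m - M) / (2 * (M + 1)) < c * m - M"
    using cm m by (simp add: divide_simps)
  moreover have "\<theta> * M = M + M * (c * m - M) / (2 * (M + 1))"
    unfolding \<theta>_def by (simp add: distrib_left mult.commute[of _ M])
  ultimately have "\<theta> * M < c * m" by linarith
  then have \<theta>c: "2 * \<theta> * M / m < 2 * c"
    using m by (simp add: pos_divide_less_eq mult.assoc)
  \<comment> \<open>bounds for numerator and denominator times \<open>1 - s\<close>, the numerator divided by the half-space mass; for \<open>1 / 2 < s < 1\<close> neither depends on \<open>\<delta>\<close>\<close>
  define f where "f s = (2 * \<theta> * M + 2 * V * \<tau> (1 / 2) * (1 - s) / \<kappa> 1)" for s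
  define g where "g s = m * s * (T powr (1 - s) - (1 - s)) - M * (1 - s)\<^sup>2" for s
  have lim_g: "(g \<longlongrightarrow> m) (at_left 1)"
    unfolding g_def by (rule tendsto_eq_intros refl | use T in simp)+
  have lim_f: "(f \<longlongrightarrow> 2 * \<theta> * M) (at_left 1)"
    unfolding f_def by (rule tendsto_eq_intros refl | use \<kappa>1 in simp)+
  have "((\<lambda>s. f s / g s) \<longlongrightarrow> 2 * \<theta> * M / m) (at_left 1)"
    using lim_f lim_g m by (intro tendsto_divide) auto
  then have ev: "\<forall>\<^sub>F s in at_left 1. f s / g s < 2 * c \<and> 0 < g s \<and> 1 / 2 < s \<and> s < 1"
    using order_tendstoD(2)[OF _ \<theta>c] order_tendstoD(1)[OF lim_g m(1)]
      eventually_at_left_real[of "1 / 2" "1 :: real"]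
    by (auto simp: eventually_conj_iff)
  then show ?thesis
  proof eventually_elim
    case (elim s)
    then have s: "0 < s" "1 / 2 < s" "s < 1" by auto
    define \<epsilon> where "\<epsilon> = min T ((1 - s) powr (1 / (1 - s)))"
    have "0 < \<epsilon>" using T s by (simp add: \<epsilon>_def)
    then obtain \<delta> where \<delta>: "0 < \<delta>" "\<delta> < \<epsilon>" "deep_layers K D m M T \<delta>" using layers by blast
    define q where "q = \<delta> powr (1 - s)"
    have "q \<le> ((1 - s) powr (1 / (1 - s))) powr (1 - s)"
      unfolding q_def using \<delta> s by (intro powr_mono2) (auto simp: \<epsilon>_def)
    then have q: "0 < q" "q \<le> 1 - s" using s \<delta> by (auto simp: powr_powr q_def)
    define num where "num \<sigma> = 2 * \<theta> * M * \<kappa> s / (1 - \<sigma>) + 2 * V * \<tau> s" for \<sigma>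
    define den where "den \<sigma> = m * \<sigma> * (T powr (1 - \<sigma>) - \<delta> powr (1 - \<sigma>)) / (1 - \<sigma>) - M * \<delta> powr (1 - \<sigma>)" for \<sigma>
    have den_s: "g s \<le> (1 - s) * den s"
    proof -
      have "m * s * q \<le> m * s * (1 - s)" using q m s by (intro mult_left_mono) auto
      moreover have "M * (1 - s) * q \<le> M * (1 - s) * (1 - s)" using q m s by (intro mult_left_mono) auto
      moreover have "(1 - s) * den s = m * s * (T powr (1 - s) - q) - M * (1 - s) * q"
      proof -
        have "(1 - s) * (A / (1 - s) - B) = A - (1 - s) * B" for A B
          using s by (simp add: right_diff_distrib)
        then show ?thesis by (simp add: den_def q_def mult_ac)
      qed
      moreover have "g s = m * s * (T powr (1 - s)) - m * s * (1 - s) - M * (1 - s) * (1 - s)"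
        by (simp add: g_def right_diff_distrib power2_eq_square)
      moreover have "m * s * (T powr (1 - s) - q) = m * s * T powr (1 - s) - m * s * q"
        by (rule right_diff_distrib)
      ultimately show ?thesis by linarith
    qed
    have num_s: "(1 - s) * num s \<le> \<kappa> s * f s"
    proof -
      have "\<tau> s \<le> \<tau> (1 / 2)"
        using riesz_tail_antimono[of "1 / 2" s, where 'n = 'n] s nonneg(2)
        by (simp add: \<tau> ennreal_le_iff)
      moreover have "\<kappa> 1 \<le> \<kappa> s"
        using half_space_mass_antimono[OF e, of s 1] s nonneg(1) by (simp add: \<kappa> ennreal_le_iff)
      ultimately have "\<tau> s * \<kappa> 1 \<le> \<tau> (1 / 2) * \<kappa> s" using nonneg by (intro mult_mono) auto
      then have "\<tau> s \<le> \<tau> (1 / 2) * \<kappa> s / \<kappa> 1" using \<kappa>1 by (simp add: field_simps)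
      then have "2 * V * (1 - s) * \<tau> s \<le> 2 * V * (1 - s) * (\<tau> (1 / 2) * \<kappa> s / \<kappa> 1)"
        using s nonneg(3) by (intro mult_left_mono) auto
      moreover have "(1 - s) * num s = 2 * \<theta> * M * \<kappa> s + 2 * V * (1 - s) * \<tau> s"
      proof -
        have "(1 - s) * (A / (1 - s) + B) = A + (1 - s) * B" for A B
          using s by (simp add: distrib_left)
        then show ?thesis by (simp add: num_def mult_ac)
      qed
      moreover have "\<kappa> s * f s = 2 * \<theta> * M * \<kappa> s + 2 * V * (1 - s) * (\<tau> (1 / 2) * \<kappa> s / \<kappa> 1)"
        using \<kappa>1 by (simp add: f_def field_simps)
      ultimately show ?thesis by linarith
    qed
    have den_pos: "0 < den s" using den_s elim s by (metis less_le_trans zero_less_mult_pos diff_gt_0_iff_gt)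
    have \<kappa>s: "0 < \<kappa> s" using half_space_mass_pos[OF e, of s] \<kappa>[of s] s by (simp add: ennreal_less_zero_iff)
    have "num s / den s < 2 * c * \<kappa> s"
    proof -
      have "num s / den s = ((1 - s) * num s) / ((1 - s) * den s)" using s by simp
      also have "\<dots> \<le> (\<kappa> s * f s) / g s"
        using num_s den_s elim nonneg \<theta> m s
        by (intro frac_le) (auto simp: f_def num_def intro!: add_nonneg_nonneg mult_nonneg_nonneg divide_nonneg_nonneg less_imp_le[OF \<kappa>1])
      also have "\<dots> = \<kappa> s * (f s / g s)" by simp
      also have "\<dots> < \<kappa> s * (2 * c)" using elim \<kappa>s by (intro mult_strict_left_mono) auto
      finally show ?thesis by (simp add: mult_ac)
    qed
    moreover have lim_p: "((\<lambda>p. s * p) \<longlongrightarrow> s) (at_right 1)"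
      by (rule tendsto_eq_intros refl | simp)+
    have lim_num: "((\<lambda>p. num (s * p)) \<longlongrightarrow> num s) (at_right 1)"
      unfolding num_def using s by (intro tendsto_intros lim_p) auto
    have lim_den: "((\<lambda>p. den (s * p)) \<longlongrightarrow> den s) (at_right 1)"
      unfolding den_def using s T \<delta> by (intro tendsto_intros lim_p) auto
    have "((\<lambda>p. num (s * p) / den (s * p)) \<longlongrightarrow> num s / den s) (at_right 1)"
      using den_pos by (intro tendsto_divide lim_num lim_den) auto
    ultimately have "\<forall>\<^sub>F p in at_right 1. num (s * p) / den (s * p) < 2 * c * \<kappa> s"
      by (intro order_tendstoD(2))
    moreover have "\<forall>\<^sub>F p in at_right 1. 0 < den (s * p)" by (rule order_tendstoD(1)[OF lim_den den_pos])
    moreover have "\<forall>\<^sub>F p in at_right 1. s * p < 1" by (rule order_tendstoD(2)[OF lim_p s(3)])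
    moreover have "\<forall>\<^sub>F p in at_right 1. (1 :: real) < p" by (rule eventually_at_right_less)
    ultimately show ?case
    proof eventually_elim
      case (elim p)
      have "hardy_const s p D \<le> ennreal (num (s * p) / den (s * p))"
        unfolding num_def V_def
        by (rule hardy_const_le_of_deep_layers[OF K D e _ s(1) _ \<delta>(1) _ _ _ \<theta> \<delta>(3) \<kappa>[OF s(1)] nonneg(1) \<tau>[OF s(1)] nonneg(2) den_def])
           (use elim \<delta> m in \<open>auto simp: \<epsilon>_def\<close>)
      also have "\<dots> \<le> ennreal (2 * c * \<kappa> s)" using elim by (intro ennreal_leI) auto
      also have "\<dots> = ennreal (2 * c) * half_space_mass e s"
        using nonneg(1) by (simp add: \<kappa>[OF s(1)] ennreal_mult'')
      finally show ?case .
    qed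
  qed
qed

section \<open>Boundary layers of convex sets\<close>

text \<open>The segment from \<open>x\<close> to a point of the complement meets the boundary on its way.\<close>

lemma boundary_dist_eq_infdist_compl:
  fixes \<Omega> :: "(real ^ 'n) set"
  assumes "open \<Omega>" "\<Omega> \<noteq> UNIV" "x \<in> \<Omega>"
  shows "boundary_dist \<Omega> x = infdist x (- \<Omega>)"
proof (rule antisym)
  have fr: "frontier \<Omega> \<noteq> {}" "frontier \<Omega> \<subseteq> - \<Omega>"
    using assms frontier_eq_empty[of \<Omega>] by (blast, simp add: frontier_def interior_open Diff_eq)
  then show "infdist x (- \<Omega>) \<le> boundary_dist \<Omega> x" by (intro infdist_mono)
  have "closed (- \<Omega>)" "- \<Omega> \<noteq> {}" using assms by auto
  then obtain y where y: "y \<in> - \<Omega>" "infdist x (- \<Omega>) = dist x y" by (rule infdist_attains_inf)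
  have "closed_segment x y \<inter> frontier \<Omega> \<noteq> {}"
    by (rule connected_Int_frontier) (use y assms in auto)
  then obtain z where z: "z \<in> closed_segment x y" "z \<in> frontier \<Omega>" by blast
  have "boundary_dist \<Omega> x \<le> dist x z" by (rule infdist_le) fact
  also have "\<dots> \<le> dist x y" using dist_in_closed_segment[OF z(1)] by (simp add: dist_commute)
  finally show "boundary_dist \<Omega> x \<le> infdist x (- \<Omega>)" using y by simp
qed

lemma infdist_compl_geI:
  assumes "ball x r \<subseteq> K" "K \<noteq> UNIV"
  shows "r \<le> infdist x (- K)"
proof -
  have ne: "- K \<noteq> {}" using assms by auto
  have "r \<le> dist x y" if "y \<in> - K" for y
    using that assms(1) by (metis ComplD mem_ball not_le subsetD)
  then show ?thesis using ne by (auto simp: infdist_def intro: cINF_greatest)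
qed

lemma emeasure_lborel_translate:
  fixes S :: "'a::euclidean_space set"
  assumes [measurable]: "S \<in> sets borel"
  shows "emeasure lborel {x. v + x \<in> S} = emeasure lborel S"
proof -
  have "(\<integral>\<^sup>+x. indicator S (v + x) \<partial>lborel) = emeasure lborel S"
    by (subst nn_integral_lborel_translate) auto
  moreover have "(\<lambda>x. indicator S (v + x)) = (indicator {x. v + x \<in> S} :: 'a \<Rightarrow> ennreal)"
    by (auto simp: fun_eq_iff indicator_def)
  ultimately show ?thesis by simp
qed

lemma emeasure_lborel_homothety:
  fixes S :: "'a::euclidean_space set"
  assumes S: "open S" and c: "0 < c"
  shows "emeasure lborel ((\<lambda>x. a + c *\<^sub>R x) ` S) = ennreal (c ^ DIM('a)) * emeasure lborel S"
proof -
  let ?h = "\<lambda>x. a + c *\<^sub>R x"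
  have [measurable]: "?h ` S \<in> sets borel" "S \<in> sets borel" using open_affinity[OF S, of c a] S c by auto
  have "indicator (?h ` S) (?h x) = (indicator S x :: ennreal)" for x
    using c by (auto simp: indicator_def)
  then show ?thesis
    using nn_integral_lborel_affine[of "indicator (?h ` S)" c a] c by simp
qed

text \<open>A point of \<open>S\<close> that moves in steps \<open>r *\<^sub>R e\<close> has left \<open>S\<close> after more than \<open>B / r\<close> steps. So the translates of the set
  of points that leave \<open>S\<close> with the next step cover \<open>S\<close>, and about \<open>B / r\<close> of them suffice.\<close>

lemma measure_exit_set_ge:
  fixes S :: "'a::euclidean_space set"
  assumes S: "open S" "bounded S" and diam: "\<And>x y. x \<in> S \<Longrightarrow> y \<in> S \<Longrightarrow> dist x y \<le> B"
    and e: "norm e = 1" and r: "0 < r" "r \<le> 1" and B: "0 \<le> B"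
  shows "r * measure lborel S \<le> (B + 2) * measure lborel {x \<in> S. x + r *\<^sub>R e \<notin> S}"
proof -
  define E where "E = {x \<in> S. x + r *\<^sub>R e \<notin> S}"
  have [measurable]: "S \<in> sets borel" using S by simp
  have E[measurable]: "E \<in> sets borel" unfolding E_def by measurable
  have fin: "emeasure lborel A = ennreal (measure lborel A)" if "A \<subseteq> S" "A \<in> sets borel" for A
  proof -
    have "emeasure lborel A \<le> emeasure lborel S" using that by (intro emeasure_mono) auto
    also have "\<dots> < \<infinity>" using S(2) by (rule emeasure_bounded_finite)
    finally show ?thesis by (simp add: emeasure_eq_ennreal_measure less_top)
  qed
  define n where "n = nat \<lceil>B / r\<rceil> + 1"
  have Bn: "B < real n * r"
  proof -
    have "B / r \<le> real (nat \<lceil>B / r\<rceil>)" using B r by (simp add: of_nat_ceiling)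
    then have "B / r < real n" by (simp add: n_def)
    then show ?thesis using r by (simp add: pos_divide_less_eq)
  qed
  have nB: "real n * r \<le> B + 2"
  proof -
    have "real n \<le> B / r + 2" unfolding n_def using B r by (simp add: of_nat_nat) linarith
    then have "real n * r \<le> (B / r + 2) * r" using r by (intro mult_right_mono) auto
    also have "\<dots> \<le> B + 2" using r by (simp add: distrib_right)
    finally show ?thesis .
  qed
  have cover: "S \<subseteq> (\<Union>j<n. {x. (real j * r) *\<^sub>R e + x \<in> E})"
  proof
    fix x assume x: "x \<in> S"
    define P where "P j \<longleftrightarrow> (real j * r) *\<^sub>R e + x \<notin> S" for j :: nat
    have "P n"
    proof (rule ccontr)
      assume "\<not> P n"
      then have "dist ((real n * r) *\<^sub>R e + x) x \<le> B" using x by (intro diam) (auto simp: P_def)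
      then show False using Bn e r by (simp add: dist_norm)
    qed
    moreover have "\<not> P 0" using x by (simp add: P_def)
    ultimately obtain j where j: "j < n" "\<not> P j" "P (Suc j)"
      using ex_least_nat_less[of P n] by auto
    have step: "(real (Suc j) * r) *\<^sub>R e + x = ((real j * r) *\<^sub>R e + x) + r *\<^sub>R e"
      by (simp add: algebra_simps)
    have "(real j * r) *\<^sub>R e + x \<in> E"
      using j(2,3) unfolding P_def step E_def by blast
    with j show "x \<in> (\<Union>j<n. {x. (real j * r) *\<^sub>R e + x \<in> E})" by blast
  qed
  have "emeasure lborel S \<le> emeasure lborel (\<Union>j<n. {x. (real j * r) *\<^sub>R e + x \<in> E})"
    by (intro emeasure_mono cover) measurable
  also have "\<dots> \<le> (\<Sum>j<n. emeasure lborel {x. (real j * r) *\<^sub>R e + x \<in> E})"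
    by (intro emeasure_subadditive_finite) auto
  also have "\<dots> = of_nat n * emeasure lborel E"
    by (simp add: emeasure_lborel_translate)
  also have "\<dots> = ennreal (real n * measure lborel E)"
    by (subst fin) (auto simp: E_def ennreal_mult'' ennreal_of_nat_eq_real_of_nat)
  finally have "measure lborel S \<le> real n * measure lborel E"
    by (subst (asm) fin) (auto simp: ennreal_le_iff)
  then have "r * measure lborel S \<le> r * (real n * measure lborel E)"
    using r by (intro mult_left_mono) auto
  also have "\<dots> = (real n * r) * measure lborel E" by simp
  also have "\<dots> \<le> (B + 2) * measure lborel E"
    using nB by (intro mult_right_mono) auto
  finally show ?thesis by (simp add: E_def)
qed

text \<open>The homothety with centre \<open>a\<close> and ratio \<open>1 - \<tau>\<close> maps a convex set to points of depth at least \<open>\<tau> * \<rho>\<close>, and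
  Bernoulli's inequality bounds the volume that it leaves out.\<close>

lemma measure_boundary_layer_le:
  fixes \<Omega> :: "(real ^ 'n) set"
  assumes \<Omega>: "open \<Omega>" "bounded \<Omega>" "convex \<Omega>" and ball: "ball a \<rho> \<subseteq> \<Omega>" and \<rho>: "0 < \<rho>" and \<tau>: "0 < \<tau>" "\<tau> < 1"
  shows "measure lborel {x \<in> \<Omega>. infdist x (- \<Omega>) < \<tau> * \<rho>} \<le> real CARD('n) * \<tau> * measure lborel \<Omega>"
proof -
  have ne: "\<Omega> \<noteq> UNIV" using \<Omega>(2) not_bounded_UNIV by blast
  let ?N = "CARD('n)"
  let ?h = "\<lambda>x. \<tau> *\<^sub>R a + (1 - \<tau>) *\<^sub>R x"
  have fin: "emeasure lborel \<Omega> = ennreal (measure lborel \<Omega>)"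
    using emeasure_bounded_finite[OF \<Omega>(2)] by (simp add: emeasure_eq_ennreal_measure less_top)
  have meas: "?h ` \<Omega> \<in> sets borel" "\<Omega> \<in> sets borel"
    using open_affinity[OF \<Omega>(1), of "1 - \<tau>" "\<tau> *\<^sub>R a"] \<Omega>(1) \<tau> by auto
  have layer: "{x \<in> \<Omega>. infdist x (- \<Omega>) < \<tau> * \<rho>} \<in> sets lborel"
    by (simp, intro borel_open open_Collect_conj open_Collect_less continuous_intros) (simp add: \<Omega>(1))
  have deep: "\<tau> * \<rho> \<le> infdist x (- \<Omega>)" "x \<in> \<Omega>" if "x \<in> ?h ` \<Omega>" for x
  proof -
    obtain w where w: "w \<in> \<Omega>" "x = ?h w" using \<open>x \<in> ?h ` \<Omega>\<close> by blast
    have inner: "y \<in> \<Omega>" if "dist x y < \<tau> * \<rho>" for y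
    proof -
      \<comment> \<open>the point of the ball for which \<open>y = \<tau> *\<^sub>R z + (1 - \<tau>) *\<^sub>R w\<close>\<close>
      define z where "z = a + (1 / \<tau>) *\<^sub>R (y - x)"
      have "dist a z < \<rho>"
        using that \<tau> by (simp add: z_def dist_norm norm_minus_commute pos_divide_less_eq mult.commute)
      then have "z \<in> \<Omega>" using ball by auto
      then have "\<tau> *\<^sub>R z + (1 - \<tau>) *\<^sub>R w \<in> \<Omega>" using w \<tau> \<Omega>(3) by (intro convexD) auto
      also have "\<tau> *\<^sub>R z + (1 - \<tau>) *\<^sub>R w = y"
        using \<tau> w(2) by (simp add: z_def scaleR_add_right)
      finally show ?thesis .
    qed
    then show "\<tau> * \<rho> \<le> infdist x (- \<Omega>)" by (intro infdist_compl_geI ne) auto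
    show "x \<in> \<Omega>" using inner[of x] \<tau> \<rho> by simp
  qed
  have "{x \<in> \<Omega>. infdist x (- \<Omega>) < \<tau> * \<rho>} \<subseteq> \<Omega> - ?h ` \<Omega>"
    using deep(1) by (intro subsetI DiffI) (blast, metis (mono_tags, lifting) mem_Collect_eq not_le)
  then have "measure lborel {x \<in> \<Omega>. infdist x (- \<Omega>) < \<tau> * \<rho>} \<le> measure lborel (\<Omega> - ?h ` \<Omega>)"
    using meas fin layer by (intro measure_mono_fmeasurable fmeasurable_Diff) (auto simp: fmeasurable_def)
  also have "\<dots> = measure lborel \<Omega> - measure lborel (?h ` \<Omega>)"
    using deep(2) meas fin by (intro measure_Diff) auto
  also have "measure lborel (?h ` \<Omega>) = (1 - \<tau>) ^ ?N * measure lborel \<Omega>"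
  proof (rule measure_eq_emeasure_eq_ennreal)
    show "emeasure lborel (?h ` \<Omega>) = ennreal ((1 - \<tau>) ^ ?N * measure lborel \<Omega>)"
      by (subst emeasure_lborel_homothety[OF \<Omega>(1)]) (use \<tau> in \<open>simp_all add: ennreal_mult'' fin\<close>)
  qed (use \<tau> in simp)
  also have "measure lborel \<Omega> - (1 - \<tau>) ^ ?N * measure lborel \<Omega> \<le> real ?N * \<tau> * measure lborel \<Omega>"
  proof -
    have "1 + real ?N * (- \<tau>) \<le> (1 + (- \<tau>)) ^ ?N" using \<tau> by (intro Bernoulli_inequality) auto
    then have "(1 - real ?N * \<tau>) * measure lborel \<Omega> \<le> (1 - \<tau>) ^ ?N * measure lborel \<Omega>"
      by (intro mult_right_mono) auto
    then show ?thesis by (simp add: left_diff_distrib)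
  qed
  finally show ?thesis .
qed

text \<open>The volume \<open>V t\<close> of the boundary layer of depth \<open>t\<close> is of exact order \<open>t\<close> as \<open>t\<close> tends to \<open>0\<close>. With \<open>m\<close> just below the supremum of the
  rates that bound \<open>V\<close> from below near \<open>0\<close>, the slightly larger rate \<open>M\<close> fails to do so; hence there
  are arbitrarily small depths at which \<open>M\<close> is an upper bound. For \<open>c\<close> close to \<open>1\<close> both rates are close to the lower
  Minkowski content of the boundary.\<close>

lemma exists_deep_layers_convex:
  fixes \<Omega> :: "(real ^ 'n) set"
  assumes \<Omega>: "\<Omega> \<noteq> {}" "open \<Omega>" "bounded \<Omega>" "convex \<Omega>" and c: "1 < c"
  obtains m M T where "0 < m" "0 \<le> M" "0 < T" "M / m < c"
    "\<And>\<epsilon>. 0 < \<epsilon> \<Longrightarrow> \<exists>\<delta>. 0 < \<delta> \<and> \<delta> < \<epsilon> \<and> deep_layers \<Omega> \<Omega> m M T \<delta>"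
proof -
  have ne: "\<Omega> \<noteq> UNIV" using \<Omega>(3) not_bounded_UNIV by blast
  define V where "V t = measure lborel {x \<in> \<Omega>. infdist x (- \<Omega>) < t}" for t
  define B where "B = diameter \<Omega>"
  have B: "0 \<le> B" unfolding B_def by (rule diameter_ge_0) fact
  have [measurable]: "\<Omega> \<in> sets borel" using \<Omega> by simp
  have [measurable]: "(\<lambda>x. infdist x (- \<Omega>)) \<in> borel_measurable borel"
    by (intro borel_measurable_continuous_onI continuous_intros)
  have fin: "{x \<in> \<Omega>. P x} \<in> fmeasurable lborel" if "Measurable.pred borel P" for P
  proof (rule fmeasurableI2)
    show "\<Omega> \<in> fmeasurable lborel"
      using emeasure_bounded_finite[OF \<Omega>(3)] by (simp add: fmeasurable_def)
    show "{x \<in> \<Omega>. P x} \<in> sets lborel" using that by measurable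
  qed auto
  obtain e :: "real ^ 'n" where e: "norm e = 1" using vector_choose_size[of 1] by auto
  obtain a \<rho> where \<rho>: "0 < \<rho>" "ball a \<rho> \<subseteq> \<Omega>"
    using \<Omega> by (metis ex_in_conv open_contains_ball)
  have vol: "0 < measure lborel \<Omega>"
  proof -
    have "measure lborel (ball a \<rho>) \<le> measure lborel {x \<in> \<Omega>. True}"
      using \<rho> by (intro measure_mono_fmeasurable fin) auto
    from less_le_trans[OF content_ball_pos[OF \<rho>(1)] this] show ?thesis by simp
  qed
  define m0 where "m0 = measure lborel \<Omega> / (2 * (B + 2))"
  have m0: "0 < m0" using vol B by (simp add: m0_def)
  have lower: "m0 * t \<le> V t" if "0 < t" "t \<le> 2" for t
  proof -
    define r where "r = t / 2"
    have "r * measure lborel \<Omega> \<le> (B + 2) * measure lborel {x \<in> \<Omega>. x + r *\<^sub>R e \<notin> \<Omega>}"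
      using that B e \<Omega> by (intro measure_exit_set_ge) (auto simp: r_def B_def intro: diameter_bounded_bound)
    also have "\<dots> \<le> (B + 2) * V t"
    proof (intro mult_left_mono)
      show "measure lborel {x \<in> \<Omega>. x + r *\<^sub>R e \<notin> \<Omega>} \<le> V t"
        unfolding V_def
      proof (intro measure_mono_fmeasurable fin)
        show "{x \<in> \<Omega>. x + r *\<^sub>R e \<notin> \<Omega>} \<subseteq> {x \<in> \<Omega>. infdist x (- \<Omega>) < t}"
        proof safe
          fix x assume "x + r *\<^sub>R e \<notin> \<Omega>"
          then have "infdist x (- \<Omega>) \<le> dist x (x + r *\<^sub>R e)" by (intro infdist_le) auto
          also have "\<dots> < t" using that e by (simp add: dist_norm r_def)
          finally show "infdist x (- \<Omega>) < t" .
        qed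
      qed (measurable; simp)+
    qed (use B in auto)
    finally have "r * measure lborel \<Omega> / (B + 2) \<le> V t"
      using B by (simp add: pos_divide_le_eq mult.commute)
    then show ?thesis using B by (simp add: m0_def r_def mult.commute)
  qed
  define S where "S = {m. \<exists>T > 0. \<forall>t. 0 < t \<and> t \<le> T \<longrightarrow> m * t \<le> V t}"
  have m0_S: "m0 \<in> S" unfolding S_def using lower by (intro CollectI exI[of _ 2]) auto
  have bdd: "bdd_above S"
  proof (rule bdd_aboveI)
    fix m assume "m \<in> S"
    then obtain T where T: "0 < T" "\<And>t. 0 < t \<Longrightarrow> t \<le> T \<Longrightarrow> m * t \<le> V t" by (auto simp: S_def)
    define \<tau> where "\<tau> = min (T / \<rho>) (1 / 2)"
    have \<tau>: "0 < \<tau>" "\<tau> < 1" "\<tau> * \<rho> \<le> T"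
      using T \<rho> by (auto simp: \<tau>_def min_def field_simps)
    have "m * (\<tau> * \<rho>) \<le> V (\<tau> * \<rho>)" using T \<tau> \<rho> by simp
    also have "\<dots> \<le> real CARD('n) * \<tau> * measure lborel \<Omega>"
      unfolding V_def by (rule measure_boundary_layer_le) fact+
    finally have "m * \<rho> * \<tau> \<le> real CARD('n) * measure lborel \<Omega> * \<tau>" by (simp add: mult_ac)
    then have "m * \<rho> \<le> real CARD('n) * measure lborel \<Omega>" using \<tau> by simp
    then show "m \<le> real CARD('n) * measure lborel \<Omega> / \<rho>" using \<rho> by (simp add: pos_le_divide_eq)
  qed
  define c' where "c' = (1 + c) / 2"
  have c': "1 < c'" "c' < c" using c by (auto simp: c'_def)
  have sup: "m0 \<le> Sup S" by (rule cSup_upper[OF m0_S bdd])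
  have "Sup S / c' < Sup S" using c' m0 sup by (simp add: divide_less_eq)
  then obtain m where m: "m \<in> S" "Sup S / c' < m" using less_cSupD[of S] m0_S by blast
  have "0 < Sup S / c'" using c' m0 sup by simp
  then have m_pos: "0 < m" using m by linarith
  obtain T where T: "0 < T" "\<And>t. 0 < t \<Longrightarrow> t \<le> T \<Longrightarrow> m * t \<le> V t" using m(1) by (auto simp: S_def)
  have "Sup S < c' * m" using m(2) c' by (simp add: divide_less_eq mult.commute)
  then have notS: "c' * m \<notin> S" using cSup_upper[OF _ bdd, of "c' * m"] by auto
  show thesis
  proof (rule that[of m "c' * m" T])
    show "c' * m / m < c" using m_pos c' by simp
    fix \<epsilon> :: real assume \<epsilon>: "0 < \<epsilon>"
    have "\<not> (\<forall>t. 0 < t \<and> t \<le> \<epsilon> / 2 \<longrightarrow> c' * m * t \<le> V t)"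
      using notS half_gt_zero[OF \<epsilon>] unfolding S_def by blast
    then obtain \<delta> where \<delta>: "0 < \<delta>" "\<delta> \<le> \<epsilon> / 2" "V \<delta> < c' * m * \<delta>" by (auto simp: not_le)
    have "deep_layers \<Omega> \<Omega> m (c' * m) T \<delta>"
      unfolding deep_layers_def V_def[symmetric]
    proof (intro conjI allI impI)
      show "V \<delta> \<le> c' * m * \<delta>" using \<delta> by simp
      fix t assume t: "\<delta> \<le> t" "t \<le> T"
      let ?A = "{x \<in> \<Omega>. \<delta> \<le> infdist x (- \<Omega>) \<and> boundary_dist \<Omega> x \<le> t}"
      have "V t \<le> measure lborel ({x \<in> \<Omega>. infdist x (- \<Omega>) < \<delta>} \<union> ?A)"
        unfolding V_def
        by (intro measure_mono_fmeasurable fmeasurable.Un fin)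
           (auto simp: boundary_dist_eq_infdist_compl[OF \<Omega>(2) ne] intro: fmeasurableD fin)
      also have "\<dots> \<le> V \<delta> + measure lborel ?A"
        unfolding V_def by (intro measure_Un_le fmeasurableD fin) measurable
      finally show "m * t - c' * m * \<delta> \<le> measure lborel ?A"
        using T(2)[of t] t \<delta> by linarith
    qed
    then show "\<exists>\<delta>. 0 < \<delta> \<and> \<delta> < \<epsilon> \<and> deep_layers \<Omega> \<Omega> m (c' * m) T \<delta>"
      using \<delta> \<epsilon> by (intro exI[of _ \<delta>]) auto
  qed (use m_pos c' T in auto)
qed

section \<open>A flat box in the half-space\<close>

definition box_corner :: "'n::finite \<Rightarrow> real \<Rightarrow> real \<Rightarrow> real ^ 'n" where
  "box_corner k l r = (\<chi> i. if i = k then r else l)"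

lemma measure_cbox_box_corner:
  fixes k :: "'n::finite"
  assumes "a \<le> a'" "b \<le> b'"
  shows "measure lborel (cbox (box_corner k a b) (box_corner k a' b')) = (a' - a) ^ (CARD('n) - 1) * (b' - b)"
proof -
  have "cbox (box_corner k a b) (box_corner k a' b') \<noteq> {}"
    using assms by (auto simp: interval_ne_empty_cart box_corner_def)
  then have "measure lborel (cbox (box_corner k a b) (box_corner k a' b')) = (\<Prod>i\<in>UNIV. box_corner k a' b' $ i - box_corner k a b $ i)"
    by (rule content_cbox_cart)
  also have "\<dots> = (b' - b) * (\<Prod>i\<in>UNIV - {k}. a' - a)"
    by (subst prod.remove[of _ k]) (auto simp: box_corner_def intro!: arg_cong2[of _ _ _ _ "(*)"] prod.cong)
  finally show ?thesis by simp
qed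

lemma infdist_compl_box_ge:
  fixes a b :: "real ^ 'n"
  assumes "\<And>i. a $ i + \<delta> \<le> x $ i" "\<And>i. x $ i + \<delta> \<le> b $ i"
  shows "\<delta> \<le> infdist x (- box a b)"
proof (rule infdist_compl_geI)
  show "ball x \<delta> \<subseteq> box a b"
  proof
    fix y assume "y \<in> ball x \<delta>"
    then have "norm (x - y) < \<delta>" by (simp add: dist_norm)
    then have "\<bar>x $ i - y $ i\<bar> < \<delta>" for i
      using component_le_norm_cart[of "x - y" i] by simp
    then have "a $ i < y $ i \<and> y $ i < b $ i" for i
      using assms[of i] by (smt (verit))
    then show "y \<in> box a b" by (simp add: mem_box_cart)
  qed
  show "box a b \<noteq> UNIV" using bounded_box not_bounded_UNIV by metis
qed

text \<open>The comparison domain is a flat box resting on the boundary hyperplane. Its top contributes as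
  much perimeter as its bottom, but only the bottom contributes to the weighted integral; the sides
  become negligible as the height \<open>h\<close> tends to \<open>0\<close>. Hence the factor \<open>2\<close>.\<close>

lemma exists_deep_layers_half_space:
  fixes k :: "'n::finite"
  assumes c: "2 < c"
  obtains K M T where "open K" "bounded K" "K \<subseteq> half_space k" "0 \<le> M" "0 < T" "M / 1 < c"
    "\<And>\<epsilon>. 0 < \<epsilon> \<Longrightarrow> \<exists>\<delta>. 0 < \<delta> \<and> \<delta> < \<epsilon> \<and> deep_layers K (half_space k) 1 M T \<delta>"
proof -
  define n where "n = CARD('n) - 1"
  \<comment> \<open>chosen so that M < c\<close>
  define h where "h = min 1 ((c - 2) / (4 * real n + 4))"
  define M where "M = 2 + 2 * real n * h"
  have h: "0 < h" "h \<le> 1" using c by (auto simp: h_def)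
  have M: "0 \<le> M" "M < c"
  proof -
    have "h \<le> (c - 2) / (4 * real n + 4)" by (simp add: h_def)
    then have "h * (4 * real n + 4) \<le> c - 2" by (simp add: pos_le_divide_eq)
    moreover have "h * (4 * real n + 4) = 4 * (h * real n) + 4 * h" by (simp add: algebra_simps)
    moreover have "0 \<le> h * real n" using h by simp
    moreover have "M = 2 + 2 * (h * real n)" by (simp add: M_def)
    ultimately show "M < c" using h by linarith
    show "0 \<le> M" using h by (simp add: M_def)
  qed
  define K where "K = box (0 :: real ^ 'n) (box_corner k 1 h)"
  have K_mem: "x \<in> K \<longleftrightarrow> (\<forall>i. 0 < x $ i \<and> x $ i < (if i = k then h else 1))" for x
    by (simp add: K_def mem_box_cart box_corner_def)
  have K_sub: "K \<subseteq> half_space k" by (auto simp: K_mem half_space_def)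
  have [measurable]: "K \<in> sets borel" "half_space k \<in> sets borel" by (simp_all add: K_def open_half_space)
  have [measurable]: "(\<lambda>x. infdist x (- K)) \<in> borel_measurable borel"
    by (intro borel_measurable_continuous_onI continuous_intros)
  have fin: "{x \<in> K. P x} \<in> fmeasurable lborel" if "Measurable.pred borel P" for P
  proof (rule fmeasurableI2)
    show "K \<in> fmeasurable lborel"
      using emeasure_bounded_finite[OF bounded_box, of 0 "box_corner k 1 h"] by (simp add: fmeasurable_def K_def)
    show "{x \<in> K. P x} \<in> sets lborel" using that by measurable
  qed auto
  have bern: "1 - 2 * real n * \<delta> \<le> (1 - \<delta> - \<delta>) ^ n" if "0 < \<delta>" "\<delta> < 1 / 2" for \<delta> :: real
    using Bernoulli_inequality[of "- (2 * \<delta>)" n] that by (simp add: mult_ac)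
  have layers: "deep_layers K (half_space k) 1 M (h / 2) \<delta>" if \<delta>: "0 < \<delta>" "\<delta> < 1 / 2" "\<delta> < h / 2" for \<delta>
    unfolding deep_layers_def
  proof (intro conjI allI impI)
    have deep: "x \<in> K \<and> \<delta> \<le> infdist x (- K)"
      if "x \<in> cbox (box_corner k \<delta> \<delta>) (box_corner k (1 - \<delta>) (h - \<delta>))" for x
    proof
      have bnd: "\<delta> \<le> x $ i" "x $ i + \<delta> \<le> (if i = k then h else 1)" for i
        using that by (auto simp: mem_box_cart box_corner_def dest!: spec[of _ i] split: if_splits)
      show "\<delta> \<le> infdist x (- K)"
        unfolding K_def using bnd by (intro infdist_compl_box_ge) (auto simp: box_corner_def)
      show "x \<in> K" unfolding K_mem using bnd \<delta> by (smt (verit))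
    qed
    let ?C = "cbox (box_corner k \<delta> \<delta>) (box_corner k (1 - \<delta>) (h - \<delta>))"
    have "measure lborel {x \<in> K. infdist x (- K) < \<delta>} \<le> measure lborel (K - ?C)"
    proof (intro measure_mono_fmeasurable)
      show "{x \<in> K. infdist x (- K) < \<delta>} \<subseteq> K - ?C" using deep by fastforce
      have "K \<in> fmeasurable lborel" using fin[of "\<lambda>_. True"] by simp
      then show "K - ?C \<in> fmeasurable lborel" by (rule fmeasurable_Diff) simp
    qed (use fin in \<open>auto intro: fmeasurableD\<close>)
    also have "\<dots> = measure lborel K - measure lborel ?C"
    proof (rule measure_Diff)
      show "emeasure lborel K \<noteq> \<infinity>"
        unfolding K_def using emeasure_bounded_finite[OF bounded_box, of 0 "box_corner k 1 h"] by simp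
    qed (use deep in auto)
    also have "measure lborel K = h"
    proof -
      have "measure lborel K = measure lborel (cbox (box_corner k 0 0) (box_corner k 1 h))"
        unfolding K_def measure_lborel_box_eq measure_lborel_cbox_eq
        by (simp add: box_corner_def zero_vec_def)
      then show ?thesis using h by (simp add: measure_cbox_box_corner)
    qed
    also have "measure lborel ?C = (1 - \<delta> - \<delta>) ^ n * (h - \<delta> - \<delta>)"
      using \<delta> h by (subst measure_cbox_box_corner) (auto simp: n_def)
    also have "h - (1 - \<delta> - \<delta>) ^ n * (h - \<delta> - \<delta>) \<le> M * \<delta>"
    proof -
      have "(1 - 2 * real n * \<delta>) * (h - \<delta> - \<delta>) \<le> (1 - \<delta> - \<delta>) ^ n * (h - \<delta> - \<delta>)"
        using bern \<delta> by (intro mult_right_mono) auto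
      moreover have "(1 - 2 * real n * \<delta>) * (h - \<delta> - \<delta>) = h - M * \<delta> + 4 * real n * \<delta> * \<delta>"
        by (simp add: M_def algebra_simps)
      moreover have "0 \<le> 4 * real n * \<delta> * \<delta>" using \<delta> by simp
      ultimately show ?thesis by linarith
    qed
    finally show "measure lborel {x \<in> K. infdist x (- K) < \<delta>} \<le> M * \<delta>" .
    fix t assume t: "\<delta> \<le> t" "t \<le> h / 2"
    let ?C = "cbox (box_corner k \<delta> \<delta>) (box_corner k (1 - \<delta>) t)"
    have "1 * t - M * \<delta> \<le> (1 - 2 * real n * \<delta>) * (t - \<delta>)"
    proof -
      have "2 * real n * \<delta> * (t - \<delta>) \<le> 2 * real n * \<delta> * h"
        using t \<delta> h by (intro mult_left_mono) auto
      then show ?thesis using \<delta> by (simp add: M_def algebra_simps)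
    qed
    also have "\<dots> \<le> (1 - \<delta> - \<delta>) ^ n * (t - \<delta>)"
      using bern \<delta> t by (intro mult_right_mono) auto
    also have "\<dots> = measure lborel ?C"
      using \<delta> t by (subst measure_cbox_box_corner) (auto simp: n_def)
    also have "\<dots> \<le> measure lborel {x \<in> K. \<delta> \<le> infdist x (- K) \<and> boundary_dist (half_space k) x \<le> t}"
    proof (intro measure_mono_fmeasurable fin)
      show "?C \<subseteq> {x \<in> K. \<delta> \<le> infdist x (- K) \<and> boundary_dist (half_space k) x \<le> t}"
      proof
        fix x assume x: "x \<in> ?C"
        have "x $ k \<le> t" using x by (auto simp: mem_box_cart box_corner_def dest!: spec[of _ k])
        have "box_corner k (1 - \<delta>) t $ i \<le> box_corner k (1 - \<delta>) (h - \<delta>) $ i" for i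
          using t \<delta> by (auto simp: box_corner_def)
        then have "x \<in> cbox (box_corner k \<delta> \<delta>) (box_corner k (1 - \<delta>) (h - \<delta>))"
          using x unfolding mem_box_cart by (meson order_trans)
        from deep[OF this] \<open>x $ k \<le> t\<close> K_sub
        show "x \<in> {x \<in> K. \<delta> \<le> infdist x (- K) \<and> boundary_dist (half_space k) x \<le> t}"
          by (auto simp: boundary_dist_half_space subsetD)
      qed
    qed auto
    finally show "1 * t - M * \<delta> \<le> measure lborel {x \<in> K. \<delta> \<le> infdist x (- K) \<and> boundary_dist (half_space k) x \<le> t}" .
  qed
  show thesis
  proof (rule that[of K M "h / 2"])
    fix \<epsilon> :: real assume \<epsilon>: "0 < \<epsilon>"
    define \<delta> where "\<delta> = min (\<epsilon> / 2) (min (1 / 4) (h / 4))"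
    show "\<exists>\<delta>. 0 < \<delta> \<and> \<delta> < \<epsilon> \<and> deep_layers K (half_space k) 1 M (h / 2) \<delta>"
      using \<epsilon> h by (intro exI[of _ \<delta>] conjI layers) (auto simp: \<delta>_def)
  qed (use M h K_sub in \<open>auto simp: K_def bounded_box\<close>)
qed


section \<open>The limit of the quotient\<close>

lemma eventually_half_space_mass_ge:
  fixes e :: "real ^ 'n"
  assumes e: "norm e = 1" and s: "0 < s" and c: "c < 1"
  shows "\<forall>\<^sub>F p in at_right 1. ennreal c * half_space_mass e s \<le> half_space_mass e (s * p)"
proof -
  define k where "k \<sigma> = enn2real (half_space_mass e \<sigma>)" for \<sigma>
  have k: "half_space_mass e \<sigma> = ennreal (k \<sigma>)" "0 < k \<sigma>" if "0 < \<sigma>" for \<sigma>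
    using half_space_mass_finite[OF that e] half_space_mass_pos[OF e, of \<sigma>]
    by (simp_all add: k_def ennreal_enn2real_if less_top enn2real_positive_iff)
  have "((\<lambda>p. (s * p - s) * (2 / s) * k (s / 2)) \<longlongrightarrow> (s * 1 - s) * (2 / s) * k (s / 2)) (at_right 1)"
    by (intro tendsto_intros)
  then have "((\<lambda>p. (s * p - s) * (2 / s) * k (s / 2)) \<longlongrightarrow> 0) (at_right 1)" by simp
  moreover have "0 < (1 - c) * k s" using c k(2)[OF s] by simp
  ultimately have "\<forall>\<^sub>F p in at_right 1. (s * p - s) * (2 / s) * k (s / 2) < (1 - c) * k s"
    by (rule order_tendstoD(2))
  moreover have "\<forall>\<^sub>F p in at_right 1. (1 :: real) < p" by (rule eventually_at_right_less)
  ultimately show ?thesis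
  proof eventually_elim
    case (elim p)
    then have sp: "s \<le> s * p" "0 < s * p" using s by auto
    have "ennreal (k s) \<le> ennreal (k (s * p)) + ennreal ((s * p - s) * (2 / s)) * ennreal (k (s / 2))"
      using half_space_mass_ge[OF e s sp(1)] s sp by (simp add: k)
    also have "\<dots> = ennreal (k (s * p) + (s * p - s) * (2 / s) * k (s / 2))"
      using k(2)[OF sp(2)] k(2)[of "s / 2"] s sp by (simp add: ennreal_mult''[symmetric] ennreal_plus[symmetric] del: ennreal_plus)
    finally have "k s \<le> k (s * p) + (s * p - s) * (2 / s) * k (s / 2)"
      using k(2)[OF sp(2)] k(2)[of "s / 2"] s sp by (subst (asm) ennreal_le_iff) auto
    then have "c * k s \<le> k (s * p)" using elim by (simp add: algebra_simps)
    then have "ennreal (c * k s) \<le> ennreal (k (s * p))" by (rule ennreal_leI)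
    then show ?case using k(1)[OF s] k(1)[OF sp(2)] k(2)[OF s] by (simp add: ennreal_mult'')
  qed
qed

lemma eventually_hardy_const_convex_ge:
  fixes \<Omega> :: "(real ^ 'n) set" and e :: "real ^ 'n"
  assumes \<Omega>: "open \<Omega>" "\<Omega> \<noteq> UNIV" "convex \<Omega>" and e: "norm e = 1" and s: "0 < s" and c: "c < 2"
  shows "\<forall>\<^sub>F p in at_right 1. ennreal c * half_space_mass e s \<le> hardy_const s p \<Omega>"
proof -
  have "\<forall>\<^sub>F p in at_right 1. ennreal (c / 2) * half_space_mass e s \<le> half_space_mass e (s * p)"
    by (rule eventually_half_space_mass_ge) (use e s c in auto)
  then show ?thesis
  proof eventually_elim
    case (elim p)
    have "ennreal c = 2 * ennreal (c / 2)"
      using ennreal_mult'[of 2 "c / 2"] by simp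
    then have "ennreal c * half_space_mass e s = 2 * (ennreal (c / 2) * half_space_mass e s)"
      by (simp add: mult.assoc)
    also have "\<dots> \<le> 2 * half_space_mass e (s * p)" using elim by (intro mult_left_mono) auto
    also have "\<dots> \<le> hardy_const s p \<Omega>" using hardy_const_convex_ge[OF \<Omega> e] .
    finally show ?case .
  qed
qed

text \<open>In the limit \<open>p \<rightarrow> 1\<close> the lower bound for the half-space is \<open>4\<close> times the mass up to a loss of at most
  \<open>2 * \<epsilon> powr (1 - s)\<close>.\<close>

lemma eventually_hardy_const_half_space_ge:
  fixes k :: "'n::finite" and e :: "real ^ 'n"
  assumes e: "norm e = 1" and s: "0 < s" "s < 1" and c: "0 < c" "c < 4"
  shows "\<forall>\<^sub>F p in at_right 1. ennreal c * half_space_mass e s \<le> hardy_const s p (half_space k :: (real ^ 'n) set)"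
proof -
  define c' where "c' = (c + 4) / 2"
  have c': "c < c'" "c' < 4" using c by (auto simp: c'_def)
  \<comment> \<open>makes the loss \<open>2 * \<epsilon> powr (1 - s)\<close> equal to \<open>(4 - c') / 2\<close>\<close>
  define \<epsilon> where "\<epsilon> = ((4 - c') / 4) powr (1 / (1 - s))"
  have \<epsilon>: "0 < \<epsilon>" "\<epsilon> powr (1 - s) = (4 - c') / 4" using c' s by (auto simp: \<epsilon>_def powr_powr)
  \<comment> \<open>the coefficient of the half-space mass in the lower bound\<close>
  define a where "a p = 4 + 2 * 2 powr (1 - p) * \<epsilon> powr - (s * p) - 2 * (\<epsilon> / (1 + \<epsilon>)) powr - (s * p)" for p
  have lim: "(a \<longlongrightarrow> 4 + 2 * 2 powr (1 - 1) * \<epsilon> powr - (s * 1) - 2 * (\<epsilon> / (1 + \<epsilon>)) powr - (s * 1)) (at_right 1)"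
    unfolding a_def using \<epsilon> by (intro tendsto_intros) auto
  have "c' < 4 + 2 * 2 powr (1 - 1) * \<epsilon> powr - (s * 1) - 2 * (\<epsilon> / (1 + \<epsilon>)) powr - (s * 1)"
  proof -
    have "(\<epsilon> / (1 + \<epsilon>)) powr - s = \<epsilon> powr - s * (1 + \<epsilon>) powr s"
      using \<epsilon> by (simp add: powr_divide powr_minus divide_simps)
    also have "\<dots> \<le> \<epsilon> powr - s * (1 + \<epsilon>) powr 1"
      using \<epsilon> s by (intro mult_left_mono powr_mono) auto
    also have "\<dots> = \<epsilon> powr - s + \<epsilon> powr (1 - s)"
      using \<epsilon> by (simp add: distrib_left powr_diff powr_minus divide_simps)
    finally have "(\<epsilon> / (1 + \<epsilon>)) powr - s \<le> \<epsilon> powr - s + (4 - c') / 4" by (simp only: \<epsilon>(2))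
    moreover have "c' < 4 + 2 * E - 2 * X" if "X \<le> E + (4 - c') / 4" for E X :: real
      using that c'(2) by argo
    ultimately show ?thesis by simp
  qed
  with lim have "\<forall>\<^sub>F p in at_right 1. c' < a p" by (rule order_tendstoD(1))
  moreover have "\<forall>\<^sub>F p in at_right 1. ennreal (c / c') * half_space_mass e s \<le> half_space_mass e (s * p)"
    by (rule eventually_half_space_mass_ge) (use e s c c' in auto)
  moreover have "\<forall>\<^sub>F p in at_right 1. (1 :: real) < p" by (rule eventually_at_right_less)
  ultimately show ?thesis
  proof eventually_elim
    case (elim p)
    define \<kappa> where "\<kappa> = half_space_mass e (s * p)"
    define b where "b = 2 * (\<epsilon> / (1 + \<epsilon>)) powr - (s * p)"
    have \<kappa>: "\<kappa> < \<infinity>" unfolding \<kappa>_def using e s elim by (intro half_space_mass_finite) auto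
    have "ennreal c' * \<kappa> + ennreal b * \<kappa> = ennreal (c' + b) * \<kappa>"
      using c c' by (simp add: b_def ennreal_plus distrib_right)
    also have "\<dots> \<le> ennreal (4 + 2 * 2 powr (1 - p) * \<epsilon> powr - (s * p)) * \<kappa>"
      using elim by (intro mult_right_mono ennreal_leI) (auto simp: a_def b_def)
    also have "\<dots> \<le> hardy_const s p (half_space k :: (real ^ 'n) set) + ennreal b * \<kappa>"
      unfolding \<kappa>_def b_def by (rule hardy_const_half_space_ge) (use elim s \<epsilon> e in auto)
    finally have "ennreal c' * \<kappa> \<le> hardy_const s p (half_space k :: (real ^ 'n) set)"
      using \<kappa> by (auto simp: ennreal_mult_eq_top_iff add.commute[of _ "ennreal b * \<kappa>"])
    moreover have "ennreal c * half_space_mass e s \<le> ennreal c' * \<kappa>"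
    proof -
      have "ennreal c = ennreal c' * ennreal (c / c')"
        using c c' by (simp add: ennreal_mult''[symmetric])
      then have "ennreal c * half_space_mass e s = ennreal c' * (ennreal (c / c') * half_space_mass e s)"
        by (simp add: mult.assoc)
      also have "\<dots> \<le> ennreal c' * \<kappa>" using elim unfolding \<kappa>_def by (intro mult_left_mono) auto
      finally show ?thesis .
    qed
    ultimately show ?case by (rule order_trans[rotated])
  qed
qed

lemma ennreal_quotient_le:
  assumes x: "x \<le> ennreal A * ennreal k" and y: "ennreal B * ennreal k \<le> y" and pos: "0 \<le> A" "0 < B" "0 < k"
  shows "x / y \<le> ennreal (A / B)"
proof (cases y)
  case (real b)
  have b: "B * k \<le> b" using y real pos by (simp add: ennreal_mult''[symmetric] ennreal_le_iff)
  then have "0 < b" using pos by (smt (verit) mult_pos_pos)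
  have "x \<le> ennreal (A * k)" using x pos by (simp add: ennreal_mult'')
  then have "x / y \<le> ennreal (A * k) / ennreal b"
    unfolding real(2) by (rule divide_right_mono_ennreal)
  also have "\<dots> = ennreal (A * k / b)" using pos \<open>0 < b\<close> by (simp add: divide_ennreal)
  also have "\<dots> \<le> ennreal (A * k / (B * k))"
    using b pos \<open>0 < b\<close> by (intro ennreal_leI divide_left_mono mult_pos_pos) auto
  finally show ?thesis using pos by simp
qed simp

lemma ennreal_quotient_ge:
  assumes x: "ennreal A * ennreal k \<le> x" and y: "y \<le> ennreal B * ennreal k" and pos: "0 \<le> A" "0 < B" "0 < k"
  shows "ennreal (A / B) \<le> x / y"
proof (cases "y = 0")
  case True
  show ?thesis
  proof (cases "A = 0")
    case False
    then have "0 < ennreal A * ennreal k" using pos by (simp add: ennreal_zero_less_mult_iff)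
    then have "x \<noteq> 0" using x by auto
    then show ?thesis using True by (simp add: ennreal_divide_zero)
  qed simp
next
  case False
  then obtain b where b: "y = ennreal b" "0 < b" "b \<le> B * k"
    using y pos by (cases y) (auto simp: ennreal_mult''[symmetric] ennreal_le_iff top_unique)
  have "ennreal (A / B) = ennreal (A * k / (B * k))" using pos by simp
  also have "\<dots> \<le> ennreal (A * k / b)"
    using b pos by (intro ennreal_leI divide_left_mono) auto
  also have "\<dots> = ennreal (A * k) / ennreal b" using b pos by (simp add: divide_ennreal)
  also have "\<dots> \<le> x / y" unfolding b(1) using x pos
    by (intro divide_right_mono_ennreal) (simp add: ennreal_mult'')
  finally show ?thesis .
qed

theorem corollary1p3:
  fixes \<Omega> :: "(real ^ 'n) set" and k :: 'n
  assumes "\<Omega> \<noteq> {}" and "\<Omega> \<noteq> UNIV" and "open \<Omega>" and "bounded \<Omega>" and "convex \<Omega>"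
  shows "((\<lambda>s. Limsup (at_right 1) (\<lambda>p. hardy_const s p \<Omega> / hardy_const s p (half_space k)))
           \<longlongrightarrow> ennreal (1 / 2)) (at_left 1)"
proof -
  let ?H = "half_space k :: (real ^ 'n) set"
  let ?R = "\<lambda>s p. hardy_const s p \<Omega> / hardy_const s p ?H"
  let ?L = "\<lambda>s. Limsup (at_right 1) (?R s)"
  define e :: "real ^ 'n" where "e = axis k 1"
  have e: "norm e = 1" by (simp add: e_def)
  have H_ne: "?H \<noteq> UNIV"
  proof -
    have "(0 :: real ^ 'n) \<notin> ?H" by (simp add: half_space_def)
    then show ?thesis by blast
  qed
  have mass: "\<exists>\<kappa> > 0. half_space_mass e s = ennreal \<kappa>" if "0 < s" for s
    using half_space_mass_finite[OF that e] half_space_mass_pos[OF e, of s]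
    by (cases "half_space_mass e s") auto
  have near: "\<forall>\<^sub>F s in at_left 1. 0 < s \<and> s < (1 :: real)"
    using eventually_at_left_real[of 0 "1 :: real"] by simp
  have upper_\<Omega>: "\<forall>\<^sub>F s in at_left 1. \<forall>\<^sub>F p in at_right 1. hardy_const s p \<Omega> \<le> ennreal (2 * c) * half_space_mass e s"
    if c1: "1 < c" for c
  proof -
    obtain m M T where m: "0 < m" "0 \<le> M" and T: "0 < T" and c: "M / m < c"
      and layers: "\<And>\<epsilon>. 0 < \<epsilon> \<Longrightarrow> \<exists>\<delta>. 0 < \<delta> \<and> \<delta> < \<epsilon> \<and> deep_layers \<Omega> \<Omega> m M T \<delta>"
      by (rule exists_deep_layers_convex[OF assms(1,3,4,5) c1]) (rule that)
    show ?thesis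
      by (rule eventually_hardy_const_le[OF assms(3,4) subset_refl assms(3,2) e m T c layers])
  qed
  have upper_H: "\<forall>\<^sub>F s in at_left 1. \<forall>\<^sub>F p in at_right 1. hardy_const s p ?H \<le> ennreal (2 * c) * half_space_mass e s"
    if c2: "2 < c" for c
  proof -
    obtain K M T where K: "open K" "bounded K" "K \<subseteq> ?H" and M: "0 \<le> M" and T: "0 < T" and c: "M / 1 < c"
      and layers: "\<And>\<epsilon>. 0 < \<epsilon> \<Longrightarrow> \<exists>\<delta>. 0 < \<delta> \<and> \<delta> < \<epsilon> \<and> deep_layers K ?H 1 M T \<delta>"
      by (rule exists_deep_layers_half_space[OF c2, where k = k]) (rule that)
    show ?thesis
      by (rule eventually_hardy_const_le[OF K open_half_space H_ne e zero_less_one M T c layers])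
  qed
  show ?thesis
  proof (rule order_tendstoI)
    fix a :: ennreal assume "ennreal (1 / 2) < a"
    then obtain b where b: "ennreal (1 / 2) < b" "b < a" using dense by blast
    have "b \<noteq> top" using b(2) by auto
    then obtain q where "b = ennreal q" by (cases b) auto
    with b(1) have q: "b = ennreal q" "1 / 2 < q" using ennreal_less_iff[of "1 / 2" q] by simp_all
    \<comment> \<open>the quotient of the bounds for \<open>\<Omega>\<close> and the half-space, with tolerance \<open>\<eta>\<close>\<close>
    have "((\<lambda>\<eta>. (2 * (1 + \<eta>)) / (4 - \<eta>)) \<longlongrightarrow> (2 * (1 + 0)) / (4 - 0)) (at_right (0 :: real))"
      by (intro tendsto_intros) auto
    then have "\<forall>\<^sub>F \<eta> in at_right (0 :: real). (2 * (1 + \<eta>)) / (4 - \<eta>) < q"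
      using q(2) by (intro order_tendstoD(2)) auto
    then have "\<forall>\<^sub>F \<eta> in at_right (0 :: real). (2 * (1 + \<eta>)) / (4 - \<eta>) < q \<and> 0 < \<eta> \<and> \<eta> < 1"
      using eventually_at_right_real[of 0 "1 :: real"] by (simp add: eventually_conj_iff)
    then obtain \<eta> :: real where \<eta>: "(2 * (1 + \<eta>)) / (4 - \<eta>) < q" "0 < \<eta>" "\<eta> < 1"
      using eventually_happens'[OF trivial_limit_at_right_real] by blast
    have "1 < 1 + \<eta>" using \<eta> by simp
    from upper_\<Omega>[OF this] near show "\<forall>\<^sub>F s in at_left 1. ?L s < a"
    proof eventually_elim
      case (elim s)
      obtain \<kappa> where \<kappa>: "0 < \<kappa>" "half_space_mass e s = ennreal \<kappa>" using mass elim by blast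
      have "\<forall>\<^sub>F p in at_right 1. ennreal (4 - \<eta>) * half_space_mass e s \<le> hardy_const s p ?H"
        by (rule eventually_hardy_const_half_space_ge) (use elim \<eta> e in auto)
      with elim(1) have "\<forall>\<^sub>F p in at_right 1. ?R s p \<le> b"
      proof eventually_elim
        case (elim p)
        have "?R s p \<le> ennreal ((2 * (1 + \<eta>)) / (4 - \<eta>))"
          by (rule ennreal_quotient_le[where k = \<kappa>]) (use elim \<kappa> \<eta> in auto)
        also have "\<dots> \<le> b" unfolding q(1) using \<eta> by (intro ennreal_leI) auto
        finally show ?case .
      qed
      then have "?L s \<le> b" by (rule Limsup_bounded)
      from this b(2) show ?case by (rule le_less_trans)
    qed
  next
    fix a :: ennreal assume "a < ennreal (1 / 2)"
    then have "a \<noteq> top" by auto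
    then obtain q where "a = ennreal q" "0 \<le> q" by (cases a) auto
    with \<open>a < ennreal (1 / 2)\<close> have q: "a = ennreal q" "q < 1 / 2" "0 \<le> q"
      using ennreal_less_iff[of q "1 / 2"] by simp_all
    have "((\<lambda>\<eta>. (2 - \<eta>) / (2 * (2 + \<eta>))) \<longlongrightarrow> (2 - 0) / (2 * (2 + 0))) (at_right (0 :: real))"
      by (intro tendsto_intros) auto
    then have "\<forall>\<^sub>F \<eta> in at_right (0 :: real). q < (2 - \<eta>) / (2 * (2 + \<eta>))"
      using q(2) by (intro order_tendstoD(1)) auto
    then have "\<forall>\<^sub>F \<eta> in at_right (0 :: real). q < (2 - \<eta>) / (2 * (2 + \<eta>)) \<and> 0 < \<eta> \<and> \<eta> < 1"
      using eventually_at_right_real[of 0 "1 :: real"] by (simp add: eventually_conj_iff)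
    then obtain \<eta> :: real where \<eta>: "q < (2 - \<eta>) / (2 * (2 + \<eta>))" "0 < \<eta>" "\<eta> < 1"
      using eventually_happens'[OF trivial_limit_at_right_real] by blast
    have "2 < 2 + \<eta>" using \<eta> by simp
    from upper_H[OF this] near show "\<forall>\<^sub>F s in at_left 1. a < ?L s"
    proof eventually_elim
      case (elim s)
      obtain \<kappa> where \<kappa>: "0 < \<kappa>" "half_space_mass e s = ennreal \<kappa>" using mass elim by blast
      have "\<forall>\<^sub>F p in at_right 1. ennreal (2 - \<eta>) * half_space_mass e s \<le> hardy_const s p \<Omega>"
        by (rule eventually_hardy_const_convex_ge) (use elim \<eta> e assms in auto)
      with elim(1) have "\<forall>\<^sub>F p in at_right 1. ennreal ((2 - \<eta>) / (2 * (2 + \<eta>))) \<le> ?R s p"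
      proof eventually_elim
        case (elim p)
        show ?case
          by (rule ennreal_quotient_ge[where k = \<kappa>]) (use elim \<kappa> \<eta> in auto)
      qed
      then have "ennreal ((2 - \<eta>) / (2 * (2 + \<eta>))) \<le> ?L s"
        by (intro le_Limsup) auto
      moreover have "a < ennreal ((2 - \<eta>) / (2 * (2 + \<eta>)))"
        unfolding q(1) using \<eta> q by (intro ennreal_lessI) auto
      ultimately show ?case by (rule less_le_trans[rotated])
    qed
  qed
qed

end
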